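(* Let $\theta\in(0,\infty)$. (i) Assuming $y\in L^{2p}(0,T;\mathbb{R}^r)$ with an integer $1\le p<\infty$, it holds $\widehat{x}_\theta\in W^{1,p}(0,T;\mathbb{R}^n)$. (ii) For $y\in C([0,T];\mathbb{R}^r)$ it holds $\widehat{x}_\theta\in C^1([0,T];\mathbb{R}^n)$. In both settings the (weak) derivative is given by the formula $$\dot{\widehat{x}}_\theta(t)=-M(t,\widehat{x}_\theta(t))^{-1}\,V(t,\widehat{x}_\theta(t)),$$ where $$M(t,x)=\sum_{k=1}^N e^{\theta\mathcal{V}_k(t,x)}\left(P_k(t)+2\theta\,P_k(t)\,(x-\widehat{x}_k(t))\otimes(x-\widehat{x}_k(t))\,P_k(t)\right)$$ and $$\begin{aligned}V(t,x)=&-\sum_{k=1}^N e^{\theta\mathcal{V}_k(t,x)}\left(P_k(t)\dot{\widehat{x}}_k(t)-\dot P_k(t)(x-\widehat{x}_k(t))\right)\\&+\theta\sum_{k=1}^N e^{\theta\mathcal{V}_k(t,x)}\left(\|y(t)-C\widehat{x}_k(t)\|_{Q_k^{-1}}^2-2\langle x-\widehat{x}_k(t),P_k(t)\dot{\widehat{x}}_k(t)\rangle\right)P_k(t)(x-\widehat{x}_k(t)).\end{aligned}$$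
   Context: Setting. Fix $T>0$, $n,m,r\in\mathbb{N}$, $B\in\mathbb{R}^{n\times m}$, $C\in\mathbb{R}^{r\times n}$, $x_0\in\mathbb{R}^n$ and a measured output $y\in L^2(0,T;\mathbb{R}^r)$. $\|\cdot\|$ and $\langle\cdot,\cdot\rangle$ are the Euclidean norm and inner product, $a\otimes b=ab^\top$ for $a,b\in\mathbb{R}^n$, and $\|x\|_M^2=x^\top M x$ for a symmetric positive definite matrix $M$. Let $\Sigma=\Sigma_A\times\Sigma_\Gamma\times\Sigma_R\times\Sigma_Q$ be a product of finite nonempty sets, $\Sigma=\{\sigma_1,\dots,\sigma_N\}$, $N=|\Sigma|$. To each $\sigma=(\sigma_A,\sigma_\Gamma,\sigma_R,\sigma_Q)$ are assigned matrices $A_\sigma\in\mathbb{R}^{n\times n}$ (depending on $\sigma_A$ only) and symmetric positive definite matrices $\Gamma_\sigma\in\mathbb{R}^{n\times n}$, $R_\sigma\in\mathbb{R}^{m\times m}$, $Q_\sigma\in\mathbb{R}^{r\times r}$ (depending only on $\sigma_\Gamma$, $\sigma_R$, $\sigma_Q$ respectively). Index $k$ means $\sigma=\sigma_k$. For each $k$, $\Pi_k$ is the unique solution on $[0,T]$ of $\dot\Pi_k = A_k\Pi_k+\Pi_kA_k^\top-\Pi_kC^\top Q_k^{-1}C\Pi_k+BR_kB^\top$, $\Pi_k(0)=\Gamma_k$ (symmetric positive definite for all $t$), $P_k(t)=\Pi_k(t)^{-1}$ (infinitely differentiable in $t$), and $\widehat{x}_k\in H^1(0,T;\mathbb{R}^n)$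 solves $\dot{\widehat{x}}_k=A_k\widehat{x}_k+\Pi_kC^\top Q_k^{-1}(y-C\widehat{x}_k)$, $\widehat{x}_k(0)=x_0$. Set $r_k(t)=\int_0^t\|y(s)-C\widehat{x}_k(s)\|_{Q_k^{-1}}^2\,ds$ and $\mathcal{V}_k(t,x)=\|x-\widehat{x}_k(t)\|_{P_k(t)}^2+r_k(t)$. For $\theta\in(0,\infty)$ and $t\in[0,T]$, $\widehat{x}_\theta(t)$ is the unique minimizer over $x\in\mathbb{R}^n$ of $\frac1\theta\ln\left(\frac1N\sum_{k=1}^Ne^{\theta\mathcal{V}_k(t,x)}\right)$.
   Formalization: The formula for V(t,x) is false as printed; in its second sum the bracket is corrected by adding the missing term ⟨x−x̂_k(t), Ṗ_k(t)(x−x̂_k(t))⟩, which comes from the time dependence of P_k in the time derivative of 𝒱_k. *)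

theory Defs
  imports "HOL-Analysis.Analysis"
begin

section \<open>Function spaces on a bounded interval\<close>

text \<open>Elements of \<open>L\<^sup>p(0,T)\<close> and \<open>W\<^sup>1\<^sup>,\<^sup>p(0,T)\<close> are represented by functions on the reals
  of which only the values on the open interval matter (up to null sets).\<close>

definition Lp_space :: "real \<Rightarrow> nat \<Rightarrow> (real \<Rightarrow> 'a::euclidean_space) set" where
  "Lp_space T p = {f. f \<in> borel_measurable (lebesgue_on {0<..<T}) \<and>
                      integrable (lebesgue_on {0<..<T}) (\<lambda>t. norm (f t) ^ p)}"

definition locally_integrable :: "real \<Rightarrow> (real \<Rightarrow> 'a::euclidean_space) \<Rightarrow> bool" where
  "locally_integrable T f \<longleftrightarrow>
     (\<forall>K. compact K \<and> K \<subseteq> {0<..<T} \<longrightarrow> integrable (lebesgue_on K) f)"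

definition test_functions :: "real \<Rightarrow> (real \<Rightarrow> real) set" where
  "test_functions T = {\<phi>. (\<forall>k t. ((deriv ^^ k) \<phi>) differentiable (at t)) \<and>
     (\<exists>K. compact K \<and> K \<subseteq> {0<..<T} \<and> (\<forall>t. t \<notin> K \<longrightarrow> \<phi> t = 0))}"

definition has_weak_derivative ::
    "real \<Rightarrow> (real \<Rightarrow> 'a::euclidean_space) \<Rightarrow> (real \<Rightarrow> 'a) \<Rightarrow> bool" where
  "has_weak_derivative T f g \<longleftrightarrow> locally_integrable T f \<and> locally_integrable T g \<and>
     (\<forall>\<phi>\<in>test_functions T.
        (LINT t|lebesgue_on {0<..<T}. deriv \<phi> t *\<^sub>R f t) =
        - (LINT t|lebesgue_on {0<..<T}. \<phi> t *\<^sub>R g t))"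

definition W1p_space :: "real \<Rightarrow> nat \<Rightarrow> (real \<Rightarrow> 'a::euclidean_space) set" where
  "W1p_space T p = {f \<in> Lp_space T p. \<exists>g\<in>Lp_space T p. has_weak_derivative T f g}"

text \<open>The library predicate \<^term>\<open>(C1_differentiable_on)\<close> asks for two-sided derivatives, which is
  not what \<open>C\<^sup>1([0,T])\<close> means at the end points; hence \<open>at t within {0..T}\<close>.\<close>

definition C1_space :: "real \<Rightarrow> (real \<Rightarrow> 'a::euclidean_space) set" where
  "C1_space T = {f. \<exists>D. (\<forall>t\<in>{0..T}. (f has_vector_derivative D t) (at t within {0..T})) \<and>
                        continuous_on {0..T} D}"

section \<open>Matrices\<close>

definition sym_pos_def :: "real^'n^'n \<Rightarrow> bool" where
  "sym_pos_def M \<longleftrightarrow> transpose M = M \<and> (\<forall>x. x \<noteq> 0 \<longrightarrow> 0 < x \<bullet> (M *v x))"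

definition wnorm_sq :: "real^'n^'n \<Rightarrow> real^'n \<Rightarrow> real" where
  "wnorm_sq M x = x \<bullet> (M *v x)"

definition outer :: "real^'n \<Rightarrow> real^'n \<Rightarrow> real^'n^'n" (infixl \<open>\<otimes>\<^sub>o\<close> 75) where
  "a \<otimes>\<^sub>o b = (\<chi> i j. a $ i * b $ j)"

section \<open>The filters for the individual parameters\<close>

definition riccati_solution ::
    "real \<Rightarrow> real^'n^'n \<Rightarrow> real^'m^'n \<Rightarrow> real^'n^'r \<Rightarrow> real^'n^'n \<Rightarrow> real^'m^'m \<Rightarrow> real^'r^'r \<Rightarrow>
     (real \<Rightarrow> real^'n^'n) \<Rightarrow> bool" where
  "riccati_solution T A B C \<Gamma> R Q \<Pi>k \<longleftrightarrow> \<Pi>k 0 = \<Gamma> \<and>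
     (\<forall>t\<in>{0..T}. (\<Pi>k has_vector_derivative
        A ** \<Pi>k t + \<Pi>k t ** transpose A
        - \<Pi>k t ** transpose C ** matrix_inv Q ** C ** \<Pi>k t
        + B ** R ** transpose B) (at t within {0..T}))"

text \<open>Continuity on \<open>[0,T]\<close> selects the continuous representative of the \<open>H\<^sup>1\<close> function, without
  which the initial condition would be meaningless. As \<open>y\<close> is only square integrable, the
  differential equation is understood in the weak sense.\<close>

definition filter_solution ::
    "real \<Rightarrow> real^'n^'n \<Rightarrow> real^'n^'r \<Rightarrow> real^'r^'r \<Rightarrow> real^'n \<Rightarrow> (real \<Rightarrow> real^'r) \<Rightarrow>
     (real \<Rightarrow> real^'n^'n) \<Rightarrow> (real \<Rightarrow> real^'n) \<Rightarrow> bool" where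
  "filter_solution T A C Q x\<^sub>0 y \<Pi>k xh \<longleftrightarrow>
     xh \<in> W1p_space T 2 \<and> continuous_on {0..T} xh \<and> xh 0 = x\<^sub>0 \<and>
     has_weak_derivative T xh
       (\<lambda>t. A *v xh t + (\<Pi>k t ** transpose C ** matrix_inv Q) *v (y t - C *v xh t))"

definition residual ::
    "real^'n^'r \<Rightarrow> real^'r^'r \<Rightarrow> (real \<Rightarrow> real^'r) \<Rightarrow> (real \<Rightarrow> real^'n) \<Rightarrow> real \<Rightarrow> real" where
  "residual C Q y xh t =
     (LINT s|lebesgue_on {0..t}. wnorm_sq (matrix_inv Q) (y s - C *v xh s))"

definition value_fun ::
    "real^'n^'r \<Rightarrow> real^'r^'r \<Rightarrow> (real \<Rightarrow> real^'r) \<Rightarrow> (real \<Rightarrow> real^'n^'n) \<Rightarrow> (real \<Rightarrow> real^'n) \<Rightarrow>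
     real \<Rightarrow> real^'n \<Rightarrow> real" where
  "value_fun C Q y P xh t x = wnorm_sq (P t) (x - xh t) + residual C Q y xh t"

section \<open>The combined estimator\<close>

text \<open>The parameter tuples themselves serve as index set, in place of an enumeration
  \<open>\<sigma>\<^sub>1, \<dots>, \<sigma>\<^sub>N\<close> of them.\<close>

abbreviation \<sigma>A :: "'sa \<times> 'sg \<times> 'sr \<times> 'sq \<Rightarrow> 'sa" where "\<sigma>A \<sigma> \<equiv> fst \<sigma>"
abbreviation \<sigma>\<Gamma> :: "'sa \<times> 'sg \<times> 'sr \<times> 'sq \<Rightarrow> 'sg" where "\<sigma>\<Gamma> \<sigma> \<equiv> fst (snd \<sigma>)"
abbreviation \<sigma>R :: "'sa \<times> 'sg \<times> 'sr \<times> 'sq \<Rightarrow> 'sr" where "\<sigma>R \<sigma> \<equiv> fst (snd (snd \<sigma>))"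
abbreviation \<sigma>Q :: "'sa \<times> 'sg \<times> 'sr \<times> 'sq \<Rightarrow> 'sq" where "\<sigma>Q \<sigma> \<equiv> snd (snd (snd \<sigma>))"

definition soft_max_cost ::
    "real \<Rightarrow> 's set \<Rightarrow> ('s \<Rightarrow> real \<Rightarrow> real^'n \<Rightarrow> real) \<Rightarrow> real \<Rightarrow> real^'n \<Rightarrow> real" where
  "soft_max_cost \<theta> S \<V> t x =
     1 / \<theta> * ln (1 / real (card S) * (\<Sum>\<sigma>\<in>S. exp (\<theta> * \<V> \<sigma> t x)))"

definition estimator ::
    "real \<Rightarrow> 's set \<Rightarrow> ('s \<Rightarrow> real \<Rightarrow> real^'n \<Rightarrow> real) \<Rightarrow> real \<Rightarrow> real^'n" where
  "estimator \<theta> S \<V> t = (THE x. is_arg_min (soft_max_cost \<theta> S \<V> t) (\<lambda>_. True) x)"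

definition M_mat ::
    "real \<Rightarrow> 's set \<Rightarrow> ('s \<Rightarrow> real \<Rightarrow> real^'n \<Rightarrow> real) \<Rightarrow> ('s \<Rightarrow> real \<Rightarrow> real^'n^'n) \<Rightarrow>
     ('s \<Rightarrow> real \<Rightarrow> real^'n) \<Rightarrow> real \<Rightarrow> real^'n \<Rightarrow> real^'n^'n" where
  "M_mat \<theta> S \<V> P xh t x =
     (\<Sum>\<sigma>\<in>S. exp (\<theta> * \<V> \<sigma> t x) *\<^sub>R
        (P \<sigma> t + (2 * \<theta>) *\<^sub>R (P \<sigma> t ** ((x - xh \<sigma> t) \<otimes>\<^sub>o (x - xh \<sigma> t)) ** P \<sigma> t)))"

text \<open>\<open>P'\<close> and \<open>xh'\<close> stand for the time derivatives of \<open>P\<close> and \<open>xh\<close>. They are separate arguments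
  because the derivative of \<open>xh\<close> is weak or classical depending on the regularity of \<open>y\<close>.

  Erratum: the second sum contains the summand \<open>(x - xh) \<bullet> (P' *v (x - xh))\<close>, which is missing from
  the published formula. The second bracket is the time derivative of \<open>value_fun\<close>, and this
  summand comes from the time dependence of the weight \<open>P\<close>. Without it the derivative formula for
  the estimator is false, for example for scalar data \<open>B = C = 0\<close>, \<open>y = 0\<close>, \<open>x\<^sub>0 = \<Gamma> = \<theta> = 1\<close> and
  \<open>A \<in> {0, 1}\<close>.\<close>

definition V_vec ::
    "real \<Rightarrow> 's set \<Rightarrow> real^'n^'r \<Rightarrow> ('s \<Rightarrow> real^'r^'r) \<Rightarrow> (real \<Rightarrow> real^'r) \<Rightarrow>
     ('s \<Rightarrow> real \<Rightarrow> real^'n \<Rightarrow> real) \<Rightarrow>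
     ('s \<Rightarrow> real \<Rightarrow> real^'n^'n) \<Rightarrow> ('s \<Rightarrow> real \<Rightarrow> real^'n^'n) \<Rightarrow>
     ('s \<Rightarrow> real \<Rightarrow> real^'n) \<Rightarrow> ('s \<Rightarrow> real \<Rightarrow> real^'n) \<Rightarrow> real \<Rightarrow> real^'n \<Rightarrow> real^'n" where
  "V_vec \<theta> S C Q y \<V> P P' xh xh' t x =
     - (\<Sum>\<sigma>\<in>S. exp (\<theta> * \<V> \<sigma> t x) *\<^sub>R
          (P \<sigma> t *v xh' \<sigma> t - P' \<sigma> t *v (x - xh \<sigma> t)))
     + \<theta> *\<^sub>R (\<Sum>\<sigma>\<in>S.
          (exp (\<theta> * \<V> \<sigma> t x) *
            (wnorm_sq (matrix_inv (Q \<sigma>)) (y t - C *v xh \<sigma> t)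
             - 2 * ((x - xh \<sigma> t) \<bullet> (P \<sigma> t *v xh' \<sigma> t))
             + (x - xh \<sigma> t) \<bullet> (P' \<sigma> t *v (x - xh \<sigma> t)))) *\<^sub>R
          (P \<sigma> t *v (x - xh \<sigma> t)))"

end

theory Submission
  imports Defs
begin

text \<open>Up to the positive factor \<open>2 \<theta>\<close>, the gradient in \<open>x\<close> of \<open>\<Sum>\<^sub>k exp (\<theta> V\<^sub>k(t,x))\<close> is
\<open>G(t,x) = \<Sum>\<^sub>k exp (\<theta> V\<^sub>k(t,x)) P\<^sub>k(t) (x - xh\<^sub>k(t))\<close>. The matrix \<open>M\<close> is the derivative of \<open>G\<close> in
\<open>x\<close> and the vector \<open>V\<close> is its derivative in \<open>t\<close>, so that differentiating \<open>G(t, x(t)) = 0\<close> gives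
\<open>M x' + V = 0\<close>. As \<open>V\<^sub>k \<ge> 0\<close>, each weight is at least \<open>1\<close>, and positive definiteness of the \<open>P\<^sub>k\<close> yields
\<open>h \<bullet> M h \<ge> c \<bar>h\<bar>\<^sup>2\<close> with one \<open>c > 0\<close> for all \<open>t\<close> and \<open>x\<close> (\<open>M_coercive\<close>). This bound carries most
of the proof: it makes \<open>M\<close> invertible, the zero of \<open>G(t, _)\<close> unique and hence equal to the minimizer
(\<open>estimator_root\<close>), and it turns a change of \<open>G\<close> into a bound on the movement of its zero.

If \<open>y\<close> is only square integrable, \<open>G\<close> is merely absolutely continuous in \<open>t\<close>. The predicate
\<open>has_density F f a b\<close> says that the increments of \<open>F\<close> on \<open>[a,b]\<close> are the integrals of \<open>f\<close>. By
\<open>has_densityI_local\<close> this may be tested near each point, up to errors that are small compared with the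
integral of a fixed function. Product rule, chain rule and the implicit function theorem
\<open>implicit_function_has_density\<close> thus become first-order estimates, and nothing has to be said about
differentiability almost everywhere.

A continuous function on \<open>[0,T]\<close> has the weak derivative \<open>g\<close> if and only if it has density \<open>g\<close> on the
compact subintervals of \<open>(0,T)\<close>: one direction is the product rule with a test function, the other
is the lemma of du Bois-Reymond. The implicit function theorem is then used twice. With the right-hand
sides of the filter equations it applies on all of \<open>[0,T]\<close>; the resulting density is at most
\<open>K (1 + \<bar>y\<bar>\<^sup>2)\<close>, so it lies in \<open>L\<^sup>p\<close> if \<open>y \<in> L\<^sup>2\<^sup>p\<close>, and it is continuous if \<open>y\<close> is. With arbitrary
weak derivatives of the \<open>xh\<^sub>k\<close> it applies on compact subintervals, which gives the formula for every
choice of representatives.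

That the \<open>P\<^sub>k\<close> exist, are positive definite and continuously differentiable rests on the Riccati
equation: a solution that starts symmetric and positive definite remains so (\<open>riccati_symmetric\<close>,
\<open>riccati_pos_def\<close>).\<close>

section \<open>Matrices and their inverses\<close>

lemma bounded_bilinear_mult_vec:
  "bounded_bilinear ((*v) :: real^'n^'m \<Rightarrow> real^'n \<Rightarrow> real^'m)"
  unfolding bilinear_conv_bounded_bilinear[symmetric] bilinear_def
  by (auto intro!: linearI simp: matrix_vector_right_distrib matrix_vector_mult_add_rdistrib
      matrix_vector_mult_scaleR scaleR_matrix_vector_assoc)

lemma bounded_bilinear_mult_mat:
  "bounded_bilinear ((**) :: real^'n^'m \<Rightarrow> real^'p^'n \<Rightarrow> real^'p^'m)"
  unfolding bilinear_conv_bounded_bilinear[symmetric] bilinear_def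
  by (auto intro!: linearI simp: matrix_add_ldistrib matrix_scalar_ac scalar_matrix_assoc
      matrix_matrix_mult_def vec_eq_iff algebra_simps sum.distrib sum_distrib_left)

lemma bounded_linear_transpose:
  "bounded_linear (transpose :: real^'n^'m \<Rightarrow> real^'m^'n)"
  unfolding linear_conv_bounded_linear[symmetric]
  by (auto intro!: linearI simp: transpose_def vec_eq_iff)

lemmas continuous_on_matrix_vector_mult [continuous_intros] =
  bounded_bilinear.continuous_on[OF bounded_bilinear_mult_vec]
lemmas continuous_on_matrix_matrix_mult [continuous_intros] =
  bounded_bilinear.continuous_on[OF bounded_bilinear_mult_mat]
lemmas continuous_on_transpose [continuous_intros] =
  bounded_linear.continuous_on[OF bounded_linear_transpose]

lemmas matrix_mult_algebra =
  bounded_bilinear.diff_left[OF bounded_bilinear_mult_mat]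
  bounded_bilinear.diff_right[OF bounded_bilinear_mult_mat]
  bounded_bilinear.add_left[OF bounded_bilinear_mult_mat]
  bounded_bilinear.add_right[OF bounded_bilinear_mult_mat]
  bounded_bilinear.minus_left[OF bounded_bilinear_mult_mat]
  bounded_bilinear.minus_right[OF bounded_bilinear_mult_mat]
  bounded_bilinear.scaleR_left[OF bounded_bilinear_mult_mat]
  bounded_bilinear.scaleR_right[OF bounded_bilinear_mult_mat]

lemmas matrix_vector_algebra =
  bounded_bilinear.diff_left[OF bounded_bilinear_mult_vec]
  bounded_bilinear.diff_right[OF bounded_bilinear_mult_vec]
  bounded_bilinear.add_left[OF bounded_bilinear_mult_vec]
  bounded_bilinear.add_right[OF bounded_bilinear_mult_vec]
  bounded_bilinear.minus_left[OF bounded_bilinear_mult_vec]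
  bounded_bilinear.minus_right[OF bounded_bilinear_mult_vec]
  bounded_bilinear.scaleR_left[OF bounded_bilinear_mult_vec]
  bounded_bilinear.scaleR_right[OF bounded_bilinear_mult_vec]

lemma inner_matrix_transpose:
  fixes M :: "real^'n^'m"
  shows "x \<bullet> (M *v z) = (transpose M *v x) \<bullet> z"
  by (simp add: dot_lmul_matrix[symmetric])

lemma inner_symmetric_matrix:
  fixes M :: "real^'n^'n"
  assumes "transpose M = M"
  shows "x \<bullet> (M *v z) = z \<bullet> (M *v x)"
  using inner_matrix_transpose[of x M z] assms by (simp add: inner_commute)

lemma outer_mult_vector: "(a \<otimes>\<^sub>o b) *v h = (b \<bullet> h) *\<^sub>R a"
  by (simp add: outer_def matrix_vector_mult_def vec_eq_iff inner_vec_def sum_distrib_left mult_ac)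

lemma matrix_inv_cancel:
  fixes M :: "real^'n^'n"
  assumes "invertible M"
  shows "M ** matrix_inv M = mat 1" "matrix_inv M ** M = mat 1"
  using assms someI_ex[of "\<lambda>B. M ** B = mat 1 \<and> B ** M = mat 1"]
  unfolding matrix_inv_def invertible_def by auto

lemma matrix_inv_vector_cancel:
  fixes M :: "real^'n^'n"
  assumes "invertible M"
  shows "M *v (matrix_inv M *v x) = x" "matrix_inv M *v (M *v x) = x"
  using matrix_inv_cancel[OF assms] by (simp_all add: matrix_vector_mul_assoc)

lemma coercive_imp_invertible:
  fixes M :: "real^'n^'n"
  assumes "\<And>x. x \<noteq> 0 \<Longrightarrow> 0 < x \<bullet> (M *v x)"
  shows "invertible M"
proof -
  have "x = 0" if "M *v x = 0" for x
    using assms[of x] that by force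
  then show ?thesis
    unfolding invertible_left_inverse matrix_left_invertible_ker by blast
qed

text \<open>Test the coercivity with \<open>x = M\<inverse> v\<close> and use the Cauchy-Schwarz inequality.\<close>

lemma norm_matrix_inv_le:
  fixes M :: "real^'n^'n"
  assumes c: "c > 0" and M: "\<And>x. c * (x \<bullet> x) \<le> x \<bullet> (M *v x)"
  shows "norm (matrix_inv M *v v) \<le> norm v / c"
proof -
  have inv: "invertible M"
    using M c by (intro coercive_imp_invertible) (smt (verit) inner_gt_zero_iff mult_pos_pos)
  define x where "x = matrix_inv M *v v"
  have "c * (norm x)\<^sup>2 \<le> norm x * norm v"
    using M[of x] norm_cauchy_schwarz[of x v] 
    by (simp add: x_def matrix_inv_vector_cancel[OF inv] power2_norm_eq_inner)
  then have "c * norm x \<le> norm v"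
    by (cases "norm x = 0") (auto simp: power2_eq_square mult.left_commute)
  then show ?thesis
    using c by (simp add: x_def field_simps)
qed

lemma sym_pos_def_invertible: "sym_pos_def M \<Longrightarrow> invertible M"
  by (simp add: sym_pos_def_def coercive_imp_invertible)

lemma sym_pos_def_matrix_inv:
  assumes "sym_pos_def M"
  shows "sym_pos_def (matrix_inv M)"
proof -
  note inv = sym_pos_def_invertible[OF assms]
  have "transpose (matrix_inv M) = transpose (matrix_inv M) ** (M ** matrix_inv M)"
    by (simp add: matrix_inv_cancel[OF inv])
  also have "\<dots> = transpose (transpose M ** matrix_inv M) ** matrix_inv M"
    by (simp add: matrix_transpose_mul matrix_mul_assoc)
  also have "\<dots> = matrix_inv M"
    using assms by (simp add: sym_pos_def_def matrix_inv_cancel[OF inv] transpose_mat)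
  finally have "transpose (matrix_inv M) = matrix_inv M" .
  moreover have "0 < x \<bullet> (matrix_inv M *v x)" if "x \<noteq> 0" for x
  proof -
    have "matrix_inv M *v x \<noteq> 0"
      using that matrix_inv_vector_cancel(1)[OF inv, of x] by force
    then have "0 < (matrix_inv M *v x) \<bullet> (M *v (matrix_inv M *v x))"
      using assms by (simp add: sym_pos_def_def)
    then show ?thesis
      by (simp add: matrix_inv_vector_cancel[OF inv] inner_commute)
  qed
  ultimately show ?thesis
    by (simp add: sym_pos_def_def)
qed

text \<open>The resolvent identity reduces continuity and differentiability of the inverse to those of the matrix.\<close>

lemma matrix_inv_diff:
  fixes M N :: "real^'n^'n"
  assumes "invertible M" "invertible N"
  shows "matrix_inv N - matrix_inv M = - (matrix_inv N ** (N - M) ** matrix_inv M)"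
proof -
  have "matrix_inv N ** (N - M) ** matrix_inv M
      = (matrix_inv N ** N) ** matrix_inv M - matrix_inv N ** (M ** matrix_inv M)"
    by (simp add: matrix_mult_algebra matrix_mul_assoc)
  then show ?thesis
    by (simp add: matrix_inv_cancel assms)
qed

lemma norm_matrix_triple_bound:
  obtains K where "K > 0"
    "\<And>(X::real^'n^'n) (Y::real^'n^'n) (Z::real^'n^'n).
        norm (X ** Y ** Z) \<le> norm X * norm Y * norm Z * K"
proof -
  obtain K where K: "K > 0"
    "\<And>(X::real^'n^'n) (Y::real^'n^'n). norm (X ** Y) \<le> norm X * norm Y * K"
    using bounded_bilinear.pos_bounded[OF bounded_bilinear_mult_mat] by blast
  have "norm (X ** Y ** Z) \<le> norm X * norm Y * norm Z * (K * K)" for X Y Z :: "real^'n^'n"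
  proof -
    have "norm (X ** Y ** Z) \<le> norm (X ** Y) * norm Z * K"
      by (rule K(2))
    also have "\<dots> \<le> (norm X * norm Y * K) * norm Z * K"
      using K by (intro mult_right_mono) auto
    finally show ?thesis
      by (simp add: mult_ac)
  qed
  with K(1) show thesis
    by (intro that[of "K * K"]) auto
qed

text \<open>By the resolvent identity \<open>\<bar>f(x)\<inverse> - A\<inverse>\<bar> \<le> q \<bar>f(x)\<inverse>\<bar>\<close> with \<open>q\<close> tending to \<open>0\<close>. As soon as
\<open>q \<le> 1/2\<close> this bounds \<open>\<bar>f(x)\<inverse>\<bar>\<close> by \<open>2 \<bar>A\<inverse>\<bar>\<close>, and then it yields the limit. On singular matrices
\<open>matrix_inv\<close> is an arbitrary choice, hence the hypothesis on the values of \<open>f\<close>.\<close>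

lemma tendsto_matrix_inv:
  fixes f :: "'a \<Rightarrow> real^'n^'n"
  assumes lim: "(f \<longlongrightarrow> A) F" and A: "invertible A" and f: "\<forall>\<^sub>F x in F. invertible (f x)"
  shows "((\<lambda>x. matrix_inv (f x)) \<longlongrightarrow> matrix_inv A) F"
proof -
  obtain K where K: "K > 0"
    "\<And>(X::real^'n^'n) (Y::real^'n^'n) (Z::real^'n^'n).
        norm (X ** Y ** Z) \<le> norm X * norm Y * norm Z * K"
    by (rule norm_matrix_triple_bound) blast
  let ?P = "matrix_inv A"
  have lim0: "((\<lambda>x. norm (f x - A) * norm ?P * K) \<longlongrightarrow> 0) F"
    using tendsto_mult_left_zero[OF tendsto_norm_zero[OF LIM_zero[OF lim]], of "norm ?P * K"]
    by (simp add: mult.assoc)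
  then have ev: "\<forall>\<^sub>F x in F. norm (f x - A) * norm ?P * K < 1/2"
    by (rule order_tendstoD(2)) simp
  have "((\<lambda>x. 2 * norm ?P * (norm (f x - A) * norm ?P * K)) \<longlongrightarrow> 0) F"
    using tendsto_mult_left[OF lim0, of "2 * norm ?P"] by simp
  moreover have "\<forall>\<^sub>F x in F. norm (matrix_inv (f x) - ?P) \<le> 2 * norm ?P * (norm (f x - A) * norm ?P * K)"
    using ev f
  proof eventually_elim
    case (elim x)
    let ?q = "norm (f x - A) * norm ?P * K" and ?X = "matrix_inv (f x)"
    have le: "norm (?X - ?P) \<le> norm ?X * ?q"
      using K(2)[of ?X "f x - A" ?P] by (simp add: matrix_inv_diff[OF A elim(2)] mult_ac)
    have "norm ?X \<le> norm ?P + norm (?X - ?P)"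
      by (metis add.commute diff_add_cancel norm_triangle_ineq)
    also have "\<dots> \<le> norm ?P + norm ?X * (1/2)"
      using le elim(1) mult_left_mono[of ?q "1/2" "norm ?X"] by simp
    finally have "norm ?X \<le> 2 * norm ?P"
      by simp
    then show ?case
      using le K(1) mult_right_mono[of "norm ?X" "2 * norm ?P" ?q] by simp
  qed
  ultimately have "((\<lambda>x. matrix_inv (f x) - ?P) \<longlongrightarrow> 0) F"
    by (rule Lim_null_comparison[rotated])
  then show ?thesis
    by (simp add: LIM_zero_iff)
qed

lemma continuous_on_matrix_inv:
  fixes f :: "'a::topological_space \<Rightarrow> real^'n^'n"
  assumes "continuous_on S f" "\<And>x. x \<in> S \<Longrightarrow> invertible (f x)"
  shows "continuous_on S (\<lambda>x. matrix_inv (f x))"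
  unfolding continuous_on_def
proof
  fix x assume "x \<in> S"
  then show "((\<lambda>x. matrix_inv (f x)) \<longlongrightarrow> matrix_inv (f x)) (at x within S)"
    using assms by (intro tendsto_matrix_inv)
      (auto simp: continuous_on_def eventually_at_topological intro: exI[of _ UNIV])
qed

text \<open>The form of the derivative in which the resolvent identity can be inserted.\<close>

lemma has_vector_derivative_iff_quotient:
  fixes f :: "real \<Rightarrow> 'a::real_normed_vector"
  shows "(f has_vector_derivative D) (at t within S) \<longleftrightarrow>
    ((\<lambda>s. (f s - f t) /\<^sub>R (s - t)) \<longlongrightarrow> D) (at t within S)"
proof -
  have "norm ((f s - f t) /\<^sub>R (s - t) - D) = norm ((f s - f t) - (s - t) *\<^sub>R D) / norm (s - t)"
    if "s \<noteq> t" for s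
  proof -
    have "(f s - f t) /\<^sub>R (s - t) - D = ((f s - f t) - (s - t) *\<^sub>R D) /\<^sub>R (s - t)"
      using that by (simp add: scaleR_diff_right)
    then show ?thesis
      by (simp add: divide_inverse mult.commute)
  qed
  then have "\<forall>\<^sub>F s in at t within S. norm ((f s - f t) /\<^sub>R (s - t) - D)
      = norm ((f s - f t) - (s - t) *\<^sub>R D) / norm (s - t)"
    by (auto simp: eventually_at_topological intro: exI[of _ UNIV])
  then have "((\<lambda>s. norm ((f s - f t) - (s - t) *\<^sub>R D) / norm (s - t)) \<longlongrightarrow> 0) (at t within S)
     \<longleftrightarrow> ((\<lambda>s. norm ((f s - f t) /\<^sub>R (s - t) - D)) \<longlongrightarrow> 0) (at t within S)"
    by (intro tendsto_cong) (auto simp: eq_commute)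
  then show ?thesis
    unfolding has_vector_derivative_def has_derivative_iff_norm
    by (simp add: bounded_linear_scaleR_left tendsto_norm_zero_iff LIM_zero_iff)
qed

lemma has_vector_derivative_matrix_inv:
  fixes f :: "real \<Rightarrow> real^'n^'n"
  assumes f: "(f has_vector_derivative D) (at t within S)" and t: "t \<in> S"
    and inv: "\<And>s. s \<in> S \<Longrightarrow> invertible (f s)"
  shows "((\<lambda>s. matrix_inv (f s)) has_vector_derivative
            - (matrix_inv (f t) ** D ** matrix_inv (f t))) (at t within S)"
proof -
  let ?P = "\<lambda>s. matrix_inv (f s)"
  have cont: "(f \<longlongrightarrow> f t) (at t within S)"
    using has_vector_derivative_continuous[OF f] by (simp add: continuous_within)
  have ev: "\<forall>\<^sub>F s in at t within S. invertible (f s)"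
    using inv by (auto simp: eventually_at_topological intro: exI[of _ UNIV])
  have P: "(?P \<longlongrightarrow> ?P t) (at t within S)"
    by (rule tendsto_matrix_inv[OF cont inv[OF t] ev])
  have q: "((\<lambda>s. (f s - f t) /\<^sub>R (s - t)) \<longlongrightarrow> D) (at t within S)"
    using f by (simp add: has_vector_derivative_iff_quotient)
  have "((\<lambda>s. - (?P s ** ((f s - f t) /\<^sub>R (s - t)) ** ?P t)) \<longlongrightarrow> - (?P t ** D ** ?P t)) (at t within S)"
    by (intro tendsto_minus bounded_bilinear.tendsto[OF bounded_bilinear_mult_mat]
        P q tendsto_const)
  moreover have "\<forall>\<^sub>F s in at t within S. - (?P s ** ((f s - f t) /\<^sub>R (s - t)) ** ?P t) 
      = (?P s - ?P t) /\<^sub>R (s - t)"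
    using ev
    by eventually_elim
      (simp add: matrix_inv_diff[OF inv[OF t]] matrix_mult_algebra flip: scaleR_minus_right)
  ultimately have "((\<lambda>s. (?P s - ?P t) /\<^sub>R (s - t)) \<longlongrightarrow> - (?P t ** D ** ?P t)) (at t within S)"
    by (rule Lim_transform_eventually)
  then show ?thesis
    by (simp add: has_vector_derivative_iff_quotient)
qed

section \<open>Functions that are integrals\<close>

text \<open>Absolute continuity on \<open>[a,b]\<close> with the derivative named. Increments are used in place of
\<open>F t = F a + integral {a..t} f\<close> because they make sense at once on every subinterval.\<close>

definition has_density ::
    "(real \<Rightarrow> 'a::euclidean_space) \<Rightarrow> (real \<Rightarrow> 'a) \<Rightarrow> real \<Rightarrow> real \<Rightarrow> bool" where
  "has_density F f a b \<longleftrightarrow> f absolutely_integrable_on {a..b} \<and>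
     (\<forall>s t. a \<le> s \<longrightarrow> s \<le> t \<longrightarrow> t \<le> b \<longrightarrow> integral {s..t} f = F t - F s)"

lemma has_densityD:
  assumes "has_density F f a b"
  shows "f absolutely_integrable_on {a..b}"
    and "\<And>s t. a \<le> s \<Longrightarrow> s \<le> t \<Longrightarrow> t \<le> b \<Longrightarrow> f absolutely_integrable_on {s..t}"
    and "\<And>s t. a \<le> s \<Longrightarrow> s \<le> t \<Longrightarrow> t \<le> b \<Longrightarrow> (f has_integral (F t - F s)) {s..t}"
    and "\<And>s t. a \<le> s \<Longrightarrow> s \<le> t \<Longrightarrow> t \<le> b \<Longrightarrow> integral {s..t} f = F t - F s"
proof -
  show abs: "f absolutely_integrable_on {a..b}"
    using assms by (simp add: has_density_def)
  fix s t assume st: "a \<le> s" "s \<le> t" "t \<le> b"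
  show sub: "f absolutely_integrable_on {s..t}"
    using absolutely_integrable_on_subinterval[OF abs] st by auto
  show "integral {s..t} f = F t - F s"
    using assms st by (simp add: has_density_def)
  then show "(f has_integral (F t - F s)) {s..t}"
    using sub by (metis absolutely_integrable_on_def has_integral_integrable_integral)
qed

lemma has_density_subinterval:
  assumes "has_density F f a b" "a \<le> a'" "b' \<le> b"
  shows "has_density F f a' b'"
  using assms absolutely_integrable_on_subinterval[of "{a..b}" f a' b']
  by (auto simp: has_density_def)

lemma has_density_cong:
  assumes "has_density F f a b" "\<And>t. t \<in> {a..b} \<Longrightarrow> F t = G t" "\<And>t. t \<in> {a..b} \<Longrightarrow> f t = g t"
  shows "has_density G g a b"
proof -
  have "g absolutely_integrable_on {a..b}"
    by (rule absolutely_integrable_spike[OF has_densityD(1)[OF assms(1)] negligible_empty])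
      (simp add: assms(3))
  moreover have "integral {s..t} g = G t - G s" if "a \<le> s" "s \<le> t" "t \<le> b" for s t
  proof -
    have "integral {s..t} g = integral {s..t} f"
      using that assms(3) by (intro integral_cong) auto
    then show ?thesis
      using that assms(2) has_densityD(4)[OF assms(1) that] by simp
  qed
  ultimately show ?thesis
    by (simp add: has_density_def)
qed

lemma has_density_continuous_on:
  assumes "has_density F f a b"
  shows "continuous_on {a..b} F"
proof -
  have "f integrable_on {a..b}"
    using has_densityD(1)[OF assms] by (simp add: absolutely_integrable_on_def)
  then have "continuous_on {a..b} (\<lambda>t. F a + integral {a..t} f)"
    by (intro continuous_intros indefinite_integral_continuous_1)
  then show ?thesis
    by (rule continuous_on_eq) (auto simp: has_densityD(4)[OF assms])
qed

lemma has_density_integral: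
  fixes f :: "real \<Rightarrow> 'a::euclidean_space"
  assumes "f absolutely_integrable_on {a..b}"
  shows "has_density (\<lambda>t. integral {a..t} f) f a b"
proof -
  have "integral {a..s} f + integral {s..t} f = integral {a..t} f" if "a \<le> s" "s \<le> t" "t \<le> b" for s t
    using that absolutely_integrable_on_subinterval[OF assms, of a t]
    by (intro Henstock_Kurzweil_Integration.integral_combine) (auto simp: absolutely_integrable_on_def)
  then show ?thesis
    using assms by (auto simp: has_density_def algebra_simps)
qed

lemma has_density_C1:
  fixes F :: "real \<Rightarrow> 'a::euclidean_space"
  assumes F: "\<And>t. t \<in> {a..b} \<Longrightarrow> (F has_vector_derivative f t) (at t within {a..b})"
    and f: "continuous_on {a..b} f"
  shows "has_density F f a b"
proof -
  have "(f has_integral (F t - F s)) {s..t}" if "a \<le> s" "s \<le> t" "t \<le> b" for s t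
    using that by (intro fundamental_theorem_of_calculus)
      (auto intro: has_vector_derivative_within_subset[OF F])
  then show ?thesis
    using absolutely_integrable_continuous_real[OF f] by (auto simp: has_density_def)
qed

lemma has_density_imp_has_vector_derivative:
  assumes F: "has_density F f a b" and f: "continuous_on {a..b} f" and t: "t \<in> {a..b}"
  shows "(F has_vector_derivative f t) (at t within {a..b})"
proof -
  have "((\<lambda>t. integral {a..t} f) has_vector_derivative f t) (at t within {a..b})"
    by (rule integral_has_vector_derivative[OF f t])
  then have "((\<lambda>t. F a + integral {a..t} f) has_vector_derivative f t) (at t within {a..b})"
    using has_vector_derivative_add[OF has_vector_derivative_const[of "F a"]] by fastforce
  then show ?thesis
    by (rule has_vector_derivative_transform[OF t, rotated]) (auto simp: has_densityD(4)[OF F])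
qed

lemma has_density_const: "has_density (\<lambda>t. c) (\<lambda>t. 0) a b"
  by (auto simp: has_density_def)

lemma has_density_add:
  assumes "has_density F f a b" "has_density G g a b"
  shows "has_density (\<lambda>t. F t + G t) (\<lambda>t. f t + g t) a b"
  unfolding has_density_def
  using has_densityD(1)[OF assms(1)] has_densityD(1)[OF assms(2)]
    has_integral_add[OF has_densityD(3)[OF assms(1)] has_densityD(3)[OF assms(2)], THEN integral_unique]
  by (auto intro!: set_integral_add(1))

lemma has_density_linear:
  assumes "bounded_linear h" "has_density F f a b"
  shows "has_density (\<lambda>t. h (F t)) (\<lambda>t. h (f t)) a b"
  unfolding has_density_def
proof (intro conjI allI impI)
  show "(\<lambda>t. h (f t)) absolutely_integrable_on {a..b}"
    using absolutely_integrable_linear[OF has_densityD(1)[OF assms(2)] assms(1)] by (simp add: o_def)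
  show "integral {s..t} (\<lambda>t. h (f t)) = h (F t) - h (F s)" if "a \<le> s" "s \<le> t" "t \<le> b" for s t
    using has_integral_linear[OF has_densityD(3)[OF assms(2) that] assms(1)]
    by (simp add: o_def integral_unique linear_diff[OF bounded_linear.linear[OF assms(1)]])
qed

lemma has_density_diff:
  assumes "has_density F f a b" "has_density G g a b"
  shows "has_density (\<lambda>t. F t - G t) (\<lambda>t. f t - g t) a b"
  using has_density_add[OF assms(1) has_density_linear[OF bounded_linear_minus[OF bounded_linear_ident] assms(2)]]
  by (simp add: diff_conv_add_uminus del: add_uminus_conv_diff)

lemma has_density_sum:
  assumes "\<And>i. i \<in> I \<Longrightarrow> has_density (F i) (f i) a b"
  shows "has_density (\<lambda>t. \<Sum>i\<in>I. F i t) (\<lambda>t. \<Sum>i\<in>I. f i t) a b"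
  using assms
proof (induction I rule: infinite_finite_induct)
  case (insert i I)
  have "has_density (\<lambda>t. F i t + (\<Sum>i\<in>I. F i t)) (\<lambda>t. f i t + (\<Sum>i\<in>I. f i t)) a b"
    using insert by (intro has_density_add) simp_all
  then show ?case
    using insert by simp
qed (simp_all add: has_density_const)

text \<open>The defect \<open>D(s,t) = F t - F s - \<integral>\<^sub>s\<^sup>t f\<close> is additive over adjacent intervals. If it is at most
\<open>e \<integral>\<^sub>s\<^sup>t w\<close> on short intervals around each point, then bisection propagates this to every interval,
and \<open>e \<rightarrow> 0\<close> forces \<open>D = 0\<close>.\<close>

lemma has_densityI_local:
  fixes F :: "real \<Rightarrow> 'a::euclidean_space"
  assumes f: "f absolutely_integrable_on {a..b}" and w: "w integrable_on {a..b}"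
    and loc: "\<And>x e. x \<in> {a..b} \<Longrightarrow> e > 0 \<Longrightarrow>
      \<exists>d>0. \<forall>s t. a \<le> s \<and> s \<le> x \<and> x \<le> t \<and> t \<le> b \<and> t - s < d \<longrightarrow>
        norm (F t - F s - integral {s..t} f) \<le> e * integral {s..t} w"
  shows "has_density F f a b"
  unfolding has_density_def
proof (intro conjI allI impI)
  fix s t assume st: "a \<le> s" "s \<le> t" "t \<le> b"
  have f': "f integrable_on {a..b}"
    using f by (simp add: absolutely_integrable_on_def)
  have fi: "f integrable_on {u..v}" and wi: "w integrable_on {u..v}" if "a \<le> u" "v \<le> b" for u v
    using that integrable_on_subinterval[OF f'] integrable_on_subinterval[OF w] by auto
  have le: "norm (F t - F s - integral {s..t} f) \<le> e * integral {s..t} w" if "e > 0" for e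
  proof -
    define P where "P u v \<longleftrightarrow> (s \<le> u \<and> u \<le> v \<and> v \<le> t \<longrightarrow>
      norm (F v - F u - integral {u..v} f) \<le> e * integral {u..v} w)" for u v
    have "P s t"
      using \<open>s \<le> t\<close>
    proof (induction rule: Bolzano)
      case (trans u v z)
      show ?case
        unfolding P_def
      proof
        assume *: "s \<le> u \<and> u \<le> z \<and> z \<le> t"
        have "norm (F v - F u - integral {u..v} f) \<le> e * integral {u..v} w"
          "norm (F z - F v - integral {v..z} f) \<le> e * integral {v..z} w"
          using trans * by (auto simp: P_def)
        moreover have "integral {u..z} f = integral {u..v} f + integral {v..z} f"
          "integral {u..z} w = integral {u..v} w + integral {v..z} w"
          using trans * st by (auto intro!: Henstock_Kurzweil_Integration.integral_combine[symmetric] fi wi)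
        ultimately show "norm (F z - F u - integral {u..z} f) \<le> e * integral {u..z} w"
          using norm_triangle_ineq[of "F v - F u - integral {u..v} f" "F z - F v - integral {v..z} f"]
          by (simp add: algebra_simps)
      qed
    next
      case (local x)
      then have "x \<in> {a..b}"
        using st by simp
      from loc[OF this that] obtain d where "d > 0" and
        d: "\<And>u v. a \<le> u \<and> u \<le> x \<and> x \<le> v \<and> v \<le> b \<and> v - u < d \<Longrightarrow>
          norm (F v - F u - integral {u..v} f) \<le> e * integral {u..v} w"
        by blast
      have "P u v" if "u \<le> x \<and> x \<le> v \<and> v - u < d" for u v
        unfolding P_def using d[of u v] that st by linarith
      with \<open>d > 0\<close> show ?case
        by blast
    qed
    with st show ?thesis
      by (simp add: P_def)
  qed
  have "norm (F t - F s - integral {s..t} f) \<le> 0"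
  proof (rule field_le_epsilon)
    fix e :: real assume "e > 0"
    define W where "W = \<bar>integral {s..t} w\<bar> + 1"
    have "norm (F t - F s - integral {s..t} f) \<le> e / W * integral {s..t} w"
      using \<open>e > 0\<close> by (intro le) (auto simp: W_def)
    also have "\<dots> \<le> e / W * W"
      using \<open>e > 0\<close> by (intro mult_left_mono) (auto simp: W_def)
    also have "\<dots> = e"
      by (simp add: W_def)
    finally show "norm (F t - F s - integral {s..t} f) \<le> 0 + e"
      by simp
  qed
  then show "integral {s..t} f = F t - F s"
    by simp
qed (rule f)

text \<open>Often the increment of \<open>F\<close> is itself an exact integral, of a function in which some factors of \<open>f\<close> are
frozen at an end point or at an intermediate value. Then it is enough to compare the integrands.\<close>

lemma has_densityI_pointwise:
  fixes F :: "real \<Rightarrow> 'a::euclidean_space"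
  assumes f: "f absolutely_integrable_on {a..b}" and w: "w integrable_on {a..b}"
    and loc: "\<And>x e. x \<in> {a..b} \<Longrightarrow> e > 0 \<Longrightarrow>
      \<exists>d>0. \<forall>s t. a \<le> s \<and> s \<le> x \<and> x \<le> t \<and> t \<le> b \<and> t - s < d \<longrightarrow>
        (\<exists>\<phi>. (\<phi> has_integral F t - F s) {s..t} \<and> (\<forall>u\<in>{s..t}. norm (\<phi> u - f u) \<le> e * w u))"
  shows "has_density F f a b"
proof (rule has_densityI_local[OF f w])
  fix x e :: real assume "x \<in> {a..b}" "e > 0"
  from loc[OF this] obtain d where d: "d > 0"
    "\<And>s t. a \<le> s \<and> s \<le> x \<and> x \<le> t \<and> t \<le> b \<and> t - s < d \<Longrightarrow>
        (\<exists>\<phi>. (\<phi> has_integral F t - F s) {s..t} \<and> (\<forall>u\<in>{s..t}. norm (\<phi> u - f u) \<le> e * w u))"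
    by blast
  have "norm (F t - F s - integral {s..t} f) \<le> e * integral {s..t} w"
    if st: "a \<le> s \<and> s \<le> x \<and> x \<le> t \<and> t \<le> b \<and> t - s < d" for s t
  proof -
    obtain \<phi> where \<phi>: "(\<phi> has_integral F t - F s) {s..t}"
      "\<And>u. u \<in> {s..t} \<Longrightarrow> norm (\<phi> u - f u) \<le> e * w u"
      using d(2)[OF st] by blast
    have "f integrable_on {a..b}"
      using f by (simp add: absolutely_integrable_on_def)
    then have fi: "f integrable_on {s..t}" and wi: "w integrable_on {s..t}"
      using st w integrable_on_subinterval[of _ "{a..b}" s t] by simp_all
    have "((\<lambda>u. \<phi> u - f u) has_integral (F t - F s - integral {s..t} f)) {s..t}"
      using \<phi>(1) fi by (intro has_integral_diff) auto
    moreover have "norm (integral {s..t} (\<lambda>u. \<phi> u - f u)) \<le> integral {s..t} (\<lambda>u. e * w u)"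
    proof (rule integral_norm_bound_integral)
      show "(\<lambda>u. \<phi> u - f u) integrable_on {s..t}"
        using \<phi>(1) fi by (intro integrable_diff) (simp_all add: has_integral_integrable)
      show "(\<lambda>u. e * w u) integrable_on {s..t}"
        using integrable_on_cmult_left[OF wi, of e] by simp
    qed (rule \<phi>(2))
    ultimately show ?thesis
      by (simp add: integral_unique)
  qed
  with d(1) show "\<exists>d>0. \<forall>s t. a \<le> s \<and> s \<le> x \<and> x \<le> t \<and> t \<le> b \<and> t - s < d \<longrightarrow>
        norm (F t - F s - integral {s..t} f) \<le> e * integral {s..t} w"
    by blast
qed

lemma absolutely_integrable_continuous_product:
  fixes h :: "'a::euclidean_space \<Rightarrow> 'b::euclidean_space \<Rightarrow> 'c::euclidean_space" and a b :: real
  assumes "bounded_bilinear h" "continuous_on {a..b} F" "g absolutely_integrable_on {a..b}"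
  shows "(\<lambda>u. h (F u) (g u)) absolutely_integrable_on {a..b}"
proof (rule absolutely_integrable_bounded_measurable_product[where h = h and f = F and g = g])
  show "bilinear h"
    using assms(1) by (simp add: bilinear_conv_bounded_bilinear)
  show "F \<in> borel_measurable (lebesgue_on {a..b})"
    by (rule continuous_imp_measurable_on_sets_lebesgue[OF assms(2)]) simp
  show "bounded (F ` {a..b})"
    by (rule compact_imp_bounded[OF compact_continuous_image[OF assms(2)]]) simp
qed (use assms(3) in simp_all)

lemma continuous_on_near:
  fixes F :: "real \<Rightarrow> 'a::metric_space"
  assumes "continuous_on {a..b} F" "x \<in> {a..b}" "e > 0"
  obtains d where "d > 0" "\<And>u. u \<in> {a..b} \<Longrightarrow> \<bar>u - x\<bar> < d \<Longrightarrow> dist (F u) (F x) < e"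
  using assms unfolding continuous_on_iff dist_real_def by metis

text \<open>The increment of \<open>h (F, G)\<close> over \<open>[s,t]\<close> is exactly the integral of \<open>h (f u, G t) + h (F s, g u)\<close>,
and continuity of \<open>F\<close> and \<open>G\<close> makes the frozen factors harmless.\<close>

lemma has_density_bilinear:
  fixes h :: "'a::euclidean_space \<Rightarrow> 'b::euclidean_space \<Rightarrow> 'c::euclidean_space"
  assumes h: "bounded_bilinear h" and F: "has_density F f a b" and G: "has_density G g a b"
  shows "has_density (\<lambda>t. h (F t) (G t)) (\<lambda>t. h (f t) (G t) + h (F t) (g t)) a b"
proof (rule has_densityI_pointwise)
  have h': "bounded_bilinear (\<lambda>x y. h y x)"
    by (rule bounded_bilinear.flip[OF h])
  note contF = has_density_continuous_on[OF F] and contG = has_density_continuous_on[OF G]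
  show "(\<lambda>t. h (f t) (G t) + h (F t) (g t)) absolutely_integrable_on {a..b}"
    using absolutely_integrable_continuous_product[OF h' contG has_densityD(1)[OF F]]
      absolutely_integrable_continuous_product[OF h contF has_densityD(1)[OF G]]
    by (rule set_integral_add(1))
  show "(\<lambda>u. norm (f u) + norm (g u)) integrable_on {a..b}"
    using has_densityD(1)[OF F] has_densityD(1)[OF G]
    by (intro integrable_add) (simp_all add: absolutely_integrable_on_def)
  fix x e :: real assume x: "x \<in> {a..b}" and e: "e > 0"
  obtain K where K: "K > 0" "\<And>p q. norm (h p q) \<le> norm p * norm q * K"
    using bounded_bilinear.pos_bounded[OF h] by blast
  \<comment> \<open>\<open>F\<close> and \<open>G\<close> move by at most \<open>2 \<eta>\<close> between two points near \<open>x\<close>.\<close>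
  define \<eta> where "\<eta> = e / (2 * K)"
  have \<eta>: "\<eta> > 0"
    using e K by (simp add: \<eta>_def)
  obtain d1 where d1: "d1 > 0" "\<And>u. u \<in> {a..b} \<Longrightarrow> \<bar>u - x\<bar> < d1 \<Longrightarrow> dist (F u) (F x) < \<eta>"
    using continuous_on_near[OF contF x \<eta>] by metis
  obtain d2 where d2: "d2 > 0" "\<And>u. u \<in> {a..b} \<Longrightarrow> \<bar>u - x\<bar> < d2 \<Longrightarrow> dist (G u) (G x) < \<eta>"
    using continuous_on_near[OF contG x \<eta>] by metis
  have "\<exists>\<phi>. (\<phi> has_integral h (F t) (G t) - h (F s) (G s)) {s..t} \<and>
      (\<forall>u\<in>{s..t}. norm (\<phi> u - (h (f u) (G u) + h (F u) (g u))) \<le> e * (norm (f u) + norm (g u)))"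
    if st: "a \<le> s \<and> s \<le> x \<and> x \<le> t \<and> t \<le> b \<and> t - s < min d1 d2" for s t
  proof (intro exI conjI ballI)
    have "((\<lambda>u. h (f u) (G t)) has_integral h (F t - F s) (G t)) {s..t}"
      using has_integral_linear[OF has_densityD(3)[OF F] bounded_bilinear.bounded_linear_left[OF h]] st
      by (force simp: o_def)
    moreover have "((\<lambda>u. h (F s) (g u)) has_integral h (F s) (G t - G s)) {s..t}"
      using has_integral_linear[OF has_densityD(3)[OF G] bounded_bilinear.bounded_linear_right[OF h]] st
      by (force simp: o_def)
    ultimately have "((\<lambda>u. h (f u) (G t) + h (F s) (g u)) has_integral
        (h (F t - F s) (G t) + h (F s) (G t - G s))) {s..t}"
      by (rule has_integral_add)
    then show "((\<lambda>u. h (f u) (G t) + h (F s) (g u)) has_integral h (F t) (G t) - h (F s) (G s)) {s..t}"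
      by (simp add: bounded_bilinear.diff_left[OF h] bounded_bilinear.diff_right[OF h])
    fix u assume u: "u \<in> {s..t}"
    have "\<bar>u - x\<bar> < d1" "\<bar>u - x\<bar> < d2"
      using u st by auto
    then have "dist (F s) (F u) \<le> 2 * \<eta>" "dist (G t) (G u) \<le> 2 * \<eta>"
      using d1(2)[of s] d1(2)[of u] d2(2)[of t] d2(2)[of u] u st
        dist_triangle2[of "F s" "F u" "F x"] dist_triangle2[of "G t" "G u" "G x"] by auto
    then have *: "norm (F s - F u) \<le> 2 * \<eta>" "norm (G t - G u) \<le> 2 * \<eta>"
      by (auto simp: dist_norm)
    have "h (f u) (G t) + h (F s) (g u) - (h (f u) (G u) + h (F u) (g u))
        = h (f u) (G t - G u) + h (F s - F u) (g u)"
      by (simp add: bounded_bilinear.diff_left[OF h] bounded_bilinear.diff_right[OF h])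
    also have "norm \<dots> \<le> norm (f u) * norm (G t - G u) * K + norm (F s - F u) * norm (g u) * K"
      by (rule order_trans[OF norm_triangle_ineq add_mono[OF K(2) K(2)]])
    also have "\<dots> \<le> norm (f u) * (2 * \<eta>) * K + (2 * \<eta>) * norm (g u) * K"
      using * K(1) by (intro add_mono mult_right_mono mult_left_mono) auto
    also have "\<dots> = e * (norm (f u) + norm (g u))"
      using K(1) by (simp add: \<eta>_def field_simps)
    finally show "norm (h (f u) (G t) + h (F s) (g u) - (h (f u) (G u) + h (F u) (g u)))
      \<le> e * (norm (f u) + norm (g u))" .
  qed
  then show "\<exists>d>0. \<forall>s t. a \<le> s \<and> s \<le> x \<and> x \<le> t \<and> t \<le> b \<and> t - s < d \<longrightarrow>
      (\<exists>\<phi>. (\<phi> has_integral h (F t) (G t) - h (F s) (G s)) {s..t} \<and>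
      (\<forall>u\<in>{s..t}. norm (\<phi> u - (h (f u) (G u) + h (F u) (g u))) \<le> e * (norm (f u) + norm (g u))))"
    using d1(1) d2(1) by (intro exI[of _ "min d1 d2"]) auto
qed

text \<open>By the mean value theorem the increment of \<open>\<psi> (F)\<close> is \<open>\<psi>' \<xi>\<close> times that of \<open>F\<close>, with \<open>\<xi>\<close> between two
values of \<open>F\<close>; it is the integral of \<open>\<psi>' \<xi> f\<close>.\<close>

lemma has_density_chain:
  fixes F :: "real \<Rightarrow> real"
  assumes \<psi>: "\<And>z. (\<psi> has_real_derivative \<psi>' z) (at z)" and \<psi>': "continuous_on UNIV \<psi>'"
    and F: "has_density F f a b"
  shows "has_density (\<lambda>t. \<psi> (F t)) (\<lambda>t. \<psi>' (F t) * f t) a b"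
proof (rule has_densityI_pointwise)
  note contF = has_density_continuous_on[OF F]
  have "continuous_on {a..b} (\<lambda>t. \<psi>' (F t))"
    using continuous_on_compose[OF contF continuous_on_subset[OF \<psi>' subset_UNIV]]
    by (simp add: o_def)
  then show "(\<lambda>t. \<psi>' (F t) * f t) absolutely_integrable_on {a..b}"
    by (rule absolutely_integrable_continuous_product[OF bounded_bilinear_mult _ has_densityD(1)[OF F]])
  show "(\<lambda>u. norm (f u)) integrable_on {a..b}"
    using has_densityD(1)[OF F] by (auto simp: absolutely_integrable_on_def)
  fix x e :: real assume x: "x \<in> {a..b}" and e: "e > 0"
  have "isCont \<psi>' (F x)"
    using \<psi>' by (simp add: continuous_on_eq_continuous_at)
  then obtain \<eta> where \<eta>: "\<eta> > 0" "\<And>z. \<bar>z - F x\<bar> < \<eta> \<Longrightarrow> \<bar>\<psi>' z - \<psi>' (F x)\<bar> < e / 2"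
    unfolding continuous_at_eps_delta dist_real_def using half_gt_zero[OF e] by blast
  obtain d where d: "d > 0" "\<And>u. u \<in> {a..b} \<Longrightarrow> \<bar>u - x\<bar> < d \<Longrightarrow> dist (F u) (F x) < \<eta>"
    using continuous_on_near[OF contF x \<eta>(1)] by blast
  have "\<exists>\<phi>. (\<phi> has_integral \<psi> (F t) - \<psi> (F s)) {s..t} \<and>
      (\<forall>u\<in>{s..t}. norm (\<phi> u - \<psi>' (F u) * f u) \<le> e * norm (f u))"
    if st: "a \<le> s \<and> s \<le> x \<and> x \<le> t \<and> t \<le> b \<and> t - s < d" for s t
  proof -
    have near: "\<bar>F u - F x\<bar> < \<eta>" if "u \<in> {s..t}" for u
      using d(2)[of u] that st by (auto simp: dist_real_def)
    obtain \<xi> where \<xi>: "\<psi> (F t) - \<psi> (F s) = \<psi>' \<xi> * (F t - F s)" "\<bar>\<xi> - F x\<bar> < \<eta>"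
    proof (cases "F s" "F t" rule: linorder_cases)
      case less
      from MVT2[OF this \<psi>] obtain z where "F s < z" "z < F t" "\<psi> (F t) - \<psi> (F s) = (F t - F s) * \<psi>' z"
        by blast
      with near[of s] near[of t] st show ?thesis
        by (intro that[of z]) (auto simp: mult.commute)
    next
      case greater
      from MVT2[OF this \<psi>] obtain z where "F t < z" "z < F s" "\<psi> (F s) - \<psi> (F t) = (F s - F t) * \<psi>' z"
        by blast
      with near[of s] near[of t] st show ?thesis
        by (intro that[of z]) (auto simp: algebra_simps)
    next
      case equal
      with that[of "F x"] \<eta>(1) show ?thesis
        by simp
    qed
    show ?thesis
    proof (intro exI conjI ballI)
      show "((\<lambda>u. \<psi>' \<xi> * f u) has_integral \<psi> (F t) - \<psi> (F s)) {s..t}"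
        using has_integral_mult_right[OF has_densityD(3)[OF F], of s t "\<psi>' \<xi>"] st by (simp add: \<xi>)
      fix u assume u: "u \<in> {s..t}"
      have "\<bar>\<psi>' \<xi> - \<psi>' (F u)\<bar> \<le> e"
        using \<eta>(2)[OF \<xi>(2)] \<eta>(2)[OF near[OF u]] by linarith
      then show "norm (\<psi>' \<xi> * f u - \<psi>' (F u) * f u) \<le> e * norm (f u)"
        unfolding left_diff_distrib[symmetric] by (simp add: abs_mult mult_right_mono)
    qed
  qed
  then show "\<exists>d>0. \<forall>s t. a \<le> s \<and> s \<le> x \<and> x \<le> t \<and> t \<le> b \<and> t - s < d \<longrightarrow>
      (\<exists>\<phi>. (\<phi> has_integral \<psi> (F t) - \<psi> (F s)) {s..t} \<and>
      (\<forall>u\<in>{s..t}. norm (\<phi> u - \<psi>' (F u) * f u) \<le> e * norm (f u)))"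
    using d(1) by blast
qed

section \<open>Smooth step functions\<close>

definition smooth_fun :: "(real \<Rightarrow> real) \<Rightarrow> bool" where
  "smooth_fun f \<longleftrightarrow> (\<forall>k t. ((deriv ^^ k) f) differentiable (at t))"

text \<open>Smoothness is proved by exhibiting a family of functions that is closed under differentiation. This
avoids formulas for higher derivatives of products and compositions.\<close>

lemma smooth_fun_coinduct:
  assumes closed: "\<And>f. f \<in> \<F> \<Longrightarrow> \<exists>g\<in>\<F>. \<forall>t. (f has_real_derivative g t) (at t)"
    and f: "f \<in> \<F>"
  shows "smooth_fun f"
proof -
  have in_family: "(deriv ^^ k) f \<in> \<F>" for k
  proof (induction k)
    case (Suc k)
    obtain g where "g \<in> \<F>" "\<And>t. ((deriv ^^ k) f has_real_derivative g t) (at t)"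
      using closed[OF Suc] by blast
    moreover from this have "deriv ((deriv ^^ k) f) = g"
      by (auto intro: DERIV_imp_deriv)
    ultimately show ?case
      by simp
  qed (simp add: f)
  show ?thesis
    unfolding smooth_fun_def
  proof (intro allI)
    fix k t
    obtain g where "((deriv ^^ k) f has_real_derivative g) (at t)"
      using closed[OF in_family] by blast
    then show "(deriv ^^ k) f differentiable (at t)"
      by (meson differentiable_def has_field_derivative_def)
  qed
qed

lemma smooth_fun_deriv:
  assumes "smooth_fun f"
  shows "smooth_fun (deriv f)" "(f has_real_derivative deriv f t) (at t)"
proof -
  have "(deriv ^^ k) (deriv f) differentiable (at t)" for k t
    using assms unfolding smooth_fun_def by (metis comp_apply funpow_Suc_right)
  then show "smooth_fun (deriv f)"
    by (simp add: smooth_fun_def)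
  have "f differentiable (at t)"
    using assms unfolding smooth_fun_def by (metis funpow_0)
  then show "(f has_real_derivative deriv f t) (at t)"
    by (simp add: DERIV_deriv_iff_real_differentiable)
qed

lemma smooth_fun_continuous_on: "smooth_fun f \<Longrightarrow> continuous_on S f"
  by (meson DERIV_continuous continuous_at_imp_continuous_on smooth_fun_deriv(2))

lemma smooth_fun_affine_combination:
  assumes f: "smooth_fun f" and g: "smooth_fun g"
  shows "smooth_fun (\<lambda>u. \<alpha> * f (c * (u - s)) + \<beta> * g (c * (u - t)))"
proof (rule smooth_fun_coinduct)
  let ?\<F> = "{\<lambda>u. \<alpha> * f (c * (u - s)) + \<beta> * g (c * (u - t)) |\<alpha> \<beta> f g. smooth_fun f \<and> smooth_fun g}"
  show "(\<lambda>u. \<alpha> * f (c * (u - s)) + \<beta> * g (c * (u - t))) \<in> ?\<F>"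
    using f g by blast
  fix h assume "h \<in> ?\<F>"
  then obtain \<alpha> \<beta> f g where h: "h = (\<lambda>u. \<alpha> * f (c * (u - s)) + \<beta> * g (c * (u - t)))"
    and fg: "smooth_fun f" "smooth_fun g"
    by blast
  have "(h has_real_derivative
      (\<alpha> * c) * deriv f (c * (u - s)) + (\<beta> * c) * deriv g (c * (u - t))) (at u)" for u
    unfolding h
    by (auto intro!: derivative_eq_intros DERIV_chain2[OF smooth_fun_deriv(2)] fg)
  moreover have "(\<lambda>u. (\<alpha> * c) * deriv f (c * (u - s)) + (\<beta> * c) * deriv g (c * (u - t))) \<in> ?\<F>"
    by (intro CollectI exI[of _ "\<alpha> * c"] exI[of _ "\<beta> * c"] exI[of _ "deriv f"] exI[of _ "deriv g"]
        conjI refl smooth_fun_deriv fg)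
  ultimately show "\<exists>h'\<in>?\<F>. \<forall>u. (h has_real_derivative h' u) (at u)"
    by (intro bexI[rotated] allI)
qed

text \<open>The function \<open>exp (- 1/x)\<close>, extended by \<open>0\<close>, is \<open>flat 0\<close>. The powers are included because the
derivatives of the members are linear combinations of members.\<close>

definition flat :: "nat \<Rightarrow> real \<Rightarrow> real" where
  "flat n x = (if x > 0 then inverse x ^ n * exp (- inverse x) else 0)"

lemma flat_tendsto_0: "(flat n \<longlongrightarrow> 0) (at 0)"
proof -
  have "((\<lambda>x::real. inverse x ^ n / exp (inverse x)) \<longlongrightarrow> 0) (at_right 0)"
    by (rule filterlim_compose[OF tendsto_power_div_exp_0 filterlim_inverse_at_top_right])
  moreover have "\<forall>\<^sub>F x in at_right 0. inverse x ^ n / exp (inverse x) = flat n x"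
    by (auto simp: flat_def exp_minus divide_inverse eventually_at_filter)
  ultimately have "(flat n \<longlongrightarrow> 0) (at_right 0)"
    by (rule Lim_transform_eventually)
  moreover have "(flat n \<longlongrightarrow> 0) (at_left 0)"
    by (rule tendsto_eventually) (auto simp: flat_def eventually_at_filter)
  ultimately show ?thesis
    by (simp add: filterlim_at_split)
qed

lemma flat_has_derivative:
  "(flat n has_real_derivative flat (n + 2) x - real n * flat (n + 1) x) (at x)"
proof (cases x "0 :: real" rule: linorder_cases)
  case less
  show ?thesis
  proof (rule DERIV_cong[OF has_field_derivative_transform_within_open[where f = "\<lambda>x. 0" and S = "{..<0}"]])
    show "((\<lambda>x. 0) has_real_derivative 0) (at x)"
      by simp
  qed (use less in \<open>auto simp: flat_def\<close>)
next
  case equal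
  \<comment> \<open>At the origin the difference quotient of one member is the next member, which tends to \<open>0\<close>.\<close>
  have "(flat n x - flat n 0) / (x - 0) = flat (n + 1) x" for x
    by (simp add: flat_def divide_inverse)
  then have "((\<lambda>x. (flat n x - flat n 0) / (x - 0)) \<longlongrightarrow> 0) (at 0)"
    using flat_tendsto_0[of "n + 1"] by presburger
  then have "(flat n has_real_derivative 0) (at 0)"
    by (simp add: has_field_derivative_iff)
  then show ?thesis
    by (simp add: equal flat_def)
next
  case greater
  show ?thesis
  proof (rule has_field_derivative_transform_within_open[where S = "{0<..}"])
    show "((\<lambda>x. inverse x ^ n * exp (- inverse x)) has_real_derivative
        flat (n + 2) x - real n * flat (n + 1) x) (at x)"
    proof -
      have "inverse x ^ k = inverse x * inverse x ^ (k - Suc 0)" if "k \<noteq> 0" for k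
        using that by (cases k) auto
      then show ?thesis
        using greater
        by (cases n; auto intro!: derivative_eq_intros simp: flat_def power2_eq_square algebra_simps; metis)
    qed
  qed (use greater in \<open>auto simp: flat_def\<close>)
qed

text \<open>A linear space of functions that contains the bump \<open>flat 0 x * flat 0 (1 - x)\<close>, which is positive
exactly on \<open>(0,1)\<close>, and that is closed under differentiation.\<close>

inductive_set bump_family :: "(real \<Rightarrow> real) set" where
  product: "(\<lambda>x. flat m x * flat n (1 - x)) \<in> bump_family"
| combination: "f \<in> bump_family \<Longrightarrow> g \<in> bump_family \<Longrightarrow> (\<lambda>x. \<alpha> * f x + \<beta> * g x) \<in> bump_family"

lemma bump_family_closed:
  assumes "f \<in> bump_family"
  shows "\<exists>g\<in>bump_family. \<forall>t. (f has_real_derivative g t) (at t)"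
  using assms
proof induction
  case (product m n)
  let ?p = "\<lambda>m n x. flat m x * flat n (1 - x)"
  have "(?p m n has_real_derivative
      1 * (1 * ?p (m + 2) n x + (- real m) * ?p (m + 1) n x)
      + (-1) * (1 * ?p m (n + 2) x + (- real n) * ?p m (n + 1) x)) (at x)" for x
  proof -
    have "((\<lambda>x. flat n (1 - x)) has_real_derivative
        (flat (n + 2) (1 - x) - real n * flat (n + 1) (1 - x)) * (- 1)) (at x)"
      by (rule DERIV_chain2[OF flat_has_derivative]) (auto intro!: derivative_eq_intros)
    from DERIV_mult[OF flat_has_derivative[of m x] this] show ?thesis
      by (simp add: algebra_simps)
  qed
  moreover have "(\<lambda>x. 1 * (1 * ?p (m + 2) n x + (- real m) * ?p (m + 1) n x)
      + (-1) * (1 * ?p m (n + 2) x + (- real n) * ?p m (n + 1) x)) \<in> bump_family"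
    by (intro bump_family.intros)
  ultimately show ?case
    by (intro bexI[rotated] allI)
next
  case (combination f g \<alpha> \<beta>)
  then obtain f' g' where "f' \<in> bump_family" "g' \<in> bump_family"
    "\<And>t. (f has_real_derivative f' t) (at t)" "\<And>t. (g has_real_derivative g' t) (at t)"
    by blast
  then have "\<And>t. ((\<lambda>x. \<alpha> * f x + \<beta> * g x) has_real_derivative \<alpha> * f' t + \<beta> * g' t) (at t)"
    "(\<lambda>x. \<alpha> * f' x + \<beta> * g' x) \<in> bump_family"
    by (auto intro!: derivative_eq_intros bump_family.combination)
  then show ?case
    by (intro bexI[rotated] allI)
qed

text \<open>The step is the primitive of the bump, normalized by its total mass.\<close>

lemma smooth_unit_step:
  obtains \<Phi> where "smooth_fun \<Phi>" "\<And>u. 0 \<le> deriv \<Phi> u" "\<And>u. u \<le> 0 \<Longrightarrow> \<Phi> u = 0" "\<And>u. 1 \<le> u \<Longrightarrow> \<Phi> u = 1"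
proof -
  define \<rho> where "\<rho> x = flat 0 x * flat 0 (1 - x)" for x
  have fam: "\<rho> \<in> bump_family"
    using bump_family.product[of 0 0] by (simp add: \<rho>_def[abs_def])
  have smooth_\<rho>: "smooth_fun \<rho>"
    by (rule smooth_fun_coinduct[OF bump_family_closed fam])
  have nonneg: "0 \<le> \<rho> x" and pos: "0 < x \<Longrightarrow> x < 1 \<Longrightarrow> 0 < \<rho> x"
    and zero: "x \<le> 0 \<or> 1 \<le> x \<Longrightarrow> \<rho> x = 0" for x
    by (auto simp: \<rho>_def flat_def)
  note cont = smooth_fun_continuous_on[OF smooth_\<rho>]
  note int = integrable_continuous_real[OF cont]
  define c where "c = integral {0..1} \<rho>"
  have c: "c > 0"
  proof -
    have "c \<ge> 0"
      unfolding c_def using nonneg by (intro integral_nonneg int) auto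
    moreover have "c \<noteq> 0"
      using integral_eq_0_iff[OF cont, of 0 1] nonneg pos[of "1/2"] by (force simp: c_def)
    ultimately show ?thesis
      by simp
  qed
  define \<Phi> where "\<Phi> u = integral {0..u} \<rho> / c" for u
  \<comment> \<open>For \<open>u < 0\<close> the interval \<open>{0..u}\<close> is empty. A lower end point to the left of \<open>u\<close> is needed to
    differentiate there.\<close>
  have extend: "integral {0..u} \<rho> = integral {a..u} \<rho>" if "a \<le> 0" "a \<le> u" for a u
  proof (cases "u \<le> 0")
    case True
    have "integral {a..u} \<rho> = integral {a..u} (\<lambda>x. 0)"
      using True by (intro integral_cong zero) auto
    moreover have "integral {0..u} \<rho> = integral {0..u} (\<lambda>x. 0)"
      using True by (intro integral_cong zero) auto
    ultimately show ?thesis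
      by simp
  next
    case False
    then have "integral {a..0} \<rho> + integral {0..u} \<rho> = integral {a..u} \<rho>"
      using that by (intro Henstock_Kurzweil_Integration.integral_combine int) auto
    moreover have "integral {a..0} \<rho> = integral {a..0} (\<lambda>x. 0)"
      by (intro integral_cong zero) auto
    ultimately show ?thesis
      by simp
  qed
  have der: "(\<Phi> has_real_derivative \<rho> u / c) (at u)" for u
  proof -
    define a where "a = min 0 u - 1"
    have "((\<lambda>v. integral {a..v} \<rho>) has_real_derivative \<rho> u) (at u within {a..u+1})"
      by (rule integral_has_real_derivative[OF cont]) (auto simp: a_def)
    then have "((\<lambda>v. integral {a..v} \<rho>) has_real_derivative \<rho> u) (at u)"
      by (subst (asm) at_within_interior) (auto simp: a_def)
    then have "((\<lambda>v. integral {a..v} \<rho> / c) has_real_derivative \<rho> u / c) (at u)"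
      by (rule DERIV_cdivide)
    then show ?thesis
    proof (rule has_field_derivative_transform_within_open[where S = "{a<..}"])
      show "integral {a..v} \<rho> / c = \<Phi> v" if "v \<in> {a<..}" for v
        using extend[of a v] that by (simp add: \<Phi>_def a_def)
    qed (simp_all add: a_def)
  qed
  have "smooth_fun \<Phi>"
  proof (rule smooth_fun_coinduct)
    let ?\<F> = "insert \<Phi> {f. smooth_fun f}"
    show "\<exists>g\<in>?\<F>. \<forall>t. (f has_real_derivative g t) (at t)" if "f \<in> ?\<F>" for f
    proof (cases "f = \<Phi>")
      case True
      have "smooth_fun (\<lambda>u. inverse c * \<rho> (1 * (u - 0)) + 0 * \<rho> (1 * (u - 0)))"
        by (intro smooth_fun_affine_combination smooth_\<rho>)
      then have "smooth_fun (\<lambda>u. \<rho> u / c)"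
        by (simp add: divide_inverse mult.commute)
      then show ?thesis
        using der True by (auto intro!: bexI[where x = "\<lambda>u. \<rho> u / c"])
    next
      case False
      then show ?thesis
        using that smooth_fun_deriv by blast
    qed
  qed simp
  moreover have "0 \<le> deriv \<Phi> u" for u
    using DERIV_imp_deriv[OF der[of u]] nonneg c by simp
  moreover have "\<Phi> u = 0" if "u \<le> 0" for u
    using that by (cases "u = 0") (auto simp: \<Phi>_def)
  moreover have "\<Phi> u = 1" if "1 \<le> u" for u
  proof -
    have "integral {0..1} \<rho> + integral {1..u} \<rho> = integral {0..u} \<rho>"
      using that by (intro Henstock_Kurzweil_Integration.integral_combine int) auto
    moreover have "integral {1..u} \<rho> = integral {1..u} (\<lambda>x. 0)"
      by (intro integral_cong zero) auto
    ultimately show ?thesis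
      using c by (simp add: \<Phi>_def c_def)
  qed
  ultimately show thesis
    by (rule that)
qed

lemma deriv_zero_on_open:
  fixes f :: "real \<Rightarrow> real"
  assumes "open S" "t \<in> S" "\<And>x. x \<in> S \<Longrightarrow> f x = c"
  shows "deriv f t = 0"
proof (rule DERIV_imp_deriv)
  show "(f has_real_derivative 0) (at t)"
    by (rule has_field_derivative_transform_within_open[where f = "\<lambda>_. c", OF DERIV_const assms(1,2)])
      (simp add: assms(3))
qed

lemma smooth_step:
  assumes "\<epsilon> > 0"
  obtains \<Psi> where "smooth_fun \<Psi>" "\<And>u. 0 \<le> deriv \<Psi> u"
    "\<And>u. u \<le> x \<Longrightarrow> \<Psi> u = 0" "\<And>u. x + \<epsilon> \<le> u \<Longrightarrow> \<Psi> u = 1"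
    "\<And>u. u \<notin> {x..x + \<epsilon>} \<Longrightarrow> deriv \<Psi> u = 0"
proof -
  obtain \<Phi> where \<Phi>: "smooth_fun \<Phi>" "\<And>u. 0 \<le> deriv \<Phi> u"
    "\<And>u. u \<le> 0 \<Longrightarrow> \<Phi> u = 0" "\<And>u. 1 \<le> u \<Longrightarrow> \<Phi> u = 1"
    by (rule smooth_unit_step) blast
  define \<Psi> where "\<Psi> u = \<Phi> (inverse \<epsilon> * (u - x))" for u
  have "smooth_fun (\<lambda>u. 1 * \<Phi> (inverse \<epsilon> * (u - x)) + 0 * \<Phi> (inverse \<epsilon> * (u - 0)))"
    by (rule smooth_fun_affine_combination[OF \<Phi>(1) \<Phi>(1)])
  then have 1: "smooth_fun \<Psi>"
    by (simp add: \<Psi>_def[abs_def])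
  have 2: "0 \<le> deriv \<Psi> u" for u
  proof -
    have "((\<lambda>u. inverse \<epsilon> * (u - x)) has_real_derivative inverse \<epsilon>) (at u)"
      by (auto intro!: derivative_eq_intros)
    from DERIV_chain2[OF smooth_fun_deriv(2)[OF \<Phi>(1)] this]
    have "deriv \<Psi> u = deriv \<Phi> (inverse \<epsilon> * (u - x)) * inverse \<epsilon>"
      unfolding \<Psi>_def by (rule DERIV_imp_deriv)
    then show ?thesis
      using \<Phi>(2) assms by simp
  qed
  have 3: "\<Psi> u = 0" if "u \<le> x" for u
    unfolding \<Psi>_def using that assms by (intro \<Phi>(3)) (simp add: mult_le_0_iff)
  have 4: "\<Psi> u = 1" if "x + \<epsilon> \<le> u" for u
    unfolding \<Psi>_def using that assms by (intro \<Phi>(4)) (simp add: field_simps)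
  have 5: "deriv \<Psi> u = 0" if "u \<notin> {x..x + \<epsilon>}" for u
  proof (cases "u < x")
    case True
    then show ?thesis
      by (intro deriv_zero_on_open[of "{..<x}" _ _ 0]) (simp_all add: 3)
  next
    case False
    with that show ?thesis
      by (intro deriv_zero_on_open[of "{x + \<epsilon><..}" _ _ 1]) (simp_all add: 4)
  qed
  show thesis
    by (rule that[OF 1 2 3 4 5])
qed

section \<open>Weak derivatives and densities\<close>

text \<open>Links the Lebesgue integrals of the weak formulation with integrals over compact intervals, on which
densities are defined.\<close>

lemma lebesgue_integral_supported:
  fixes F :: "real \<Rightarrow> 'a::euclidean_space"
  assumes sub: "{a..b} \<subseteq> {0<..<T}" and zero: "\<And>t. t \<notin> {a..b} \<Longrightarrow> F t = 0"
    and F: "F absolutely_integrable_on {a..b}"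
  shows "(LINT t|lebesgue_on {0<..<T}. F t) = integral {a..b} F"
proof -
  have "(LINT t|lebesgue_on {0<..<T}. F t) = (LINT t|lebesgue. indicator {0<..<T} t *\<^sub>R F t)"
    by (rule integral_restrict_space) simp
  also have "\<dots> = (LINT t|lebesgue. indicator {a..b} t *\<^sub>R F t)"
    using sub zero by (intro arg_cong[where f = "integral\<^sup>L lebesgue"]) (force simp: indicator_def)
  also have "\<dots> = integral {a..b} F"
    using set_lebesgue_integral_eq_integral(2)[OF F] by (simp add: set_lebesgue_integral_def)
  finally show ?thesis .
qed

lemma locally_integrable_Icc:
  assumes "locally_integrable T f" "0 < a" "b < T"
  shows "f absolutely_integrable_on {a..b}"
proof -
  have "{a..b} \<subseteq> {0<..<T}"
    using assms by auto
  then have "integrable (lebesgue_on {a..b}) f"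
    using assms(1) by (simp add: locally_integrable_def)
  then show ?thesis
    by (simp add: set_integrable_def integrable_restrict_space)
qed

lemma compact_subset_Ioo:
  fixes K :: "real set"
  assumes "compact K" "K \<subseteq> {0<..<T}" "0 < T"
  obtains a b where "0 < a" "a \<le> b" "b < T" "K \<subseteq> {a<..<b}"
proof -
  let ?K = "insert (T/2) K"
  have K: "compact ?K" "?K \<noteq> {}"
    using assms by (auto intro: compact_insert)
  obtain l where l: "l \<in> ?K" "\<And>x. x \<in> ?K \<Longrightarrow> l \<le> x"
    using compact_attains_inf[OF K] by blast
  obtain u where u: "u \<in> ?K" "\<And>x. x \<in> ?K \<Longrightarrow> x \<le> u"
    using compact_attains_sup[OF K] by blast
  have lu: "0 < l" "l \<le> u" "u < T"
    using l(1) u(1) l(2)[OF u(1)] assms by auto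
  have "l / 2 < x \<and> x < (u + T) / 2" if "x \<in> K" for x
    using l(2)[of x] u(2)[of x] that lu by auto
  with lu show thesis
    by (intro that[of "l/2" "(u + T)/2"]) auto
qed

lemma locally_integrableI:
  assumes "\<And>a b. 0 < a \<Longrightarrow> a \<le> b \<Longrightarrow> b < T \<Longrightarrow> f absolutely_integrable_on {a..b}" "0 < T"
  shows "locally_integrable T f"
  unfolding locally_integrable_def
proof (intro allI impI, elim conjE)
  fix K :: "real set" assume K: "compact K" "K \<subseteq> {0<..<T}"
  obtain a b where ab: "0 < a" "a \<le> b" "b < T" "K \<subseteq> {a<..<b}"
    by (rule compact_subset_Ioo[OF K \<open>0 < T\<close>])
  have meas: "K \<in> sets lebesgue"
    using K(1) by (simp add: borel_compact)
  have "set_integrable lebesgue K f"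
    by (rule set_integrable_subset[OF assms(1)[OF ab(1-3)] meas]) (use ab in auto)
  then show "integrable (lebesgue_on K) f"
    using meas by (simp add: absolutely_integrable_imp_integrable)
qed

text \<open>A weighted mean of \<open>h\<close> is as close to \<open>h x\<close> as the values of \<open>h\<close> where the weight lives.\<close>

lemma integral_mollified_near:
  fixes h :: "real \<Rightarrow> 'a::euclidean_space"
  assumes h: "continuous_on {a..b} h" and \<kappa>: "continuous_on {a..b} \<kappa>"
    and nonneg: "\<And>u. u \<in> {a..b} \<Longrightarrow> 0 \<le> \<kappa> u" and int: "integral {a..b} \<kappa> = 1"
    and near: "\<And>u. u \<in> {a..b} \<Longrightarrow> \<kappa> u \<noteq> 0 \<Longrightarrow> norm (h u - h x) \<le> e"
  shows "norm (integral {a..b} (\<lambda>u. \<kappa> u *\<^sub>R h u) - h x) \<le> e"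
proof -
  have \<kappa>i: "(\<kappa> has_integral 1) {a..b}"
    using integrable_integral[OF integrable_continuous_real[OF \<kappa>]] int by simp
  have hi: "((\<lambda>u. \<kappa> u *\<^sub>R h u) has_integral integral {a..b} (\<lambda>u. \<kappa> u *\<^sub>R h u)) {a..b}"
    by (intro integrable_integral integrable_continuous_real continuous_intros h \<kappa>)
  have ci: "((\<lambda>u. \<kappa> u *\<^sub>R h x) has_integral 1 *\<^sub>R h x) {a..b}"
    by (rule has_integral_scaleR_left[OF \<kappa>i])
  have ei: "((\<lambda>u. e * \<kappa> u) has_integral e * 1) {a..b}"
    by (rule has_integral_mult_right[OF \<kappa>i])
  have di: "((\<lambda>u. \<kappa> u *\<^sub>R (h u - h x)) has_integral (integral {a..b} (\<lambda>u. \<kappa> u *\<^sub>R h u) - h x)) {a..b}"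
    using has_integral_diff[OF hi ci] by (simp add: scaleR_diff_right)
  have "norm (integral {a..b} (\<lambda>u. \<kappa> u *\<^sub>R (h u - h x))) \<le> integral {a..b} (\<lambda>u. e * \<kappa> u)"
  proof (rule integral_norm_bound_integral)
    show "norm (\<kappa> u *\<^sub>R (h u - h x)) \<le> e * \<kappa> u" if "u \<in> {a..b}" for u
    proof (cases "\<kappa> u = 0")
      case False
      then show ?thesis
        using near[OF that] nonneg[OF that] by (simp add: mult.commute mult_left_mono)
    qed simp
  qed (use di ei in \<open>auto simp: integrable_on_def\<close>)
  then show ?thesis
    unfolding integral_unique[OF di] integral_unique[OF ei] by simp
qed

lemma has_density_smooth_fun:
  assumes "smooth_fun f"
  shows "has_density f (deriv f) a b"
proof (rule has_density_C1)
  show "(f has_vector_derivative deriv f t) (at t within {a..b})" for t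
    using smooth_fun_deriv(2)[OF assms]
    by (simp add: has_field_derivative_at_within flip: has_real_derivative_iff_has_vector_derivative)
qed (simp add: assms smooth_fun_continuous_on smooth_fun_deriv(1))

text \<open>The lemma of du Bois-Reymond. Let \<open>G\<close> be a primitive of \<open>g\<close>; it has to be shown that \<open>h = f - G\<close>
takes the same value at \<open>s\<close> and \<open>t\<close>. The difference of two smooth steps, one just to the right of \<open>s\<close>
and one just to the right of \<open>t\<close>, is a test function \<open>\<phi>\<close>. The weak formulation for \<open>f\<close> and the product
rule for \<open>\<phi> G\<close> give \<open>\<integral> \<phi>' h = 0\<close>, so the means of \<open>h\<close> near \<open>s\<close> and near \<open>t\<close> with the derivatives of
the steps as weights agree. Shrinking the steps turns the means into values.\<close>

lemma weak_derivative_imp_has_density: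
  fixes f g :: "real \<Rightarrow> 'a::euclidean_space"
  assumes weak: "has_weak_derivative T f g" and f: "continuous_on {0..T} f"
    and ab: "0 < a" "b < T"
  shows "has_density f g a b"
  unfolding has_density_def
proof (intro conjI allI impI)
  have loc: "g absolutely_integrable_on {a..b}" if "0 < a" "b < T" for a b
    using weak that by (intro locally_integrable_Icc) (auto simp: has_weak_derivative_def)
  then show "g absolutely_integrable_on {a..b}"
    using ab by blast
  fix s t assume st: "a \<le> s" "s \<le> t" "t \<le> b"
  \<comment> \<open>Leaves room to the right of \<open>t\<close> for a step inside \<open>(0,T)\<close>.\<close>
  define b' where "b' = (t + T) / 2"
  have b': "t < b'" "b' < T" "0 < s"
    using ab st by (auto simp: b'_def)
  define G where "G u = integral {s..u} g" for u
  have G: "has_density G g s b'"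
    unfolding G_def using b' by (intro has_density_integral loc) auto
  define h where "h u = f u - G u" for u
  have contf: "continuous_on {s..b'} f"
    using b' by (intro continuous_on_subset[OF f]) auto
  have conth: "continuous_on {s..b'} h"
    unfolding h_def by (intro continuous_intros contf has_density_continuous_on[OF G])
  have "dist (h s) (h t) \<le> e" if "e > 0" for e
  proof -
    have mem: "s \<in> {s..b'}" "t \<in> {s..b'}" "e / 2 > 0"
      using that b' st by auto
    obtain d1 where d1: "d1 > 0" "\<And>u. u \<in> {s..b'} \<Longrightarrow> \<bar>u - s\<bar> < d1 \<Longrightarrow> dist (h u) (h s) < e / 2"
      using continuous_on_near[OF conth mem(1) mem(3)] by blast
    obtain d2 where d2: "d2 > 0" "\<And>u. u \<in> {s..b'} \<Longrightarrow> \<bar>u - t\<bar> < d2 \<Longrightarrow> dist (h u) (h t) < e / 2"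
      using continuous_on_near[OF conth mem(2) mem(3)] by blast
    define \<epsilon> where "\<epsilon> = min (min d1 d2) (b' - t) / 2"
    have \<epsilon>: "\<epsilon> > 0" "\<epsilon> < d1" "\<epsilon> < d2" "t + \<epsilon> < b'"
      using d1(1) d2(1) b' by (auto simp: \<epsilon>_def min_def field_simps)
    obtain \<Phi> where \<Phi>: "smooth_fun \<Phi>" "\<And>u. 0 \<le> deriv \<Phi> u" "\<And>u. u \<le> s \<Longrightarrow> \<Phi> u = 0"
      "\<And>u. s + \<epsilon> \<le> u \<Longrightarrow> \<Phi> u = 1" "\<And>u. u \<notin> {s..s + \<epsilon>} \<Longrightarrow> deriv \<Phi> u = 0"
      by (rule smooth_step[OF \<epsilon>(1), of s]) blast
    obtain \<Psi> where \<Psi>: "smooth_fun \<Psi>" "\<And>u. 0 \<le> deriv \<Psi> u" "\<And>u. u \<le> t \<Longrightarrow> \<Psi> u = 0"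
      "\<And>u. t + \<epsilon> \<le> u \<Longrightarrow> \<Psi> u = 1" "\<And>u. u \<notin> {t..t + \<epsilon>} \<Longrightarrow> deriv \<Psi> u = 0"
      by (rule smooth_step[OF \<epsilon>(1), of t]) blast
    have cont: "continuous_on S (deriv \<Phi>)" "continuous_on S (deriv \<Psi>)" for S
      using \<Phi>(1) \<Psi>(1) by (simp_all add: smooth_fun_continuous_on smooth_fun_deriv(1))
    have int1: "integral {s..b'} (deriv F) = F b' - F s" if "smooth_fun F" for F
      using has_density_smooth_fun[OF that, THEN has_densityD(4), of s s b' b'] b' st by simp
    have mass: "integral {s..b'} (deriv \<Phi>) = 1" "integral {s..b'} (deriv \<Psi>) = 1"
      using int1[OF \<Phi>(1)] int1[OF \<Psi>(1)] \<Phi>(3)[of s] \<Phi>(4)[of b'] \<Psi>(3)[of s] \<Psi>(4)[of b'] st \<epsilon> by auto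
    define \<phi> where "\<phi> u = \<Phi> u - \<Psi> u" for u
    have smooth: "smooth_fun \<phi>"
      using smooth_fun_affine_combination[OF \<Phi>(1) \<Psi>(1), of 1 1 0 "- 1" 0] by (simp add: \<phi>_def[abs_def])
    have deriv_\<phi>: "deriv \<phi> u = deriv \<Phi> u - deriv \<Psi> u" for u
      unfolding \<phi>_def by (intro DERIV_imp_deriv DERIV_diff smooth_fun_deriv(2) \<Phi>(1) \<Psi>(1))
    have zero: "\<phi> u = 0" if "u \<le> s \<or> t + \<epsilon> \<le> u" for u
    proof (cases "u \<le> s")
      case True
      with st show ?thesis
        by (simp add: \<phi>_def \<Phi>(3) \<Psi>(3))
    next
      case False
      with st that show ?thesis
        by (simp add: \<phi>_def \<Phi>(4) \<Psi>(4))
    qed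
    have zero': "deriv \<phi> u = 0" if "u \<notin> {s..b'}" for u
    proof -
      have "u \<notin> {s..s + \<epsilon>}" "u \<notin> {t..t + \<epsilon>}"
        using that st \<epsilon> by auto
      then show ?thesis
        by (simp add: deriv_\<phi> \<Phi>(5) \<Psi>(5))
    qed
    have zero_scaled: "\<phi> u *\<^sub>R g u = 0" and zero'_scaled: "deriv \<phi> u *\<^sub>R f u = 0" if "u \<notin> {s..b'}" for u
      using zero[of u] zero'[OF that] that \<epsilon> by auto
    have sub: "{s..b'} \<subseteq> {0<..<T}"
      using b' by auto
    have "\<phi> \<in> test_functions T"
    proof -
      have "compact {s..b'} \<and> {s..b'} \<subseteq> {0<..<T} \<and> (\<forall>u. u \<notin> {s..b'} \<longrightarrow> \<phi> u = 0)"
        using sub zero \<epsilon> by auto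
      then show ?thesis
        using smooth unfolding test_functions_def smooth_fun_def by blast
    qed
    then have "(LINT u|lebesgue_on {0<..<T}. deriv \<phi> u *\<^sub>R f u) = - (LINT u|lebesgue_on {0<..<T}. \<phi> u *\<^sub>R g u)"
      using weak by (simp add: has_weak_derivative_def)
    moreover have cont\<phi>: "continuous_on S \<phi>" "continuous_on S (deriv \<phi>)" for S
      using smooth by (simp_all add: smooth_fun_continuous_on smooth_fun_deriv)
    have int: "(\<lambda>u. deriv \<phi> u *\<^sub>R f u) absolutely_integrable_on {s..b'}"
      "(\<lambda>u. deriv \<phi> u *\<^sub>R G u) absolutely_integrable_on {s..b'}"
      by (intro absolutely_integrable_continuous_real continuous_intros cont\<phi> contf
          has_density_continuous_on[OF G])+
    have int': "(\<lambda>u. \<phi> u *\<^sub>R g u) absolutely_integrable_on {s..b'}"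
      by (rule absolutely_integrable_continuous_product[OF bounded_bilinear_scaleR cont\<phi>(1) has_densityD(1)[OF G]])
    ultimately have *: "integral {s..b'} (\<lambda>u. deriv \<phi> u *\<^sub>R f u) = - integral {s..b'} (\<lambda>u. \<phi> u *\<^sub>R g u)"
      using lebesgue_integral_supported[OF sub zero'_scaled int(1)] lebesgue_integral_supported[OF sub zero_scaled int']
      by simp
    from has_densityD(4)[OF has_density_bilinear[OF bounded_bilinear_scaleR has_density_smooth_fun[OF smooth] G], of s b']
    have "integral {s..b'} (\<lambda>u. deriv \<phi> u *\<^sub>R G u + \<phi> u *\<^sub>R g u) = 0"
      using zero[of s] zero[of b'] b' st \<epsilon> by simp
    then have "integral {s..b'} (\<lambda>u. deriv \<phi> u *\<^sub>R G u) = - integral {s..b'} (\<lambda>u. \<phi> u *\<^sub>R g u)"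
      using int int' by (subst (asm) integral_add) (auto simp: absolutely_integrable_on_def eq_neg_iff_add_eq_0)
    with * have "integral {s..b'} (\<lambda>u. deriv \<phi> u *\<^sub>R h u) = 0"
      using int unfolding h_def scaleR_diff_right
      by (subst integral_diff) (auto simp: absolutely_integrable_on_def)
    moreover have "integral {s..b'} (\<lambda>u. deriv \<phi> u *\<^sub>R h u)
        = integral {s..b'} (\<lambda>u. deriv \<Phi> u *\<^sub>R h u) - integral {s..b'} (\<lambda>u. deriv \<Psi> u *\<^sub>R h u)"
      unfolding deriv_\<phi> scaleR_diff_left
      by (intro integral_diff integrable_continuous_real continuous_intros cont conth)
    ultimately have eq: "integral {s..b'} (\<lambda>u. deriv \<Phi> u *\<^sub>R h u) = integral {s..b'} (\<lambda>u. deriv \<Psi> u *\<^sub>R h u)"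
      by simp
    have "norm (integral {s..b'} (\<lambda>u. deriv \<Phi> u *\<^sub>R h u) - h s) \<le> e / 2"
    proof (rule integral_mollified_near[OF conth cont(1) \<Phi>(2) mass(1)])
      fix u assume u: "u \<in> {s..b'}" "deriv \<Phi> u \<noteq> 0"
      then have "\<bar>u - s\<bar> < d1"
        using \<Phi>(5)[of u] \<epsilon> by force
      then show "norm (h u - h s) \<le> e / 2"
        using d1(2)[OF u(1)] by (simp add: dist_norm)
    qed
    moreover have "norm (integral {s..b'} (\<lambda>u. deriv \<Psi> u *\<^sub>R h u) - h t) \<le> e / 2"
    proof (rule integral_mollified_near[OF conth cont(2) \<Psi>(2) mass(2)])
      fix u assume u: "u \<in> {s..b'}" "deriv \<Psi> u \<noteq> 0"
      then have "\<bar>u - t\<bar> < d2"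
        using \<Psi>(5)[of u] \<epsilon> by force
      then show "norm (h u - h t) \<le> e / 2"
        using d2(2)[OF u(1)] by (simp add: dist_norm)
    qed
    ultimately show ?thesis
      unfolding eq dist_norm[symmetric] using dist_triangle3[of "h s" "h t" "integral {s..b'} (\<lambda>u. deriv \<Psi> u *\<^sub>R h u)"]
      by linarith
  qed
  then have "dist (h s) (h t) \<le> 0 + e" if "e > 0" for e
    using that by fastforce
  then have "dist (h s) (h t) \<le> 0"
    by (rule field_le_epsilon)
  then have "h s = h t"
    by simp
  moreover have "G s = 0"
    by (simp add: G_def)
  ultimately have "G t = f t - f s"
    by (simp add: h_def algebra_simps)
  then show "integral {s..t} g = f t - f s"
    by (simp add: G_def)
qed

text \<open>Integration by parts: \<open>\<phi> f\<close> has density \<open>\<phi>' f + \<phi> g\<close>, and \<open>\<phi>\<close> vanishes at the ends of an interval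
around its support.\<close>

lemma has_density_imp_weak_derivative:
  fixes f g :: "real \<Rightarrow> 'a::euclidean_space"
  assumes dens: "\<And>a b. 0 < a \<Longrightarrow> a \<le> b \<Longrightarrow> b < T \<Longrightarrow> has_density f g a b" and T: "0 < T"
  shows "has_weak_derivative T f g"
  unfolding has_weak_derivative_def
proof (intro conjI ballI)
  show "locally_integrable T f"
    using dens by (intro locally_integrableI T)
      (auto intro: absolutely_integrable_continuous_real has_density_continuous_on)
  show "locally_integrable T g"
    using dens by (intro locally_integrableI T) (auto intro: has_densityD)
  fix \<phi> assume "\<phi> \<in> test_functions T"
  then obtain K where smooth: "smooth_fun \<phi>" and K: "compact K" "K \<subseteq> {0<..<T}"
    and zero: "\<And>t. t \<notin> K \<Longrightarrow> \<phi> t = 0"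
    by (auto simp: test_functions_def smooth_fun_def)
  obtain a b where ab: "0 < a" "a \<le> b" "b < T" "K \<subseteq> {a<..<b}"
    by (rule compact_subset_Ioo[OF K T])
  have zero': "deriv \<phi> t = 0" if "t \<notin> K" for t
    using that compact_imp_closed[OF K(1)] zero by (intro deriv_zero_on_open[of "- K" _ _ 0]) auto
  note F = dens[OF ab(1-3)]
  have cont\<phi>: "continuous_on S \<phi>" "continuous_on S (deriv \<phi>)" for S
    using smooth by (simp_all add: smooth_fun_continuous_on smooth_fun_deriv)
  have int: "(\<lambda>u. deriv \<phi> u *\<^sub>R f u) absolutely_integrable_on {a..b}"
    by (intro absolutely_integrable_continuous_real continuous_intros cont\<phi> has_density_continuous_on[OF F])
  have int': "(\<lambda>u. \<phi> u *\<^sub>R g u) absolutely_integrable_on {a..b}"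
    by (rule absolutely_integrable_continuous_product[OF bounded_bilinear_scaleR cont\<phi>(1) has_densityD(1)[OF F]])
  from has_densityD(4)[OF has_density_bilinear[OF bounded_bilinear_scaleR has_density_smooth_fun[OF smooth] F], of a b]
  have "integral {a..b} (\<lambda>u. deriv \<phi> u *\<^sub>R f u + \<phi> u *\<^sub>R g u) = 0"
    using zero[of a] zero[of b] ab by fastforce
  then have "integral {a..b} (\<lambda>u. deriv \<phi> u *\<^sub>R f u) = - integral {a..b} (\<lambda>u. \<phi> u *\<^sub>R g u)"
    using int int' by (subst (asm) integral_add) (auto simp: absolutely_integrable_on_def eq_neg_iff_add_eq_0)
  moreover have sub: "{a..b} \<subseteq> {0<..<T}"
    using ab by auto
  have out: "t \<notin> K" if "t \<notin> {a..b}" for t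
    using that ab(4) by auto
  have "(LINT t|lebesgue_on {0<..<T}. deriv \<phi> t *\<^sub>R f t) = integral {a..b} (\<lambda>u. deriv \<phi> u *\<^sub>R f u)"
    by (rule lebesgue_integral_supported[OF sub _ int]) (simp add: zero'[OF out])
  moreover have "(LINT t|lebesgue_on {0<..<T}. \<phi> t *\<^sub>R g t) = integral {a..b} (\<lambda>u. \<phi> u *\<^sub>R g u)"
    by (rule lebesgue_integral_supported[OF sub _ int']) (simp add: zero[OF out])
  ultimately show "(LINT t|lebesgue_on {0<..<T}. deriv \<phi> t *\<^sub>R f t) = - (LINT t|lebesgue_on {0<..<T}. \<phi> t *\<^sub>R g t)"
    by simp
qed

section \<open>Positive definiteness along the Riccati flow\<close>

lemma quadratic_form_normalized:
  fixes M :: "real^'n^'n"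
  assumes "x \<noteq> 0"
  shows "(x /\<^sub>R norm x) \<bullet> (M *v (x /\<^sub>R norm x)) = (x \<bullet> (M *v x)) / (x \<bullet> x)"
  by (simp add: matrix_vector_mult_scaleR dot_square_norm power2_eq_square divide_inverse)

text \<open>The form \<open>x \<bullet> P(t) x\<close> attains a positive minimum over \<open>t \<in> [a,b]\<close> and unit vectors \<open>x\<close>.\<close>

lemma pos_def_uniformly_coercive:
  fixes P :: "real \<Rightarrow> real^'n^'n"
  assumes P: "continuous_on {a..b} P" and pos: "\<And>t. t \<in> {a..b} \<Longrightarrow> sym_pos_def (P t)" and "a \<le> b"
  shows "\<exists>c>0. \<forall>t\<in>{a..b}. \<forall>x. c * (x \<bullet> x) \<le> x \<bullet> (P t *v x)"
proof -
  let ?K = "{a..b} \<times> sphere (0::real^'n) 1"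
  define f where "f z = snd z \<bullet> (P (fst z) *v snd z)" for z
  have nonempty: "?K \<noteq> {}"
    using \<open>a \<le> b\<close> by simp
  have compact: "compact ?K"
    by (intro compact_Times) auto
  have "continuous_on ?K f"
    unfolding f_def by (intro continuous_intros continuous_on_compose2[OF P]) auto
  from continuous_attains_inf[OF compact nonempty this]
  obtain z where z: "z \<in> ?K" "\<And>w. w \<in> ?K \<Longrightarrow> f z \<le> f w"
    by blast
  define c where "c = f z"
  have "snd z \<noteq> 0" "sym_pos_def (P (fst z))"
    using z(1) pos[of "fst z"] by auto
  then have "c > 0"
    by (simp add: c_def f_def sym_pos_def_def)
  moreover have "c * (x \<bullet> x) \<le> x \<bullet> (P t *v x)" if t: "t \<in> {a..b}" for t x
  proof (cases "x = 0")
    case False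
    have "c \<le> (x /\<^sub>R norm x) \<bullet> (P t *v (x /\<^sub>R norm x))"
    proof -
      have "(t, x /\<^sub>R norm x) \<in> ?K"
        using t False by simp
      from z(2)[OF this] show ?thesis
        unfolding c_def f_def by simp
    qed
    also have "\<dots> = (x \<bullet> (P t *v x)) / (x \<bullet> x)"
      by (rule quadratic_form_normalized[OF False])
    finally show ?thesis
      using False by (simp add: pos_le_divide_eq)
  qed simp
  ultimately show ?thesis
    by blast
qed

text \<open>The function \<open>exp (- 2 K t) \<bar>D t\<bar>\<^sup>2\<close> is nonincreasing, nonnegative and starts at \<open>0\<close>.\<close>

lemma gronwall_zero:
  fixes D :: "real \<Rightarrow> 'a::real_inner"
  assumes D: "\<And>t. t \<in> {0..T} \<Longrightarrow> (D has_vector_derivative D' t) (at t within {0..T})"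
    and le: "\<And>t. t \<in> {0..T} \<Longrightarrow> norm (D' t) \<le> K * norm (D t)"
    and zero: "D 0 = 0" and t: "t \<in> {0..T}"
  shows "D t = 0"
proof -
  define m where "m t = exp (- 2 * K * t) * (D t \<bullet> D t)" for t
  have contD: "continuous_on {0..T} D"
    using D by (meson continuous_on_eq_continuous_within has_vector_derivative_continuous)
  have "m t \<le> m 0"
  proof (rule DERIV_nonpos_imp_decreasing_open[where f = m and a = 0 and b = t])
    show "0 \<le> t"
      using t by simp
    show "continuous_on {0..t} m"
      unfolding m_def using t by (intro continuous_intros continuous_on_subset[OF contD]) auto
    fix s assume s: "0 < s" "s < t"
    have "(D has_vector_derivative D' s) (at s)"
      using D[of s] s t at_within_Icc_at[of 0 s T] by auto
    then have "((\<lambda>s. D s \<bullet> D s) has_real_derivative D s \<bullet> D' s + D' s \<bullet> D s) (at s)"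
      unfolding has_real_derivative_iff_has_vector_derivative
      by (rule bounded_bilinear.has_vector_derivative[OF bounded_bilinear_inner])
        fact
    then have "(m has_real_derivative
        exp (- 2 * K * s) * (- 2 * K) * (D s \<bullet> D s) + (D s \<bullet> D' s + D' s \<bullet> D s) * exp (- 2 * K * s)) (at s)"
      unfolding m_def by (auto intro!: derivative_eq_intros)
    moreover have "D s \<bullet> D' s \<le> K * (D s \<bullet> D s)"
    proof -
      have "norm (D s) * norm (D' s) \<le> norm (D s) * (K * norm (D s))"
        using le[of s] s t by (intro mult_left_mono) auto
      then have "D s \<bullet> D' s \<le> norm (D s) * (K * norm (D s))"
        using norm_cauchy_schwarz[of "D s" "D' s"] by linarith
      then show ?thesis
        by (simp add: dot_square_norm power2_eq_square mult_ac)
    qed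
    then have "exp (- 2 * K * s) * (D s \<bullet> D' s) \<le> exp (- 2 * K * s) * (K * (D s \<bullet> D s))"
      by (intro mult_left_mono) auto
    then have "exp (- 2 * K * s) * (- 2 * K) * (D s \<bullet> D s) + (D s \<bullet> D' s + D' s \<bullet> D s) * exp (- 2 * K * s) \<le> 0"
      by (simp add: inner_commute algebra_simps)
    ultimately show "\<exists>y. (m has_real_derivative y) (at s) \<and> y \<le> 0"
      by blast
  qed
  then have "D t \<bullet> D t \<le> 0"
    by (simp add: m_def zero mult_le_0_iff)
  then show ?thesis
    by (metis inner_eq_zero_iff inner_ge_zero order_antisym)
qed

text \<open>The quadratic terms of the solution and of its transpose differ by terms that are linear in
\<open>D = \<Pi>s - transpose \<Pi>s\<close>, because \<open>XGX - YGY = XG(X - Y) + (X - Y)GY\<close>. So \<open>D\<close> solves a linear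
homogeneous equation with bounded coefficients and initial value \<open>0\<close>.\<close>

lemma riccati_symmetric:
  fixes \<Pi>s :: "real \<Rightarrow> real^'n^'n"
  assumes ode: "\<And>t. t \<in> {0..T} \<Longrightarrow> (\<Pi>s has_vector_derivative
        A ** \<Pi>s t + \<Pi>s t ** transpose A - \<Pi>s t ** G ** \<Pi>s t + W) (at t within {0..T})"
    and G: "transpose G = G" and W: "transpose W = W" and init: "transpose (\<Pi>s 0) = \<Pi>s 0"
    and t: "t \<in> {0..T}"
  shows "transpose (\<Pi>s t) = \<Pi>s t"
proof -
  have cont: "continuous_on {0..T} \<Pi>s"
    using ode by (meson continuous_on_eq_continuous_within has_vector_derivative_continuous)
  define D where "D t = \<Pi>s t - transpose (\<Pi>s t)" for t
  define D' where "D' t = A ** D t + D t ** transpose A - \<Pi>s t ** G ** D t - D t ** G ** transpose (\<Pi>s t)" for t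
  note tr = bounded_linear_transpose[THEN bounded_linear.linear]
  have der: "(D has_vector_derivative D' t) (at t within {0..T})" if "t \<in> {0..T}" for t
  proof -
    have "(D has_vector_derivative
        (A ** \<Pi>s t + \<Pi>s t ** transpose A - \<Pi>s t ** G ** \<Pi>s t + W)
        - transpose (A ** \<Pi>s t + \<Pi>s t ** transpose A - \<Pi>s t ** G ** \<Pi>s t + W)) (at t within {0..T})"
      unfolding D_def
      by (intro has_vector_derivative_diff ode[OF that]
          bounded_linear.has_vector_derivative[OF bounded_linear_transpose])
    moreover have "(A ** \<Pi>s t + \<Pi>s t ** transpose A - \<Pi>s t ** G ** \<Pi>s t + W)
        - transpose (A ** \<Pi>s t + \<Pi>s t ** transpose A - \<Pi>s t ** G ** \<Pi>s t + W) = D' t"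
      by (simp add: D'_def D_def linear_add[OF tr] linear_diff[OF tr] matrix_transpose_mul G W
          matrix_mult_algebra matrix_mul_assoc)
    ultimately show ?thesis
      by simp
  qed
  obtain B where B: "B > 0" "\<And>t. t \<in> {0..T} \<Longrightarrow> norm (\<Pi>s t) \<le> B"
    using compact_imp_bounded[OF compact_continuous_image[OF cont]] unfolding bounded_pos by auto
  obtain B' where B': "B' > 0" "\<And>t. t \<in> {0..T} \<Longrightarrow> norm (transpose (\<Pi>s t)) \<le> B'"
    using compact_imp_bounded[OF compact_continuous_image[OF continuous_on_transpose[OF cont]]]
    unfolding bounded_pos by auto
  obtain L where L: "L > 0"
    "\<And>(X::real^'n^'n) (Y::real^'n^'n). norm (X ** Y) \<le> norm X * norm Y * L"
    using bounded_bilinear.pos_bounded[OF bounded_bilinear_mult_mat] by blast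
  obtain L3 where L3: "L3 > 0"
    "\<And>(X::real^'n^'n) (Y::real^'n^'n) (Z::real^'n^'n).
        norm (X ** Y ** Z) \<le> norm X * norm Y * norm Z * L3"
    by (rule norm_matrix_triple_bound) blast
  define K where "K = norm A * L + norm (transpose A) * L + B * norm G * L3 + norm G * B' * L3"
  have le: "norm (D' t) \<le> K * norm (D t)" if "t \<in> {0..T}" for t
  proof -
    have "norm (D' t) \<le> norm (A ** D t) + norm (D t ** transpose A) + norm (\<Pi>s t ** G ** D t)
        + norm (D t ** G ** transpose (\<Pi>s t))"
      unfolding D'_def by norm
    also have "norm (A ** D t) \<le> norm A * L * norm (D t)"
      using L(2)[of A "D t"] by (simp add: mult_ac)
    also have "norm (D t ** transpose A) \<le> norm (transpose A) * L * norm (D t)"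
      using L(2)[of "D t" "transpose A"] by (simp add: mult_ac)
    also have "norm (\<Pi>s t ** G ** D t) \<le> B * norm G * L3 * norm (D t)"
    proof -
      have "norm (\<Pi>s t) * (norm G * L3 * norm (D t)) \<le> B * (norm G * L3 * norm (D t))"
        using B(2)[OF that] L3(1) by (intro mult_right_mono) auto
      then show ?thesis
        using L3(2)[of "\<Pi>s t" G "D t"] by (simp add: mult_ac)
    qed
    also have "norm (D t ** G ** transpose (\<Pi>s t)) \<le> norm G * B' * L3 * norm (D t)"
    proof -
      have "norm (transpose (\<Pi>s t)) * (norm G * L3 * norm (D t)) \<le> B' * (norm G * L3 * norm (D t))"
        using B'(2)[OF that] L3(1) by (intro mult_right_mono) auto
      then show ?thesis
        using L3(2)[of "D t" G "transpose (\<Pi>s t)"] by (simp add: mult_ac)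
    qed
    finally show ?thesis
      by (simp add: K_def algebra_simps)
  qed
  have "D 0 = 0"
    using init by (simp add: D_def)
  then have "D t = 0"
    using gronwall_zero[OF der le _ t] by blast
  then show ?thesis
    by (simp add: D_def)
qed

text \<open>A zero of a nonnegative form is a minimum. A small step from \<open>v\<close> against the direction \<open>S v\<close> would make
the form negative unless \<open>S v = 0\<close>.\<close>

lemma psd_form_zero_imp_kernel:
  fixes S :: "real^'n^'n"
  assumes sym: "transpose S = S" and psd: "\<And>x. 0 \<le> x \<bullet> (S *v x)" and v: "v \<bullet> (S *v v) = 0"
  shows "S *v v = 0"
proof (rule ccontr)
  assume "S *v v \<noteq> 0"
  define w where "w = S *v v"
  define q where "q = w \<bullet> (S *v w)"
  define s where "s = (w \<bullet> w) / (q + 1)"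
  have q: "q \<ge> 0" and r: "w \<bullet> w > 0"
    using psd \<open>S *v v \<noteq> 0\<close> by (simp_all add: q_def w_def)
  have "0 \<le> (v - s *\<^sub>R w) \<bullet> (S *v (v - s *\<^sub>R w))"
    by (rule psd)
  also have "\<dots> = s\<^sup>2 * q - 2 * s * (w \<bullet> w)"
    using v inner_symmetric_matrix[OF sym, of v w]
    by (simp add: matrix_vector_algebra inner_diff_left inner_diff_right q_def power2_eq_square algebra_simps flip: w_def)
  finally have "s * (2 * (w \<bullet> w)) \<le> s * (s * q)"
    by (simp add: power2_eq_square mult_ac)
  moreover have "s > 0"
    using q r by (simp add: s_def)
  ultimately have "2 * (w \<bullet> w) \<le> s * q"
    by simp
  also have "s * q \<le> w \<bullet> w"
    using q r by (simp add: s_def field_simps)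
  finally show False
    using r by simp
qed

text \<open>Otherwise the least eigenvalue would meet the decreasing barrier \<open>\<epsilon> exp (- c t)\<close>, which starts below it.
At the first time \<open>t\<^sub>1\<close> of contact, at a unit vector \<open>v\<close>, the form minus the barrier is nonnegative with
zero \<open>v\<close>, hence \<open>\<Pi>s(t\<^sub>1) v = \<mu> v\<close> with \<open>\<mu> = \<epsilon> exp (- c t\<^sub>1)\<close>. This evaluates the Riccati equation:
the derivative of \<open>v \<bullet> \<Pi>s v\<close> is at least \<open>- \<mu> (2 \<bar>v \<bullet> A v\<bar> + \<mu> \<bar>v \<bullet> G v\<bar>)\<close>. For large \<open>c\<close> the
barrier falls faster, so \<open>v \<bullet> \<Pi>s v\<close> was below it just before \<open>t\<^sub>1\<close>, which contradicts the choice of \<open>t\<^sub>1\<close>.\<close>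

lemma riccati_pos_def:
  fixes \<Pi>s :: "real \<Rightarrow> real^'n^'n"
  assumes ode: "\<And>t. t \<in> {0..T} \<Longrightarrow> (\<Pi>s has_vector_derivative
        A ** \<Pi>s t + \<Pi>s t ** transpose A - \<Pi>s t ** G ** \<Pi>s t + W) (at t within {0..T})"
    and G: "transpose G = G" and W: "transpose W = W" and W_psd: "\<And>x. 0 \<le> x \<bullet> (W *v x)"
    and init: "sym_pos_def (\<Pi>s 0)" and t: "t \<in> {0..T}"
  shows "sym_pos_def (\<Pi>s t)"
proof -
  have T: "0 \<le> T"
    using t by simp
  have cont: "continuous_on {0..T} \<Pi>s"
    using ode by (meson continuous_on_eq_continuous_within has_vector_derivative_continuous)
  have sym: "transpose (\<Pi>s t) = \<Pi>s t" if "t \<in> {0..T}" for t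
    using init by (intro riccati_symmetric[OF ode G W _ that]) (auto simp: sym_pos_def_def)
  obtain l where l: "l > 0" "\<And>x. l * (x \<bullet> x) \<le> x \<bullet> (\<Pi>s 0 *v x)"
    using pos_def_uniformly_coercive[of 0 0 "\<lambda>_. \<Pi>s 0"] init by auto
  \<comment> \<open>The bound \<open>\<epsilon> \<le> 1\<close> gives \<open>\<mu> \<le> 1\<close>, so that the term with \<open>\<mu>\<^sup>2\<close> is controlled by \<open>\<mu>\<close>.\<close>
  define \<epsilon> where "\<epsilon> = min 1 (l / 2)"
  have \<epsilon>: "0 < \<epsilon>" "\<epsilon> \<le> 1" "\<epsilon> < l"
    using l(1) by (auto simp: \<epsilon>_def)
  obtain k where k: "k > 0" "\<And>(X::real^'n^'n) x. norm (X *v x) \<le> norm X * norm x * k"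
    using bounded_bilinear.pos_bounded[OF bounded_bilinear_mult_vec] by blast
  have form_le: "\<bar>v \<bullet> (X *v v)\<bar> \<le> norm X * k" if "norm v = 1" for X :: "real^'n^'n" and v
    using Cauchy_Schwarz_ineq2[of v "X *v v"] k(2)[of X v] that by simp
  define c where "c = 2 * (norm A * k) + norm G * k + 1"
  have c: "c > 0"
    using k(1) by (simp add: c_def add_nonneg_pos)
  define g where "g v t = v \<bullet> (\<Pi>s t *v v) - \<epsilon> * exp (- c * t)" for v t
  have contg: "continuous_on {0..T} (g v)" for v
    unfolding g_def by (intro continuous_intros cont)
  have pos: "g v t > 0" if v: "norm v = 1" and t: "t \<in> {0..T}" for v t
  proof (rule ccontr)
    assume neg: "\<not> g v t > 0"
    define Z where "Z = {z \<in> {0..T} \<times> sphere 0 1. g (snd z) (fst z) \<le> 0}"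
    let ?K = "{0..T} \<times> sphere (0::real^'n) 1"
    have K: "compact ?K"
      by (intro compact_Times) auto
    have "continuous_on ?K (\<lambda>z. g (snd z) (fst z))"
      unfolding g_def by (intro continuous_intros continuous_on_compose2[OF cont]) auto
    then have "closed (?K \<inter> (\<lambda>z. g (snd z) (fst z)) -` {..0})"
      by (intro continuous_closed_preimage compact_imp_closed[OF K]) auto
    moreover have "Z = ?K \<inter> (\<lambda>z. g (snd z) (fst z)) -` {..0}"
      by (auto simp: Z_def)
    ultimately have "compact Z"
      using compact_Int_closed[OF K, of Z] by (simp add: Int_absorb1 Z_def)
    moreover have "(t, v) \<in> Z"
      using neg v t by (simp add: Z_def)
    then have "Z \<noteq> {}"
      by blast
    ultimately obtain z where z: "z \<in> Z" "\<And>w. w \<in> Z \<Longrightarrow> fst z \<le> fst w"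
      using continuous_attains_inf[of Z fst] continuous_on_fst[OF continuous_on_id] by blast
    obtain t1 v1 where z_eq: "z = (t1, v1)"
      by (cases z)
    have t1: "t1 \<in> {0..T}" and v1: "norm v1 = 1" and g1: "g v1 t1 \<le> 0"
      using z(1) by (auto simp: Z_def z_eq)
    have before: "g w s > 0" if "norm w = 1" "0 \<le> s" "s < t1" for w s
      using z(2)[of "(s, w)"] that t1 by (force simp: Z_def z_eq)
    have "t1 \<noteq> 0"
    proof
      assume "t1 = 0"
      then have "l \<le> \<epsilon>"
        using g1 l(2)[of v1] v1 by (simp add: g_def dot_square_norm)
      then show False
        using \<epsilon>(3) by simp
    qed
    then have t1_pos: "0 < t1"
      using t1 by simp
    define \<mu> where "\<mu> = \<epsilon> * exp (- c * t1)"
    have \<mu>: "0 < \<mu>" "\<mu> \<le> 1"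
      using \<epsilon> c t1_pos mult_mono[of \<epsilon> 1 "exp (- c * t1)" 1] by (auto simp: \<mu>_def)
    have at_t1: "0 \<le> g w t1" if "norm w = 1" for w
    proof (rule ccontr)
      assume "\<not> 0 \<le> g w t1"
      then have "0 < - g w t1"
        by simp
      from continuous_on_near[OF contg t1 this] obtain d where d: "d > 0"
        "\<And>u. u \<in> {0..T} \<Longrightarrow> \<bar>u - t1\<bar> < d \<Longrightarrow> dist (g w u) (g w t1) < - g w t1"
        by blast
      define u where "u = t1 - min t1 d / 2"
      have u: "0 \<le> u" "u < t1" "\<bar>u - t1\<bar> < d"
        using d(1) t1_pos by (auto simp: u_def min_def)
      then show False
        using d(2)[of u] before[OF that u(1,2)] t1 by (auto simp: dist_real_def)
    qed
    let ?S = "\<Pi>s t1 - \<mu> *\<^sub>R mat 1"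
    have "0 \<le> w \<bullet> (?S *v w)" for w
    proof (cases "w = 0")
      case False
      then have "0 \<le> g (w /\<^sub>R norm w) t1"
        by (intro at_t1) simp
      also have "g (w /\<^sub>R norm w) t1 = (w \<bullet> (\<Pi>s t1 *v w)) / (w \<bullet> w) - \<mu>"
        unfolding g_def quadratic_form_normalized[OF False] \<mu>_def ..
      finally have "\<mu> * (w \<bullet> w) \<le> w \<bullet> (\<Pi>s t1 *v w)"
        using False by (simp add: pos_le_divide_eq)
      then show ?thesis
        by (simp add: matrix_vector_algebra inner_diff_right)
    qed simp
    moreover have "v1 \<bullet> (?S *v v1) = 0"
      using at_t1[OF v1] g1 v1
      by (simp add: g_def \<mu>_def matrix_vector_algebra inner_diff_right dot_square_norm)
    moreover have "transpose ?S = ?S"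
      using sym[OF t1] linear_diff[OF bounded_linear_transpose[THEN bounded_linear.linear], of "\<Pi>s t1" "\<mu> *\<^sub>R mat 1"]
        linear_scale[OF bounded_linear_transpose[THEN bounded_linear.linear], of \<mu> "mat 1"]
      by (simp add: transpose_mat)
    ultimately have "?S *v v1 = 0"
      by (intro psd_form_zero_imp_kernel)
    then have eig: "\<Pi>s t1 *v v1 = \<mu> *\<^sub>R v1"
      by (simp add: matrix_vector_algebra)
    let ?D = "A ** \<Pi>s t1 + \<Pi>s t1 ** transpose A - \<Pi>s t1 ** G ** \<Pi>s t1 + W"
    have "(g v1 has_real_derivative v1 \<bullet> (?D *v v1) + c * \<mu>) (at t1 within {0..T})"
    proof -
      have "((\<lambda>t. v1 \<bullet> (\<Pi>s t *v v1)) has_real_derivative v1 \<bullet> (?D *v v1)) (at t1 within {0..T})"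
        unfolding has_real_derivative_iff_has_vector_derivative
        by (intro bounded_linear.has_vector_derivative[OF bounded_linear_inner_right]
            bounded_linear.has_vector_derivative[OF
              bounded_bilinear.bounded_linear_left[OF bounded_bilinear_mult_vec]] ode t1)
      moreover have "((\<lambda>t. \<epsilon> * exp (- c * t)) has_real_derivative - c * \<mu>) (at t1 within {0..T})"
        unfolding \<mu>_def by (auto intro!: derivative_eq_intros)
      ultimately show ?thesis
        unfolding g_def using DERIV_diff by fastforce
    qed
    moreover have "v1 \<bullet> (?D *v v1) + c * \<mu> > 0"
    proof -
      have e1: "v1 \<bullet> ((A ** \<Pi>s t1) *v v1) = \<mu> * (v1 \<bullet> (A *v v1))"
        by (simp add: eig matrix_vector_algebra flip: matrix_vector_mul_assoc)
      have e2: "v1 \<bullet> ((\<Pi>s t1 ** transpose A) *v v1) = \<mu> * (v1 \<bullet> (A *v v1))"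
        using inner_symmetric_matrix[OF sym[OF t1], of v1 "transpose A *v v1"] inner_matrix_transpose[of v1 A v1]
        by (simp add: eig inner_commute flip: matrix_vector_mul_assoc)
      have e3: "v1 \<bullet> ((\<Pi>s t1 ** G ** \<Pi>s t1) *v v1) = \<mu> * \<mu> * (v1 \<bullet> (G *v v1))"
        using inner_symmetric_matrix[OF sym[OF t1], of v1 "G *v v1"]
        by (simp add: eig matrix_vector_algebra inner_commute flip: matrix_vector_mul_assoc)
      have "v1 \<bullet> (?D *v v1) = 2 * \<mu> * (v1 \<bullet> (A *v v1)) - \<mu> * \<mu> * (v1 \<bullet> (G *v v1)) + v1 \<bullet> (W *v v1)"
        by (simp add: matrix_vector_algebra inner_diff_right inner_add_right e1 e2 e3)
      moreover have "\<mu> * (v1 \<bullet> (A *v v1)) \<ge> - (\<mu> * (norm A * k))"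
      proof -
        have "\<mu> * - (v1 \<bullet> (A *v v1)) \<le> \<mu> * (norm A * k)"
          using form_le[OF v1, of A] \<mu> by (intro mult_left_mono) auto
        then show ?thesis
          by simp
      qed
      moreover have "\<mu> * \<mu> * (v1 \<bullet> (G *v v1)) \<le> \<mu> * (norm G * k)"
      proof -
        have "\<mu> * (v1 \<bullet> (G *v v1)) \<le> \<mu> * (norm G * k)"
          using form_le[OF v1, of G] \<mu> by (intro mult_left_mono) auto
        also have "\<dots> \<le> 1 * (norm G * k)"
          using \<mu> k(1) by (intro mult_right_mono) auto
        finally have "\<mu> * (v1 \<bullet> (G *v v1)) \<le> norm G * k"
          by simp
        then have "\<mu> * (\<mu> * (v1 \<bullet> (G *v v1))) \<le> \<mu> * (norm G * k)"
          using \<mu> by (intro mult_left_mono) auto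
        then show ?thesis
          by (simp add: mult.assoc)
      qed
      moreover have "c * \<mu> = 2 * (\<mu> * (norm A * k)) + \<mu> * (norm G * k) + \<mu>"
        by (simp add: c_def algebra_simps)
      ultimately show ?thesis
        using W_psd[of v1] \<mu>(1) by linarith
    qed
    ultimately obtain d where d: "d > 0" "\<And>h. 0 < h \<Longrightarrow> t1 - h \<in> {0..T} \<Longrightarrow> h < d \<Longrightarrow> g v1 (t1 - h) < g v1 t1"
      using has_real_derivative_pos_inc_left by blast
    define h where "h = min t1 d / 2"
    have h: "0 < h" "h < d" "h \<le> t1"
      using d(1) t1_pos by (auto simp: h_def min_def)
    then have "g v1 (t1 - h) < g v1 t1"
      using t1 by (intro d(2)) auto
    moreover have "g v1 (t1 - h) > 0"
      using h by (intro before v1) auto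
    ultimately show False
      using g1 by simp
  qed
  have "0 < x \<bullet> (\<Pi>s t *v x)" if "x \<noteq> 0" for x
  proof -
    have "0 < g (x /\<^sub>R norm x) t"
      using that by (intro pos t) simp
    also have "g (x /\<^sub>R norm x) t \<le> (x \<bullet> (\<Pi>s t *v x)) / (x \<bullet> x)"
      unfolding g_def quadratic_form_normalized[OF that] using \<epsilon> by simp
    finally have "0 < (x \<bullet> (\<Pi>s t *v x)) / (x \<bullet> x)" .
    moreover have "0 < x \<bullet> x"
      using that by simp
    ultimately show ?thesis
      by (simp only: pos_less_divide_eq mult_zero_left)
  qed
  then show ?thesis
    using sym[OF t] by (simp add: sym_pos_def_def)
qed

section \<open>An implicit function theorem for functions that are absolutely continuous in time\<close>

text \<open>On \<open>K\<close>, both the values of \<open>V t\<close> and, for close arguments, their oscillation are controlled by one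
function \<open>w\<close> of time.\<close>

definition dominated_on where
  "dominated_on K V w I \<longleftrightarrow> w integrable_on I \<and> (\<forall>t\<in>I. \<forall>x\<in>K. norm (V t x) \<le> w t) \<and>
    (\<forall>e>0. \<exists>d>0. \<forall>t\<in>I. \<forall>x\<in>K. \<forall>x'\<in>K. dist x x' < d \<longrightarrow> norm (V t x - V t x') \<le> e * w t)"

text \<open>Integrands that are irregular in \<open>t\<close> and continuous in \<open>x\<close>, in the spirit of Caratheodory's conditions:
they can be integrated along continuous curves, and the error of freezing \<open>x\<close> in \<open>V t (X t)\<close> is a
small multiple of an integrable function, locally uniformly in \<open>x\<close>.\<close>

definition caratheodory ::
    "(real \<Rightarrow> 'a::euclidean_space \<Rightarrow> 'b::euclidean_space) \<Rightarrow> real \<Rightarrow> real \<Rightarrow> bool" where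
  "caratheodory V a b \<longleftrightarrow>
    (\<forall>X. continuous_on {a..b} X \<longrightarrow> (\<lambda>t. V t (X t)) absolutely_integrable_on {a..b}) \<and>
    (\<forall>\<rho>. \<exists>w :: real \<Rightarrow> real. dominated_on (cball 0 \<rho>) V w {a..b})"

text \<open>On the compact set \<open>[a,b] \<times> cball 0 \<rho>\<close> the coefficient \<open>L\<close> is bounded and uniformly continuous, so a multiple
of \<open>\<bar>\<gamma>\<bar>\<close> dominates.\<close>

lemma caratheodory_bilinear:
  fixes h :: "'b::euclidean_space \<Rightarrow> 'c::euclidean_space \<Rightarrow> 'd::euclidean_space"
    and L :: "real \<Rightarrow> 'a::euclidean_space \<Rightarrow> 'b"
  assumes h: "bounded_bilinear h" and L: "continuous_on ({a..b} \<times> UNIV) (\<lambda>z. L (fst z) (snd z))"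
    and \<gamma>: "\<gamma> absolutely_integrable_on {a..b}"
  shows "caratheodory (\<lambda>t x. h (L t x) (\<gamma> t)) a b"
  unfolding caratheodory_def
proof (intro conjI allI impI)
  fix X :: "real \<Rightarrow> 'a" assume X: "continuous_on {a..b} X"
  have "continuous_on {a..b} (\<lambda>t. L (fst (t, X t)) (snd (t, X t)))"
    by (rule continuous_on_compose2[OF L]) (auto intro: continuous_intros X)
  then have "continuous_on {a..b} (\<lambda>t. L t (X t))"
    by simp
  then show "(\<lambda>t. h (L t (X t)) (\<gamma> t)) absolutely_integrable_on {a..b}"
    by (rule absolutely_integrable_continuous_product[OF h _ \<gamma>])
next
  fix \<rho> :: real
  let ?K = "{a..b} \<times> cball (0::'a) \<rho>"
  have comp: "compact ?K"
    by (intro compact_Times) auto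
  have contK: "continuous_on ?K (\<lambda>z. L (fst z) (snd z))"
    by (rule continuous_on_subset[OF L]) auto
  obtain B where B: "B > 0" "\<And>z. z \<in> ?K \<Longrightarrow> norm (L (fst z) (snd z)) \<le> B"
    using compact_imp_bounded[OF compact_continuous_image[OF contK comp]]
    unfolding bounded_pos by (metis (no_types, lifting) imageI)
  obtain k where k: "k > 0" "\<And>p q. norm (h p q) \<le> norm p * norm q * k"
    using bounded_bilinear.pos_bounded[OF h] by blast
  define w where "w t = (B + 1) * k * norm (\<gamma> t)" for t
  have le: "norm (h p (\<gamma> t)) \<le> e * w t" if "norm p \<le> e * (B + 1)" "e \<ge> 0" for p e t
  proof -
    have "norm (h p (\<gamma> t)) \<le> norm p * (norm (\<gamma> t) * k)"
      using k(2)[of p "\<gamma> t"] by (simp add: mult.assoc)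
    also have "\<dots> \<le> (e * (B + 1)) * (norm (\<gamma> t) * k)"
      using that k(1) by (intro mult_right_mono) auto
    finally show ?thesis
      by (simp add: w_def mult_ac)
  qed
  have "w integrable_on {a..b}"
    using \<gamma> unfolding w_def by (intro integrable_on_mult_right) (simp add: absolutely_integrable_on_def)
  moreover have "norm (h (L t x) (\<gamma> t)) \<le> w t" if "t \<in> {a..b}" "x \<in> cball 0 \<rho>" for t x
    using B(2)[of "(t, x)"] that le[of "L t x" 1 t] by simp
  moreover have "\<exists>d>0. \<forall>t\<in>{a..b}. \<forall>x\<in>cball 0 \<rho>. \<forall>x'\<in>cball 0 \<rho>. dist x x' < d \<longrightarrow>
        norm (h (L t x) (\<gamma> t) - h (L t x') (\<gamma> t)) \<le> e * w t" if e: "e > 0" for e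
  proof -
    have "uniformly_continuous_on ?K (\<lambda>z. L (fst z) (snd z))"
      by (rule compact_uniformly_continuous[OF contK comp])
    moreover have "e * (B + 1) > 0"
      using e B(1) by simp
    ultimately obtain d where d: "d > 0" "\<And>z z'. z \<in> ?K \<Longrightarrow> z' \<in> ?K \<Longrightarrow> dist z' z < d \<Longrightarrow>
        dist (L (fst z') (snd z')) (L (fst z) (snd z)) < e * (B + 1)"
      unfolding uniformly_continuous_on_def by blast
    have "norm (h (L t x) (\<gamma> t) - h (L t x') (\<gamma> t)) \<le> e * w t"
      if "t \<in> {a..b}" "x \<in> cball 0 \<rho>" "x' \<in> cball 0 \<rho>" "dist x x' < d" for t x x'
    proof -
      have "dist (L t x) (L t x') < e * (B + 1)"
        using d(2)[of "(t, x')" "(t, x)"] that by (simp add: dist_Pair_Pair)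
      then have "norm (h (L t x - L t x') (\<gamma> t)) \<le> e * w t"
        using e by (intro le) (auto simp: dist_norm)
      then show ?thesis
        by (simp add: bounded_bilinear.diff_left[OF h])
    qed
    with d(1) show ?thesis
      by blast
  qed
  ultimately show "\<exists>w :: real \<Rightarrow> real. dominated_on (cball 0 \<rho>) (\<lambda>t x. h (L t x) (\<gamma> t)) w {a..b}"
    unfolding dominated_on_def by blast
qed

lemma caratheodory_zero: "caratheodory (\<lambda>t x. 0) a b"
  unfolding caratheodory_def dominated_on_def by (auto intro!: exI[of _ "\<lambda>_. 0"] exI[of _ "1::real"])

lemma caratheodory_add:
  assumes V: "caratheodory V a b" and W: "caratheodory W a b"
  shows "caratheodory (\<lambda>t x. V t x + W t x) a b"
  unfolding caratheodory_def
proof (intro conjI allI impI)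
  fix X :: "real \<Rightarrow> 'a" assume X: "continuous_on {a..b} X"
  show "(\<lambda>t. V t (X t) + W t (X t)) absolutely_integrable_on {a..b}"
    using V W X unfolding caratheodory_def by (intro set_integral_add(1)) blast+
next
  fix \<rho> :: real
  obtain v w :: "real \<Rightarrow> real" where "dominated_on (cball 0 \<rho>) V v {a..b}" "dominated_on (cball 0 \<rho>) W w {a..b}"
    using V W unfolding caratheodory_def by blast
  note v = this(1)[unfolded dominated_on_def] and w = this(2)[unfolded dominated_on_def]
  have "dominated_on (cball 0 \<rho>) (\<lambda>t x. V t x + W t x) (\<lambda>t. v t + w t) {a..b}"
    unfolding dominated_on_def
  proof (intro conjI ballI allI impI)
    show "(\<lambda>t. v t + w t) integrable_on {a..b}"
      using v w by (intro integrable_add) auto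
    show "norm (V t x + W t x) \<le> v t + w t" if "t \<in> {a..b}" "x \<in> cball 0 \<rho>" for t x
      using v w that by (intro norm_triangle_le add_mono) auto
    fix e :: real assume e: "e > 0"
    obtain d1 where d1: "d1 > 0" "\<forall>t\<in>{a..b}. \<forall>x\<in>cball 0 \<rho>. \<forall>x'\<in>cball 0 \<rho>. dist x x' < d1 \<longrightarrow>
        norm (V t x - V t x') \<le> e * v t"
      using v e by blast
    obtain d2 where d2: "d2 > 0" "\<forall>t\<in>{a..b}. \<forall>x\<in>cball 0 \<rho>. \<forall>x'\<in>cball 0 \<rho>. dist x x' < d2 \<longrightarrow>
        norm (W t x - W t x') \<le> e * w t"
      using w e by blast
    have "norm (V t x + W t x - (V t x' + W t x')) \<le> e * (v t + w t)"
      if "t \<in> {a..b}" "x \<in> cball 0 \<rho>" "x' \<in> cball 0 \<rho>" "dist x x' < min d1 d2" for t x x'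
    proof -
      have "norm (V t x - V t x') \<le> e * v t" "norm (W t x - W t x') \<le> e * w t"
        using d1(2) d2(2) that by auto
      then show ?thesis
        using norm_triangle_ineq[of "V t x - V t x'" "W t x - W t x'"] by (simp add: algebra_simps)
    qed
    then show "\<exists>d>0. \<forall>t\<in>{a..b}. \<forall>x\<in>cball 0 \<rho>. \<forall>x'\<in>cball 0 \<rho>. dist x x' < d \<longrightarrow>
        norm (V t x + W t x - (V t x' + W t x')) \<le> e * (v t + w t)"
      using d1(1) d2(1) by (intro exI[of _ "min d1 d2"]) auto
  qed
  then show "\<exists>w :: real \<Rightarrow> real. dominated_on (cball 0 \<rho>) (\<lambda>t x. V t x + W t x) w {a..b}"
    by blast
qed

lemma caratheodory_sum:
  assumes "\<And>i. i \<in> I \<Longrightarrow> caratheodory (V i) a b"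
  shows "caratheodory (\<lambda>t x. \<Sum>i\<in>I. V i t x) a b"
  using assms
proof (induction I rule: infinite_finite_induct)
  case (insert i I)
  have "caratheodory (\<lambda>t x. V i t x + (\<Sum>i\<in>I. V i t x)) a b"
    using insert by (intro caratheodory_add) simp_all
  then show ?case
    using insert by simp
qed (simp_all add: caratheodory_zero)

text \<open>The mean value theorem for \<open>r \<mapsto> v \<bullet> G (x' + r v)\<close> with \<open>v = x - x'\<close> gives
\<open>c \<bar>v\<bar>\<^sup>2 \<le> v \<bullet> (G x - G x')\<close>.\<close>

lemma coercive_derivative_imp_expansive:
  fixes G :: "real^'n \<Rightarrow> real^'n"
  assumes dG: "\<And>x. (G has_derivative (\<lambda>h. M x *v h)) (at x)"
    and coercive: "\<And>x h. c * (h \<bullet> h) \<le> h \<bullet> (M x *v h)"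
  shows "c * norm (x - x') \<le> norm (G x - G x')"
proof (cases "x = x'")
  case False
  define v where "v = x - x'"
  define \<phi> where "\<phi> r = v \<bullet> G (x' + r *\<^sub>R v)" for r :: real
  have der: "(\<phi> has_derivative (\<lambda>r. v \<bullet> (M (x' + s *\<^sub>R v) *v (r *\<^sub>R v)))) (at s within {0..1})" for s
  proof -
    have "((\<lambda>r. x' + r *\<^sub>R v) has_derivative (\<lambda>r. r *\<^sub>R v)) (at s within {0..1})"
      by (auto intro!: derivative_eq_intros)
    from has_derivative_compose[OF this dG]
    show ?thesis
      unfolding \<phi>_def by (rule has_derivative_inner_right)
  qed
  obtain s where "\<phi> 1 - \<phi> 0 = v \<bullet> (M (x' + s *\<^sub>R v) *v ((1 - 0) *\<^sub>R v))"
    using mvt_very_simple[of 0 1 \<phi>, OF _ der] by auto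
  then have "c * (v \<bullet> v) \<le> \<phi> 1 - \<phi> 0"
    using coercive by simp
  also have "\<phi> 1 - \<phi> 0 = v \<bullet> (G x - G x')"
    by (simp add: \<phi>_def v_def inner_diff_right)
  also have "\<dots> \<le> norm v * norm (G x - G x')"
    by (rule norm_cauchy_schwarz)
  finally have "norm v * (c * norm v) \<le> norm v * norm (G x - G x')"
    by (simp add: dot_square_norm power2_eq_square mult_ac)
  then show ?thesis
    using False by (simp add: v_def)
qed simp

text \<open>For \<open>s \<le> t\<close>, expansivity bounds \<open>c \<bar>X t - X s\<bar>\<close> by \<open>\<bar>G t (X s) - G s (X s)\<bar>\<close>, an integral of
\<open>V u (X s)\<close>; so \<open>X\<close> is continuous and its increments are controlled by an integral. Near \<open>t\<^sub>0\<close>, linearize \<open>G t\<close> with the matrix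
\<open>M t\<^sub>0 (X t\<^sub>0)\<close>: the increment of \<open>X\<close> is minus the inverse of this matrix applied to \<open>\<integral> V u (X s)\<close>, up
to an error that is small compared with \<open>\<bar>X t - X s\<bar>\<close>. Replacing the frozen arguments by the running ones costs
another small multiple of \<open>\<integral> w\<close>, and \<open>has_densityI_local\<close> applies.\<close>

theorem implicit_function_has_density:
  fixes G :: "real \<Rightarrow> real^'n \<Rightarrow> real^'n"
  assumes root: "\<And>t. t \<in> {a..b} \<Longrightarrow> G t (X t) = 0"
    and dG: "\<And>t x. t \<in> {a..b} \<Longrightarrow> (G t has_derivative (\<lambda>h. M t x *v h)) (at x)"
    and M: "continuous_on ({a..b} \<times> UNIV) (\<lambda>z. M (fst z) (snd z))"
    and c: "c > 0" and coercive: "\<And>t x h. t \<in> {a..b} \<Longrightarrow> c * (h \<bullet> h) \<le> h \<bullet> (M t x *v h)"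
    and dens: "\<And>x. has_density (\<lambda>t. G t x) (\<lambda>t. V t x) a b"
    and V: "caratheodory V a b"
  shows "has_density X (\<lambda>t. - (matrix_inv (M t (X t)) *v V t (X t))) a b"
proof -
  note expansive = coercive_derivative_imp_expansive[OF dG coercive]
  obtain \<rho> where \<rho>: "\<And>t. t \<in> {a..b} \<Longrightarrow> X t \<in> cball 0 \<rho>"
  proof -
    have "bounded ((\<lambda>t. G t 0) ` {a..b})"
      by (intro compact_imp_bounded compact_continuous_image has_density_continuous_on[OF dens]) simp
    then obtain r where r: "\<And>t. t \<in> {a..b} \<Longrightarrow> norm (G t 0) \<le> r"
      unfolding bounded_iff by blast
    have "norm (X t) \<le> r / c" if "t \<in> {a..b}" for t
      using expansive[OF that that, of "X t" 0] root[OF that] r[OF that] c by (simp add: field_simps)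
    then show thesis
      by (intro that) simp
  qed
  obtain w :: "real \<Rightarrow> real" where "dominated_on (cball 0 \<rho>) V w {a..b}"
    using V unfolding caratheodory_def by blast
  then have w: "w integrable_on {a..b}"
    and w_bound: "\<And>t x. t \<in> {a..b} \<Longrightarrow> x \<in> cball 0 \<rho> \<Longrightarrow> norm (V t x) \<le> w t"
    and w_modulus: "\<And>e. e > 0 \<Longrightarrow> \<exists>d>0. \<forall>t\<in>{a..b}. \<forall>x\<in>cball 0 \<rho>. \<forall>x'\<in>cball 0 \<rho>. dist x x' < d \<longrightarrow>
        norm (V t x - V t x') \<le> e * w t"
    unfolding dominated_on_def by blast+
  have w_sub: "w integrable_on {s..t}" if "a \<le> s" "t \<le> b" for s t
    using integrable_on_subinterval[OF w] that by simp
  have increment: "norm (X t - X s) \<le> integral {s..t} w / c"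
    if st: "a \<le> s" "s \<le> t" "t \<le> b" for s t
  proof -
    have "c * norm (X t - X s) \<le> norm (G t (X t) - G t (X s))"
      using st by (intro expansive) auto
    also have "\<dots> = norm (integral {s..t} (\<lambda>u. V u (X s)))"
      using st root[of s] root[of t] has_densityD(4)[OF dens st] by simp
    also have "\<dots> \<le> integral {s..t} w"
    proof (rule integral_norm_bound_integral)
      show "(\<lambda>u. V u (X s)) integrable_on {s..t}"
        using has_densityD(3)[OF dens st] by blast
      show "norm (V u (X s)) \<le> w u" if "u \<in> {s..t}" for u
        using that st \<rho>[of s] by (intro w_bound) auto
    qed (use st w_sub in auto)
    finally show ?thesis
      using c by (simp add: field_simps)
  qed
  have contX: "continuous_on {a..b} X"
    unfolding continuous_on_iff
  proof (intro ballI allI impI)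
    fix t e :: real assume t: "t \<in> {a..b}" and e: "e > 0"
    define W where "W t = integral {a..t} w" for t
    have contW: "continuous_on {a..b} W"
      unfolding W_def by (rule indefinite_integral_continuous_1[OF w])
    have W: "dist (X s) (X s') \<le> dist (W s) (W s') / c" if "s \<in> {a..b}" "s' \<in> {a..b}" "s \<le> s'" for s s'
    proof -
      have "W s + integral {s..s'} w = W s'"
        unfolding W_def using that w_sub by (intro Henstock_Kurzweil_Integration.integral_combine) auto
      then show ?thesis
        using increment[of s s'] that c
        by (simp add: dist_norm norm_minus_commute[of "X s"] field_simps) 
    qed
    have "e * c > 0"
      using e c by simp
    from continuous_on_near[OF contW t this] obtain d where d: "d > 0"
      "\<And>u. u \<in> {a..b} \<Longrightarrow> \<bar>u - t\<bar> < d \<Longrightarrow> dist (W u) (W t) < e * c"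
      by blast
    have "dist (X u) (X t) < e" if "u \<in> {a..b}" "dist u t < d" for u
    proof -
      have "dist (X u) (X t) \<le> dist (W u) (W t) / c"
        using W[of u t] W[of t u] that t by (cases "u \<le> t") (auto simp: dist_commute)
      also have "\<dots> < e"
        using d(2)[of u] that c by (simp add: dist_real_def field_simps)
      finally show ?thesis .
    qed
    with d(1) show "\<exists>d>0. \<forall>u\<in>{a..b}. dist u t < d \<longrightarrow> dist (X u) (X t) < e"
      by blast
  qed
  define N where "N t = matrix_inv (M t (X t))" for t
  have inv: "invertible (M t x)" if "t \<in> {a..b}" for t x
    using coercive[OF that] c
    by (intro coercive_imp_invertible) (smt (verit) inner_gt_zero_iff mult_pos_pos)
  have "continuous_on {a..b} (\<lambda>t. M (fst (t, X t)) (snd (t, X t)))"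
    by (rule continuous_on_compose2[OF M]) (auto intro: continuous_intros contX)
  then have contN: "continuous_on {a..b} N"
    unfolding N_def by (intro continuous_on_matrix_inv inv) simp_all
  have VX: "(\<lambda>t. V t (X t)) absolutely_integrable_on {a..b}"
    using V contX unfolding caratheodory_def by blast
  obtain k where k: "k > 0" "\<And>(A::real^'n^'n) x. norm (A *v x) \<le> norm A * norm x * k"
    using bounded_bilinear.pos_bounded[OF bounded_bilinear_mult_vec] by blast
  have "has_density X (\<lambda>t. - (N t *v V t (X t))) a b"
  proof (rule has_densityI_local[OF _ w])
    have NV: "(\<lambda>t. N t *v V t (X t)) absolutely_integrable_on {a..b}"
      by (rule absolutely_integrable_continuous_product[OF bounded_bilinear_mult_vec contN VX])
    then show fint: "(\<lambda>t. - (N t *v V t (X t))) absolutely_integrable_on {a..b}"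
      using absolutely_integrable_linear[OF NV bounded_linear_minus[OF bounded_linear_ident]] by (simp add: o_def)
    fix t0 e :: real assume t0: "t0 \<in> {a..b}" and e: "e > 0"
    \<comment> \<open>Tolerances for \<open>M\<close>, for \<open>V\<close> and for the inverse of \<open>M\<close>; each contributes one third of \<open>e\<close>.\<close>
    define \<eta>1 \<eta>2 \<eta>3 where "\<eta>1 = e * c * c / (3 * k)" "\<eta>2 = e * c / 3" "\<eta>3 = e / (3 * k)"
    have \<eta>: "\<eta>1 > 0" "\<eta>2 > 0" "\<eta>3 > 0"
      using e c k(1) by (auto simp: \<eta>1_\<eta>2_\<eta>3_def)
    obtain d1 where d1: "d1 > 0" "\<And>t x. t \<in> {a..b} \<Longrightarrow> \<bar>t - t0\<bar> < d1 \<Longrightarrow> dist x (X t0) < d1 \<Longrightarrow>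
      dist (M t x) (M t0 (X t0)) < \<eta>1"
    proof -
      have "(t0, X t0) \<in> {a..b} \<times> UNIV"
        using t0 by simp
      then obtain d where d: "d > 0" "\<And>z. z \<in> {a..b} \<times> UNIV \<Longrightarrow> dist z (t0, X t0) < d \<Longrightarrow>
          dist (M (fst z) (snd z)) (M t0 (X t0)) < \<eta>1"
        using M \<eta>(1) unfolding continuous_on_iff by fastforce
      have "dist (M t x) (M t0 (X t0)) < \<eta>1"
        if "t \<in> {a..b}" "\<bar>t - t0\<bar> < d / 2" "dist x (X t0) < d / 2" for t x
      proof -
        have "dist (t, x) (t0, X t0) \<le> dist t t0 + dist x (X t0)"
          unfolding dist_Pair_Pair by (rule sqrt_sum_squares_le_sum) auto
        then have "dist (t, x) (t0, X t0) < d"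
          using that by (simp add: dist_real_def)
        then show ?thesis
          using d(2)[of "(t, x)"] that by simp
      qed
      with d(1) show thesis
        by (intro that[of "d / 2"]) auto
    qed
    obtain d2 where d2: "d2 > 0" "\<And>t x x'. t \<in> {a..b} \<Longrightarrow> x \<in> cball 0 \<rho> \<Longrightarrow> x' \<in> cball 0 \<rho> \<Longrightarrow>
        dist x x' < d2 \<Longrightarrow> norm (V t x - V t x') \<le> \<eta>2 * w t"
      using w_modulus[OF \<eta>(2)] by blast
    obtain d3 where d3: "d3 > 0" "\<And>u. u \<in> {a..b} \<Longrightarrow> \<bar>u - t0\<bar> < d3 \<Longrightarrow> dist (N u) (N t0) < \<eta>3"
      using continuous_on_near[OF contN t0 \<eta>(3)] by blast
    have "min d1 d2 / 2 > 0"
      using d1(1) d2(1) by simp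
    from continuous_on_near[OF contX t0 this]
    obtain d4 where d4: "d4 > 0" "\<And>u. u \<in> {a..b} \<Longrightarrow> \<bar>u - t0\<bar> < d4 \<Longrightarrow> dist (X u) (X t0) < min d1 d2 / 2"
      by blast
    define d where "d = min (min d1 d3) d4"
    have "norm (X t - X s - integral {s..t} (\<lambda>t. - (N t *v V t (X t)))) \<le> e * integral {s..t} w"
      if st: "a \<le> s \<and> s \<le> t0 \<and> t0 \<le> t \<and> t \<le> b \<and> t - s < d" for s t
    proof -
      have mem: "s \<in> {a..b}" "t \<in> {a..b}" "s \<le> t"
        using st by auto
      have near: "u \<in> {a..b}" "\<bar>u - t0\<bar> < d1" "\<bar>u - t0\<bar> < d3" "\<bar>u - t0\<bar> < d4"
        "dist (X u) (X t0) < d1" "dist (X u) (X t0) < d2 / 2" if "u \<in> {s..t}" for u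
      proof -
        show u: "u \<in> {a..b}" "\<bar>u - t0\<bar> < d1" "\<bar>u - t0\<bar> < d3" "\<bar>u - t0\<bar> < d4"
          using that st by (auto simp: d_def)
        have "dist (X u) (X t0) < min d1 d2 / 2"
          by (rule d4(2)[OF u(1,4)])
        then show "dist (X u) (X t0) < d1" "dist (X u) (X t0) < d2 / 2"
          using d1(1) by (auto simp: min_def split: if_splits)
      qed
      define I where "I = integral {s..t} (\<lambda>u. V u (X s))"
      have VI: "((\<lambda>u. V u (X s)) has_integral I) {s..t}"
        and I_eq: "I = G t (X s) - G s (X s)"
        using has_densityD(3,4)[OF dens, of s t "X s"] mem by (auto simp: I_def)
      let ?M0 = "M t0 (X t0)"
      define r where "r = ?M0 *v (X t - X s) - (G t (X t) - G t (X s))"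
      have r: "norm r \<le> \<eta>1 * k * norm (X t - X s)"
      proof -
        have "norm ((?M0 *v X t - G t (X t)) - (?M0 *v X s - G t (X s))) \<le> \<eta>1 * k * norm (X t - X s)"
        proof (rule differentiable_bound[where S = "ball (X t0) d1" and f = "\<lambda>x. ?M0 *v x - G t x"])
          fix x assume x: "x \<in> ball (X t0) d1"
          show "((\<lambda>x. ?M0 *v x - G t x) has_derivative (\<lambda>h. ?M0 *v h - M t x *v h)) (at x within ball (X t0) d1)"
            by (intro has_derivative_diff has_derivative_at_withinI[OF dG[OF mem(2)]]
                bounded_linear_imp_has_derivative matrix_vector_mul_bounded_linear)
          show "onorm (\<lambda>h. ?M0 *v h - M t x *v h) \<le> \<eta>1 * k"
          proof (rule onorm_bound)
            fix h
            have "norm ((?M0 - M t x) *v h) \<le> norm (?M0 - M t x) * (norm h * k)"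
              using k(2) by (simp add: mult.assoc)
            also have "\<dots> \<le> \<eta>1 * (norm h * k)"
              using d1(2)[of t x] x mem near(2)[of t] k(1)
              by (intro mult_right_mono) (auto simp: dist_norm dist_commute norm_minus_commute)
            finally show "norm (?M0 *v h - M t x *v h) \<le> \<eta>1 * k * norm h"
              by (simp add: matrix_vector_algebra mult_ac)
          qed (use \<eta> k in simp)
        qed (use near(5)[of s] near(5)[of t] mem in \<open>auto simp: dist_commute\<close>)
        then show ?thesis
          by (simp add: r_def matrix_vector_algebra algebra_simps)
      qed
      have "?M0 *v (X t - X s) = - I + r"
        using root[OF mem(1)] root[OF mem(2)] by (simp add: r_def I_eq)
      then have "N t0 *v (?M0 *v (X t - X s)) = - (N t0 *v I) + N t0 *v r"
        by (simp add: matrix_vector_algebra)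
      then have step: "X t - X s = - (N t0 *v I) + N t0 *v r"
        by (simp add: N_def matrix_inv_vector_cancel[OF inv[OF t0]])
      have N_le: "norm (N t0 *v v) \<le> norm v / c" for v
        unfolding N_def by (rule norm_matrix_inv_le[OF c coercive[OF t0]])
      have Nr: "norm (N t0 *v r) \<le> e / 3 * integral {s..t} w"
      proof -
        have "norm (N t0 *v r) \<le> \<eta>1 * k * norm (X t - X s) / c"
          using N_le[of r] r c by (meson divide_right_mono less_imp_le order_trans)
        also have "\<dots> \<le> \<eta>1 * k * (integral {s..t} w / c) / c"
          using increment[of s t] mem \<eta> k(1) c
          by (intro divide_right_mono mult_left_mono) auto
        also have "\<dots> = e / 3 * integral {s..t} w"
          using k(1) c by (simp add: \<eta>1_\<eta>2_\<eta>3_def)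
        finally show ?thesis .
      qed
      have NI: "((\<lambda>u. N t0 *v V u (X s)) has_integral N t0 *v I) {s..t}"
        using has_integral_linear[OF VI matrix_vector_mul_bounded_linear[of "N t0"]] by (simp add: o_def)
      have fi: "(\<lambda>u. N u *v V u (X u)) integrable_on {s..t}"
        using absolutely_integrable_on_subinterval[OF NV, of s t] st by (auto simp: absolutely_integrable_on_def)
      have diff: "norm (integral {s..t} (\<lambda>u. N u *v V u (X u)) - N t0 *v I) \<le> (2 * e / 3) * integral {s..t} w"
      proof -
        have "norm (integral {s..t} (\<lambda>u. N u *v V u (X u) - N t0 *v V u (X s)))
            \<le> integral {s..t} (\<lambda>u. (2 * e / 3) * w u)"
        proof (rule integral_norm_bound_integral)
          show "(\<lambda>u. N u *v V u (X u) - N t0 *v V u (X s)) integrable_on {s..t}"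
            using fi NI by (intro integrable_diff) blast+
          show "(\<lambda>u. (2 * e / 3) * w u) integrable_on {s..t}"
            using w_sub st by (intro integrable_on_mult_right) auto
          fix u assume u: "u \<in> {s..t}"
          have wu: "norm (V u (X u)) \<le> w u"
            using near(1)[OF u] \<rho> by (intro w_bound) auto
          have "N u *v V u (X u) - N t0 *v V u (X s)
              = (N u - N t0) *v V u (X u) + N t0 *v (V u (X u) - V u (X s))"
            by (simp add: matrix_vector_algebra)
          also have "norm \<dots> \<le> norm ((N u - N t0) *v V u (X u)) + norm (N t0 *v (V u (X u) - V u (X s)))"
            by (rule norm_triangle_ineq)
          also have "norm ((N u - N t0) *v V u (X u)) \<le> e / 3 * w u"
          proof -
            have "norm ((N u - N t0) *v V u (X u)) \<le> norm (N u - N t0) * norm (V u (X u)) * k"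
              by (rule k(2))
            also have "\<dots> \<le> \<eta>3 * w u * k"
              using d3(2)[OF near(1,3)[OF u]] wu k(1) \<eta>
              by (intro mult_right_mono mult_mono) (auto simp: dist_norm)
            also have "\<dots> = e / 3 * w u"
              using k(1) by (simp add: \<eta>1_\<eta>2_\<eta>3_def)
            finally show ?thesis .
          qed
          also have "norm (N t0 *v (V u (X u) - V u (X s))) \<le> e / 3 * w u"
          proof -
            have "dist (X u) (X s) < d2"
              using near(6)[OF u] near(6)[of s] mem dist_triangle2[of "X u" "X s" "X t0"] by auto
            then have "norm (V u (X u) - V u (X s)) \<le> \<eta>2 * w u"
              using near(1)[OF u] mem \<rho> by (intro d2(2)) auto
            then have "norm (V u (X u) - V u (X s)) / c \<le> \<eta>2 * w u / c"
              using c by (simp add: divide_right_mono)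
            with N_le[of "V u (X u) - V u (X s)"]
            have "norm (N t0 *v (V u (X u) - V u (X s))) \<le> \<eta>2 * w u / c"
              by linarith
            also have "\<dots> = e / 3 * w u"
              using c by (simp add: \<eta>1_\<eta>2_\<eta>3_def)
            finally show ?thesis .
          qed
          finally show "norm (N u *v V u (X u) - N t0 *v V u (X s)) \<le> (2 * e / 3) * w u"
            by simp
        qed
        moreover have "integral {s..t} (\<lambda>u. N u *v V u (X u) - N t0 *v V u (X s))
            = integral {s..t} (\<lambda>u. N u *v V u (X u)) - N t0 *v I"
          using fi NI by (subst integral_diff) (auto simp: integral_unique)
        ultimately show ?thesis
          by simp
      qed
      have "X t - X s - integral {s..t} (\<lambda>t. - (N t *v V t (X t)))
          = (integral {s..t} (\<lambda>u. N u *v V u (X u)) - N t0 *v I) + N t0 *v r"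
        by (simp add: step)
      also have "norm \<dots> \<le> (2 * e / 3) * integral {s..t} w + e / 3 * integral {s..t} w"
        by (rule order_trans[OF norm_triangle_ineq add_mono[OF diff Nr]])
      also have "\<dots> = e * integral {s..t} w"
        by (simp add: field_simps)
      finally show ?thesis .
    qed
    moreover have "d > 0"
      using d1(1) d3(1) d4(1) by (simp add: d_def)
    ultimately show "\<exists>d>0. \<forall>s t. a \<le> s \<and> s \<le> t0 \<and> t0 \<le> t \<and> t \<le> b \<and> t - s < d \<longrightarrow>
        norm (X t - X s - integral {s..t} (\<lambda>t. - (N t *v V t (X t)))) \<le> e * integral {s..t} w"
      by blast
  qed
  then show ?thesis
    by (simp add: N_def)
qed

section \<open>The sum of exponentials of the filter costs\<close>

lemma bounded_bilinear_outer:
  "bounded_bilinear ((\<otimes>\<^sub>o) :: real^'n \<Rightarrow> real^'n \<Rightarrow> real^'n^'n)"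
  unfolding bilinear_conv_bounded_bilinear[symmetric] bilinear_def
  by (auto intro!: linearI simp: outer_def vec_eq_iff algebra_simps)

lemmas continuous_on_outer [continuous_intros] =
  bounded_bilinear.continuous_on[OF bounded_bilinear_outer]

lemma sandwiched_outer_mult_vector:
  fixes N :: "real^'n^'n"
  assumes "transpose N = N"
  shows "(N ** (d \<otimes>\<^sub>o d) ** N) *v h = (d \<bullet> (N *v h)) *\<^sub>R (N *v d)"
  by (simp add: outer_mult_vector matrix_vector_mult_scaleR flip: matrix_vector_mul_assoc)

text \<open>The residuals \<open>r\<close> are abstract here; what matters is that they are continuous and nonnegative. Densities of
\<open>xh\<close> and \<open>r\<close> are arguments of the lemmas, because different representatives occur on different
intervals.\<close>

locale soft_max_bank =
  fixes T \<theta> :: real and S :: "'s set" and P P' :: "'s \<Rightarrow> real \<Rightarrow> real^'n^'n"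
    and xh :: "'s \<Rightarrow> real \<Rightarrow> real^'n" and r :: "'s \<Rightarrow> real \<Rightarrow> real"
  assumes theta_pos: "\<theta> > 0" and T_nonneg: "0 \<le> T" and finite_S: "finite S" and S_nonempty: "S \<noteq> {}"
    and P_pos_def: "\<And>\<sigma> t. \<sigma> \<in> S \<Longrightarrow> t \<in> {0..T} \<Longrightarrow> sym_pos_def (P \<sigma> t)"
    and P_deriv: "\<And>\<sigma> t. \<sigma> \<in> S \<Longrightarrow> t \<in> {0..T} \<Longrightarrow> (P \<sigma> has_vector_derivative P' \<sigma> t) (at t within {0..T})"
    and P'_cont: "\<And>\<sigma>. \<sigma> \<in> S \<Longrightarrow> continuous_on {0..T} (P' \<sigma>)"
    and xh_cont: "\<And>\<sigma>. \<sigma> \<in> S \<Longrightarrow> continuous_on {0..T} (xh \<sigma>)"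
    and r_cont: "\<And>\<sigma>. \<sigma> \<in> S \<Longrightarrow> continuous_on {0..T} (r \<sigma>)"
    and r_nonneg: "\<And>\<sigma> t. \<sigma> \<in> S \<Longrightarrow> t \<in> {0..T} \<Longrightarrow> 0 \<le> r \<sigma> t"
begin

definition cost where
  "cost \<sigma> t x = wnorm_sq (P \<sigma> t) (x - xh \<sigma> t) + r \<sigma> t"

definition weight where
  "weight \<sigma> t x = exp (\<theta> * cost \<sigma> t x)"

text \<open>The gradient of the sum of the weights, divided by \<open>2 \<theta>\<close>.\<close>

definition half_gradient where
  "half_gradient t x = (\<Sum>\<sigma>\<in>S. weight \<sigma> t x *\<^sub>R (P \<sigma> t *v (x - xh \<sigma> t)))"

definition hessian_term where
  "hessian_term \<sigma> t x = weight \<sigma> t x *\<^sub>R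
     (P \<sigma> t + (2 * \<theta>) *\<^sub>R (P \<sigma> t ** ((x - xh \<sigma> t) \<otimes>\<^sub>o (x - xh \<sigma> t)) ** P \<sigma> t))"

abbreviation "M \<equiv> M_mat \<theta> S cost P xh"

lemma M_eq: "M t x = (\<Sum>\<sigma>\<in>S. hessian_term \<sigma> t x)"
  by (simp add: M_mat_def hessian_term_def weight_def)

lemma P_cont: "\<sigma> \<in> S \<Longrightarrow> continuous_on {0..T} (P \<sigma>)"
  using P_deriv by (meson continuous_on_eq_continuous_within has_vector_derivative_continuous)

lemma P_sym: "\<sigma> \<in> S \<Longrightarrow> t \<in> {0..T} \<Longrightarrow> transpose (P \<sigma> t) = P \<sigma> t"
  using P_pos_def by (simp add: sym_pos_def_def)

lemma P_nonneg: "\<sigma> \<in> S \<Longrightarrow> t \<in> {0..T} \<Longrightarrow> 0 \<le> h \<bullet> (P \<sigma> t *v h)"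
  using P_pos_def[of \<sigma> t] by (cases "h = 0") (auto simp: sym_pos_def_def less_imp_le)

lemma cost_nonneg: "\<sigma> \<in> S \<Longrightarrow> t \<in> {0..T} \<Longrightarrow> 0 \<le> cost \<sigma> t x"
  by (simp add: cost_def wnorm_sq_def P_nonneg r_nonneg)

lemma weight_ge_1: "\<sigma> \<in> S \<Longrightarrow> t \<in> {0..T} \<Longrightarrow> 1 \<le> weight \<sigma> t x"
  using theta_pos by (simp add: weight_def cost_nonneg)

lemma weight_pos: "0 < weight \<sigma> t x"
  by (simp add: weight_def)

lemma cost_has_derivative:
  assumes "\<sigma> \<in> S" "t \<in> {0..T}"
  shows "(cost \<sigma> t has_derivative (\<lambda>h. 2 * ((P \<sigma> t *v (x - xh \<sigma> t)) \<bullet> h))) (at x)"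
proof -
  let ?d = "x - xh \<sigma> t"
  have d: "((\<lambda>x. x - xh \<sigma> t) has_derivative (\<lambda>h. h)) (at x)"
    by (auto intro!: derivative_eq_intros)
  have Pd: "((\<lambda>x. P \<sigma> t *v (x - xh \<sigma> t)) has_derivative (\<lambda>h. P \<sigma> t *v h)) (at x)"
    by (rule bounded_linear.has_derivative[OF matrix_vector_mul_bounded_linear d])
  have "((\<lambda>x. (x - xh \<sigma> t) \<bullet> (P \<sigma> t *v (x - xh \<sigma> t)) + r \<sigma> t) has_derivative
      (\<lambda>h. ?d \<bullet> (P \<sigma> t *v h) + h \<bullet> (P \<sigma> t *v ?d) + 0)) (at x)"
    by (intro has_derivative_add has_derivative_inner d Pd has_derivative_const)
  moreover have "?d \<bullet> (P \<sigma> t *v h) + h \<bullet> (P \<sigma> t *v ?d) + 0 = 2 * ((P \<sigma> t *v ?d) \<bullet> h)" for h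
    using inner_symmetric_matrix[OF P_sym[OF assms], of ?d h] by (simp add: inner_commute)
  ultimately show ?thesis
    by (simp add: cost_def[abs_def] wnorm_sq_def)
qed

lemma weight_has_derivative:
  assumes "\<sigma> \<in> S" "t \<in> {0..T}"
  shows "(weight \<sigma> t has_derivative
    (\<lambda>h. weight \<sigma> t x * (2 * \<theta> * ((P \<sigma> t *v (x - xh \<sigma> t)) \<bullet> h)))) (at x)"
proof -
  have "((\<lambda>x. \<theta> * cost \<sigma> t x) has_derivative (\<lambda>h. \<theta> * (2 * ((P \<sigma> t *v (x - xh \<sigma> t)) \<bullet> h)))) (at x)"
    by (rule has_derivative_mult_right[OF cost_has_derivative[OF assms]])
  from has_derivative_exp[OF this] show ?thesis
    by (simp add: weight_def[abs_def] mult_ac)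
qed

lemma hessian_term_mult_vector:
  assumes "\<sigma> \<in> S" "t \<in> {0..T}"
  shows "hessian_term \<sigma> t x *v h = weight \<sigma> t x *\<^sub>R
    (P \<sigma> t *v h + (2 * \<theta>) *\<^sub>R (((x - xh \<sigma> t) \<bullet> (P \<sigma> t *v h)) *\<^sub>R (P \<sigma> t *v (x - xh \<sigma> t))))"
  unfolding hessian_term_def bounded_bilinear.scaleR_left[OF bounded_bilinear_mult_vec]
    bounded_bilinear.add_left[OF bounded_bilinear_mult_vec]
    sandwiched_outer_mult_vector[OF P_sym[OF assms]] ..

text \<open>Differentiating the weight produces the rank-one part of \<open>M\<close>.\<close>

lemma half_gradient_has_derivative:
  assumes t: "t \<in> {0..T}"
  shows "(half_gradient t has_derivative (\<lambda>h. M t x *v h)) (at x)"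
proof -
  have "((\<lambda>x. weight \<sigma> t x *\<^sub>R (P \<sigma> t *v (x - xh \<sigma> t))) has_derivative (\<lambda>h. hessian_term \<sigma> t x *v h)) (at x)"
    if \<sigma>: "\<sigma> \<in> S" for \<sigma>
  proof -
    let ?d = "x - xh \<sigma> t"
    have "((\<lambda>x. P \<sigma> t *v (x - xh \<sigma> t)) has_derivative (\<lambda>h. P \<sigma> t *v h)) (at x)"
      by (rule bounded_linear.has_derivative[OF matrix_vector_mul_bounded_linear])
        (auto intro!: derivative_eq_intros)
    from has_derivative_scaleR[OF weight_has_derivative[OF \<sigma> t] this]
    have "((\<lambda>x. weight \<sigma> t x *\<^sub>R (P \<sigma> t *v (x - xh \<sigma> t))) has_derivative
      (\<lambda>h. weight \<sigma> t x *\<^sub>R (P \<sigma> t *v h) + (weight \<sigma> t x * (2 * \<theta> * ((P \<sigma> t *v ?d) \<bullet> h))) *\<^sub>R (P \<sigma> t *v ?d))) (at x)" .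
    moreover have "weight \<sigma> t x *\<^sub>R (P \<sigma> t *v h) + (weight \<sigma> t x * (2 * \<theta> * ((P \<sigma> t *v ?d) \<bullet> h))) *\<^sub>R (P \<sigma> t *v ?d)
        = hessian_term \<sigma> t x *v h" for h
    proof -
      have "(P \<sigma> t *v ?d) \<bullet> h = ?d \<bullet> (P \<sigma> t *v h)"
        using inner_symmetric_matrix[OF P_sym[OF \<sigma> t], of ?d h] by (simp add: inner_commute)
      then show ?thesis
        by (simp add: hessian_term_mult_vector[OF \<sigma> t] scaleR_add_right)
    qed
    ultimately show ?thesis
      by simp
  qed
  then have "(half_gradient t has_derivative (\<lambda>h. \<Sum>\<sigma>\<in>S. hessian_term \<sigma> t x *v h)) (at x)"
    unfolding half_gradient_def by (intro has_derivative_sum) auto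
  moreover have "(\<Sum>\<sigma>\<in>S. hessian_term \<sigma> t x *v h) = M t x *v h" for h
    unfolding M_eq
    by (rule bounded_bilinear.sum_left[OF bounded_bilinear_mult_vec, symmetric])
  ultimately show ?thesis
    by simp
qed

text \<open>All summands are positive semidefinite and all weights are at least \<open>1\<close>, so one summand already gives
the bound.\<close>

lemma M_coercive:
  obtains c where "c > 0" "\<And>t x h. t \<in> {0..T} \<Longrightarrow> c * (h \<bullet> h) \<le> h \<bullet> (M t x *v h)"
proof -
  obtain \<sigma>0 where \<sigma>0: "\<sigma>0 \<in> S"
    using S_nonempty by blast
  obtain c where c: "c > 0" "\<And>t h. t \<in> {0..T} \<Longrightarrow> c * (h \<bullet> h) \<le> h \<bullet> (P \<sigma>0 t *v h)"
    using pos_def_uniformly_coercive[OF P_cont[OF \<sigma>0] P_pos_def[OF \<sigma>0] T_nonneg] by blast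
  have "c * (h \<bullet> h) \<le> h \<bullet> (M t x *v h)" if t: "t \<in> {0..T}" for t x h
  proof -
    have form: "h \<bullet> (hessian_term \<sigma> t x *v h)
        = weight \<sigma> t x * (h \<bullet> (P \<sigma> t *v h) + 2 * \<theta> * ((x - xh \<sigma> t) \<bullet> (P \<sigma> t *v h))\<^sup>2)" if "\<sigma> \<in> S" for \<sigma>
    proof -
      have "h \<bullet> (P \<sigma> t *v (x - xh \<sigma> t)) = (x - xh \<sigma> t) \<bullet> (P \<sigma> t *v h)"
        by (rule inner_symmetric_matrix[OF P_sym[OF that t]])
      then show ?thesis
        by (simp add: hessian_term_mult_vector[OF that t] inner_add_right power2_eq_square)
    qed
    have ge: "h \<bullet> (P \<sigma> t *v h) \<le> h \<bullet> (hessian_term \<sigma> t x *v h)" if \<sigma>: "\<sigma> \<in> S" for \<sigma>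
    proof -
      let ?q = "h \<bullet> (P \<sigma> t *v h) + 2 * \<theta> * ((x - xh \<sigma> t) \<bullet> (P \<sigma> t *v h))\<^sup>2"
      have "h \<bullet> (P \<sigma> t *v h) \<le> ?q"
        using theta_pos by simp
      also have "1 * ?q \<le> weight \<sigma> t x * ?q"
        using weight_ge_1[OF \<sigma> t] P_nonneg[OF \<sigma> t] theta_pos by (intro mult_right_mono) auto
      finally show ?thesis
        by (simp add: form[OF \<sigma>])
    qed
    have "c * (h \<bullet> h) \<le> h \<bullet> (hessian_term \<sigma>0 t x *v h)"
      using c(2)[OF t, of h] ge[OF \<sigma>0] by linarith
    also have "\<dots> \<le> (\<Sum>\<sigma>\<in>S. h \<bullet> (hessian_term \<sigma> t x *v h))"
      by (intro member_le_sum \<sigma>0 finite_S order_trans[OF P_nonneg[OF _ t] ge]) auto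
    also have "\<dots> = h \<bullet> (M t x *v h)"
      by (simp add: M_eq bounded_bilinear.sum_left[OF bounded_bilinear_mult_vec] inner_sum_right)
    finally show ?thesis .
  qed
  with c(1) show thesis
    by (rule that)
qed

lemma continuous_on_joint:
  assumes "\<sigma> \<in> S" "0 \<le> a" "b \<le> T"
  shows "continuous_on ({a..b} \<times> UNIV) (\<lambda>z. P \<sigma> (fst z))"
    and "continuous_on ({a..b} \<times> UNIV) (\<lambda>z. P' \<sigma> (fst z))"
    and "continuous_on ({a..b} \<times> UNIV) (\<lambda>z. snd z - xh \<sigma> (fst z))"
    and "continuous_on ({a..b} \<times> UNIV) (\<lambda>z. weight \<sigma> (fst z) (snd z))"
    and "continuous_on ({a..b} \<times> UNIV) (\<lambda>z. hessian_term \<sigma> (fst z) (snd z))"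
proof -
  have lift: "continuous_on ({a..b} \<times> UNIV) (\<lambda>z. f (fst z))" if "continuous_on {0..T} f"
    for f :: "real \<Rightarrow> 'x::topological_space"
    by (rule continuous_on_compose2[OF that]) (use assms in \<open>auto intro: continuous_intros\<close>)
  show P: "continuous_on ({a..b} \<times> UNIV) (\<lambda>z. P \<sigma> (fst z))"
    by (rule lift[OF P_cont[OF assms(1)]])
  show "continuous_on ({a..b} \<times> UNIV) (\<lambda>z. P' \<sigma> (fst z))"
    by (rule lift[OF P'_cont[OF assms(1)]])
  show d: "continuous_on ({a..b} \<times> UNIV) (\<lambda>z. snd z - xh \<sigma> (fst z))"
    by (intro continuous_intros lift[OF xh_cont[OF assms(1)]])
  show w: "continuous_on ({a..b} \<times> UNIV) (\<lambda>z. weight \<sigma> (fst z) (snd z))"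
    unfolding weight_def cost_def wnorm_sq_def
    by (intro continuous_intros P d lift[OF r_cont[OF assms(1)]])
  show "continuous_on ({a..b} \<times> UNIV) (\<lambda>z. hessian_term \<sigma> (fst z) (snd z))"
    unfolding hessian_term_def by (intro continuous_intros P d w)
qed

lemma M_continuous:
  assumes "0 \<le> a" "b \<le> T"
  shows "continuous_on ({a..b} \<times> UNIV) (\<lambda>z. M (fst z) (snd z))"
  unfolding M_eq by (intro continuous_on_sum continuous_on_joint(5) assms)

lemma half_gradient_root_unique:
  assumes t: "t \<in> {0..T}" and "half_gradient t x = 0" "half_gradient t x' = 0"
  shows "x = x'"
proof -
  obtain c where c: "c > 0" "\<And>t x h. t \<in> {0..T} \<Longrightarrow> c * (h \<bullet> h) \<le> h \<bullet> (M t x *v h)"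
    by (rule M_coercive) blast
  have "c * norm (x - x') \<le> norm (half_gradient t x - half_gradient t x')"
    by (rule coercive_derivative_imp_expansive[OF half_gradient_has_derivative[OF t] c(2)[OF t]])
  then show ?thesis
    using assms(2,3) c(1) by (simp add: mult_le_0_iff)
qed

lemma soft_max_cost_le_iff:
  "soft_max_cost \<theta> S cost t x \<le> soft_max_cost \<theta> S cost t x' \<longleftrightarrow>
    (\<Sum>\<sigma>\<in>S. weight \<sigma> t x) \<le> (\<Sum>\<sigma>\<in>S. weight \<sigma> t x')"
proof -
  have "0 < (\<Sum>\<sigma>\<in>S. weight \<sigma> t x)" for x
    by (rule sum_pos[OF finite_S S_nonempty weight_pos])
  moreover have "0 < real (card S)"
    using finite_S S_nonempty by (simp add: card_gt_0_iff)
  ultimately show ?thesis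
    unfolding soft_max_cost_def weight_def[symmetric] using theta_pos
    by (simp add: divide_le_cancel ln_le_cancel_iff)
qed

text \<open>A minimizer exists because one weight grows at least quadratically: \<open>exp a \<ge> a\<close> and the coercivity of \<open>P\<close>
show that outside a ball around \<open>xh \<sigma>0 t\<close> the sum exceeds its value at the centre. A minimizer is a
zero of the gradient, and there is only one zero.\<close>

lemma estimator_root:
  assumes t: "t \<in> {0..T}"
  shows "half_gradient t (estimator \<theta> S cost t) = 0"
proof -
  define f where "f x = (\<Sum>\<sigma>\<in>S. weight \<sigma> t x)" for x
  have is_min: "is_arg_min (soft_max_cost \<theta> S cost t) (\<lambda>_. True) x \<longleftrightarrow> (\<forall>x'. f x \<le> f x')" for x
    unfolding is_arg_min_def f_def by (auto simp: not_less soft_max_cost_le_iff)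
  have der: "(f has_derivative (\<lambda>h. (2 * \<theta>) * (half_gradient t x \<bullet> h))) (at x)" for x
  proof -
    have "(f has_derivative (\<lambda>h. \<Sum>\<sigma>\<in>S. weight \<sigma> t x * (2 * \<theta> * ((P \<sigma> t *v (x - xh \<sigma> t)) \<bullet> h)))) (at x)"
      unfolding f_def by (intro has_derivative_sum weight_has_derivative t)
    moreover have "(\<Sum>\<sigma>\<in>S. weight \<sigma> t x * (2 * \<theta> * ((P \<sigma> t *v (x - xh \<sigma> t)) \<bullet> h)))
        = (2 * \<theta>) * (half_gradient t x \<bullet> h)" for h
      by (simp add: half_gradient_def inner_sum_left sum_distrib_left mult_ac)
    ultimately show ?thesis
      by simp
  qed
  have root: "half_gradient t x = 0" if "\<forall>x'. f x \<le> f x'" for x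
  proof -
    have "(\<lambda>h. (2 * \<theta>) * (half_gradient t x \<bullet> h)) = (\<lambda>h. 0)"
      using that by (intro has_derivative_local_min[OF der]) simp
    from fun_cong[OF this, of "half_gradient t x"] show ?thesis
      using theta_pos by simp
  qed
  obtain x where x: "\<forall>x'. f x \<le> f x'"
  proof -
    obtain \<sigma>0 where \<sigma>0: "\<sigma>0 \<in> S"
      using S_nonempty by blast
    obtain c where c: "c > 0" "\<And>t h. t \<in> {0..T} \<Longrightarrow> c * (h \<bullet> h) \<le> h \<bullet> (P \<sigma>0 t *v h)"
      using pos_def_uniformly_coercive[OF P_cont[OF \<sigma>0] P_pos_def[OF \<sigma>0] T_nonneg] by blast
    let ?x0 = "xh \<sigma>0 t"
    define \<rho> where "\<rho> = sqrt (f ?x0 / (\<theta> * c))"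
    have f_pos: "f x > 0" for x
      unfolding f_def by (rule sum_pos[OF finite_S S_nonempty weight_pos])
    have \<rho>: "\<rho> \<ge> 0" "\<theta> * c * \<rho>\<^sup>2 = f ?x0"
      using f_pos[of ?x0] c(1) theta_pos by (auto simp: \<rho>_def)
    have "continuous_on (cball ?x0 \<rho>) f"
      using has_derivative_continuous[OF der] by (simp add: continuous_at_imp_continuous_on)
    moreover have "cball ?x0 \<rho> \<noteq> {}"
      using \<rho>(1) by simp
    ultimately obtain x where x: "x \<in> cball ?x0 \<rho>" "\<And>x'. x' \<in> cball ?x0 \<rho> \<Longrightarrow> f x \<le> f x'"
      using continuous_attains_inf[OF compact_cball] by blast
    have "f x \<le> f x'" for x'
    proof (cases "x' \<in> cball ?x0 \<rho>")
      case False
      then have "\<rho>\<^sup>2 \<le> (norm (x' - ?x0))\<^sup>2"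
        using \<rho>(1) by (intro power_mono) (auto simp: dist_norm norm_minus_commute)
      then have "\<theta> * c * \<rho>\<^sup>2 \<le> \<theta> * c * (norm (x' - ?x0))\<^sup>2"
        using theta_pos c(1) by (intro mult_left_mono) auto
      also have "\<dots> = \<theta> * (c * ((x' - ?x0) \<bullet> (x' - ?x0)))"
        by (simp add: power2_norm_eq_inner)
      also have "\<dots> \<le> \<theta> * cost \<sigma>0 t x'"
        using c(2)[OF t, of "x' - ?x0"] r_nonneg[OF \<sigma>0 t] theta_pos
        by (intro mult_left_mono) (auto simp: cost_def wnorm_sq_def)
      also have "\<dots> \<le> weight \<sigma>0 t x'"
        unfolding weight_def using exp_ge_add_one_self[of "\<theta> * cost \<sigma>0 t x'"] by linarith
      also have "\<dots> \<le> f x'"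
        unfolding f_def by (intro member_le_sum \<sigma>0 finite_S less_imp_le[OF weight_pos])
      finally have "f ?x0 \<le> f x'"
        by (simp add: \<rho>(2))
      then show ?thesis
        using x(2)[of ?x0] \<rho>(1) by auto
    qed (rule x(2))
    then show thesis
      by (intro that) blast
  qed
  have "estimator \<theta> S cost t = x"
    unfolding estimator_def is_min
  proof (rule the_equality)
    show "x' = x" if "\<forall>x''. f x' \<le> f x''" for x'
      using half_gradient_root_unique[OF t root[OF that] root[OF x]] .
  qed (rule x)
  then show ?thesis
    using root[OF x] by simp
qed

text \<open>The time derivative of a summand of the half gradient is affine in the densities of \<open>r\<close> and \<open>xh\<close>. The
following functions are its constant term and the coefficient of the density of \<open>r\<close>; the
coefficient of the density of \<open>xh\<close> turns out to be minus the Hessian term.\<close>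

definition metric_drift where
  "metric_drift \<sigma> t x = weight \<sigma> t x *\<^sub>R (P' \<sigma> t *v (x - xh \<sigma> t))
    + (\<theta> * weight \<sigma> t x * ((x - xh \<sigma> t) \<bullet> (P' \<sigma> t *v (x - xh \<sigma> t)))) *\<^sub>R (P \<sigma> t *v (x - xh \<sigma> t))"

definition misfit_drift where
  "misfit_drift \<sigma> t x = (\<theta> * weight \<sigma> t x) *\<^sub>R (P \<sigma> t *v (x - xh \<sigma> t))"

text \<open>The factor \<open>1\<close> gives every summand the shape "continuous coefficient times integrable function".\<close>

definition drift where
  "drift \<rho> g t x = (\<Sum>\<sigma>\<in>S. 1 *\<^sub>R metric_drift \<sigma> t x + \<rho> \<sigma> t *\<^sub>R misfit_drift \<sigma> t x
    + (- hessian_term \<sigma> t x) *v g \<sigma> t)"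

lemma drift_coefficients_continuous:
  assumes "\<sigma> \<in> S" "0 \<le> a" "b \<le> T"
  shows "continuous_on ({a..b} \<times> UNIV) (\<lambda>z. metric_drift \<sigma> (fst z) (snd z))"
    and "continuous_on ({a..b} \<times> UNIV) (\<lambda>z. misfit_drift \<sigma> (fst z) (snd z))"
  unfolding metric_drift_def misfit_drift_def by (intro continuous_intros continuous_on_joint[OF assms])+

text \<open>Product rule for \<open>P (x - xh)\<close> and for the quadratic form, chain rule for the exponential, product rule
for their product. Symmetry of \<open>P\<close> merges the two terms that contain the density of \<open>xh\<close>.\<close>

lemma half_gradient_has_density:
  assumes ab: "0 \<le> a" "b \<le> T"
    and g: "\<And>\<sigma>. \<sigma> \<in> S \<Longrightarrow> has_density (xh \<sigma>) (g \<sigma>) a b"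
    and \<rho>: "\<And>\<sigma>. \<sigma> \<in> S \<Longrightarrow> has_density (r \<sigma>) (\<rho> \<sigma>) a b"
  shows "has_density (\<lambda>t. half_gradient t x) (\<lambda>t. drift \<rho> g t x) a b"
  unfolding half_gradient_def drift_def
proof (rule has_density_sum)
  fix \<sigma> assume \<sigma>: "\<sigma> \<in> S"
  let ?d = "\<lambda>t. x - xh \<sigma> t"
  have rearrange: "(e * (\<theta> * (- p + (q + - p) + s))) *\<^sub>R u + e *\<^sub>R (v + - w)
      = 1 *\<^sub>R (e *\<^sub>R v + (\<theta> * e * q) *\<^sub>R u) + s *\<^sub>R ((\<theta> * e) *\<^sub>R u)
        + - (e *\<^sub>R (w + (2 * \<theta>) *\<^sub>R (p *\<^sub>R u)))" for e p q s :: real and u v w :: "real^'n"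
    by (simp add: vec_eq_iff algebra_simps)
  have P: "has_density (P \<sigma>) (P' \<sigma>) a b"
    using ab \<sigma> by (intro has_density_C1)
      (auto intro!: has_vector_derivative_within_subset[OF P_deriv] continuous_on_subset[OF P'_cont])
  have d: "has_density ?d (\<lambda>t. 0 - g \<sigma> t) a b"
    by (rule has_density_diff[OF has_density_const g[OF \<sigma>]])
  have Pd: "has_density (\<lambda>t. P \<sigma> t *v ?d t) (\<lambda>t. P' \<sigma> t *v ?d t + P \<sigma> t *v (0 - g \<sigma> t)) a b"
    by (rule has_density_bilinear[OF bounded_bilinear_mult_vec P d])
  have "has_density (\<lambda>t. cost \<sigma> t x)
      (\<lambda>t. (0 - g \<sigma> t) \<bullet> (P \<sigma> t *v ?d t) + ?d t \<bullet> (P' \<sigma> t *v ?d t + P \<sigma> t *v (0 - g \<sigma> t)) + \<rho> \<sigma> t) a b"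
    unfolding cost_def wnorm_sq_def
    by (rule has_density_add[OF has_density_bilinear[OF bounded_bilinear_inner d Pd] \<rho>[OF \<sigma>]])
  from has_density_linear[OF bounded_linear_mult_right this]
  have "has_density (\<lambda>t. \<theta> * cost \<sigma> t x)
      (\<lambda>t. \<theta> * ((0 - g \<sigma> t) \<bullet> (P \<sigma> t *v ?d t) + ?d t \<bullet> (P' \<sigma> t *v ?d t + P \<sigma> t *v (0 - g \<sigma> t)) + \<rho> \<sigma> t)) a b" .
  from has_density_chain[OF DERIV_exp continuous_on_exp[OF continuous_on_id] this]
  have "has_density (\<lambda>t. weight \<sigma> t x)
      (\<lambda>t. weight \<sigma> t x * (\<theta> * ((0 - g \<sigma> t) \<bullet> (P \<sigma> t *v ?d t) + ?d t \<bullet> (P' \<sigma> t *v ?d t + P \<sigma> t *v (0 - g \<sigma> t)) + \<rho> \<sigma> t))) a b"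
    unfolding weight_def .
  from has_density_bilinear[OF bounded_bilinear_scaleR this Pd]
  show "has_density (\<lambda>t. weight \<sigma> t x *\<^sub>R (P \<sigma> t *v ?d t)) (\<lambda>t. 1 *\<^sub>R metric_drift \<sigma> t x
      + \<rho> \<sigma> t *\<^sub>R misfit_drift \<sigma> t x + (- hessian_term \<sigma> t x) *v g \<sigma> t) a b"
  proof (rule has_density_cong)
    fix t assume "t \<in> {a..b}"
    then have t: "t \<in> {0..T}"
      using ab by simp
    have flip: "g \<sigma> t \<bullet> (P \<sigma> t *v ?d t) = ?d t \<bullet> (P \<sigma> t *v g \<sigma> t)"
      by (rule inner_symmetric_matrix[OF P_sym[OF \<sigma> t]])
    show "(weight \<sigma> t x * (\<theta> * ((0 - g \<sigma> t) \<bullet> (P \<sigma> t *v ?d t) + ?d t \<bullet> (P' \<sigma> t *v ?d t + P \<sigma> t *v (0 - g \<sigma> t)) + \<rho> \<sigma> t))) *\<^sub>R (P \<sigma> t *v ?d t)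
        + weight \<sigma> t x *\<^sub>R (P' \<sigma> t *v ?d t + P \<sigma> t *v (0 - g \<sigma> t))
      = 1 *\<^sub>R metric_drift \<sigma> t x + \<rho> \<sigma> t *\<^sub>R misfit_drift \<sigma> t x + (- hessian_term \<sigma> t x) *v g \<sigma> t"
      unfolding metric_drift_def misfit_drift_def
        bounded_bilinear.minus_left[OF bounded_bilinear_mult_vec]
        hessian_term_mult_vector[OF \<sigma> t] diff_0 inner_minus_left flip inner_add_right
        bounded_bilinear.minus_right[OF bounded_bilinear_mult_vec] inner_minus_right
      by (rule rearrange)
  qed simp
qed

lemma drift_caratheodory:
  assumes ab: "0 \<le> a" "b \<le> T"
    and g: "\<And>\<sigma>. \<sigma> \<in> S \<Longrightarrow> g \<sigma> absolutely_integrable_on {a..b}"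
    and \<rho>: "\<And>\<sigma>. \<sigma> \<in> S \<Longrightarrow> \<rho> \<sigma> absolutely_integrable_on {a..b}"
  shows "caratheodory (drift \<rho> g) a b"
  unfolding drift_def
proof (intro caratheodory_sum caratheodory_add)
  fix \<sigma> assume \<sigma>: "\<sigma> \<in> S"
  note flip = bounded_bilinear.flip[OF bounded_bilinear_scaleR]
  have one: "(\<lambda>_. 1 :: real) absolutely_integrable_on {a..b}"
    by (intro absolutely_integrable_continuous_real continuous_intros)
  show "caratheodory (\<lambda>t x. 1 *\<^sub>R metric_drift \<sigma> t x) a b"
    by (rule caratheodory_bilinear[OF flip drift_coefficients_continuous(1)[OF \<sigma> ab] one])
  show "caratheodory (\<lambda>t x. \<rho> \<sigma> t *\<^sub>R misfit_drift \<sigma> t x) a b"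
    by (rule caratheodory_bilinear[OF flip drift_coefficients_continuous(2)[OF \<sigma> ab] \<rho>[OF \<sigma>]])
  show "caratheodory (\<lambda>t x. (- hessian_term \<sigma> t x) *v g \<sigma> t) a b"
    by (rule caratheodory_bilinear[OF bounded_bilinear_mult_vec _ g[OF \<sigma>]])
      (intro continuous_intros continuous_on_joint[OF \<sigma> ab])
qed

lemma estimator_has_density:
  assumes ab: "0 \<le> a" "b \<le> T"
    and g: "\<And>\<sigma>. \<sigma> \<in> S \<Longrightarrow> has_density (xh \<sigma>) (g \<sigma>) a b"
    and \<rho>: "\<And>\<sigma>. \<sigma> \<in> S \<Longrightarrow> has_density (r \<sigma>) (\<rho> \<sigma>) a b"
  shows "has_density (estimator \<theta> S cost)
    (\<lambda>t. - (matrix_inv (M t (estimator \<theta> S cost t)) *v drift \<rho> g t (estimator \<theta> S cost t))) a b"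
proof -
  obtain c where c: "c > 0" "\<And>t x h. t \<in> {0..T} \<Longrightarrow> c * (h \<bullet> h) \<le> h \<bullet> (M t x *v h)"
    by (rule M_coercive) blast
  have sub: "t \<in> {0..T}" if "t \<in> {a..b}" for t
    using that ab by simp
  show ?thesis
    by (rule implicit_function_has_density[OF estimator_root[OF sub] half_gradient_has_derivative[OF sub]
          M_continuous[OF ab] c(1) c(2)[OF sub] half_gradient_has_density[OF ab g \<rho>]
          drift_caratheodory[OF ab has_densityD(1)[OF g] has_densityD(1)[OF \<rho>]]])
qed

text \<open>Affine growth in the densities, with one constant for all of them; this decides the integrability class
of the derivative.\<close>

lemma drift_bound:
  assumes X: "continuous_on {0..T} X"
  shows "\<exists>K\<ge>0. \<forall>\<rho> g. \<forall>t\<in>{0..T}.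
    norm (drift \<rho> g t (X t)) \<le> K * (\<Sum>\<sigma>\<in>S. 1 + \<bar>\<rho> \<sigma> t\<bar> + norm (g \<sigma> t))"
proof -
  have bound: "\<exists>B>0. \<forall>t\<in>{0..T}. norm (f t (X t)) \<le> B"
    if "continuous_on ({0..T} \<times> UNIV) (\<lambda>z. f (fst z) (snd z))"
    for f :: "real \<Rightarrow> real^'n \<Rightarrow> 'x::real_normed_vector"
  proof -
    have "continuous_on {0..T} (\<lambda>t. f (fst (t, X t)) (snd (t, X t)))"
      by (rule continuous_on_compose2[OF that]) (auto intro: continuous_intros X)
    then have "bounded ((\<lambda>t. f t (X t)) ` {0..T})"
      by (intro compact_imp_bounded compact_continuous_image) simp_all
    then show ?thesis
      unfolding bounded_pos by auto
  qed
  obtain k where k: "k > 0" "\<And>(A::real^'n^'n) x. norm (A *v x) \<le> norm A * norm x * k"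
    using bounded_bilinear.pos_bounded[OF bounded_bilinear_mult_vec] by blast
  have "\<exists>B\<ge>0. \<forall>t\<in>{0..T}. \<forall>\<rho> g. norm (1 *\<^sub>R metric_drift \<sigma> t (X t) + (\<rho>::real) *\<^sub>R misfit_drift \<sigma> t (X t) + (- hessian_term \<sigma> t (X t)) *v g)
      \<le> B * (1 + \<bar>\<rho>\<bar> + norm g)" if \<sigma>: "\<sigma> \<in> S" for \<sigma>
  proof -
    note cont = continuous_on_joint[OF \<sigma> order_refl order_refl]
      and cont' = drift_coefficients_continuous[OF \<sigma> order_refl order_refl]
    obtain B1 where B1: "B1 > 0" "\<And>t. t \<in> {0..T} \<Longrightarrow> norm (metric_drift \<sigma> t (X t)) \<le> B1"
      using bound[OF cont'(1)] by blast
    obtain B2 where B2: "B2 > 0" "\<And>t. t \<in> {0..T} \<Longrightarrow> norm (misfit_drift \<sigma> t (X t)) \<le> B2"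
      using bound[OF cont'(2)] by blast
    obtain B3 where B3: "B3 > 0" "\<And>t. t \<in> {0..T} \<Longrightarrow> norm (hessian_term \<sigma> t (X t)) \<le> B3"
      using bound[OF cont(5)] by blast
    have "norm (1 *\<^sub>R metric_drift \<sigma> t (X t) + \<rho> *\<^sub>R misfit_drift \<sigma> t (X t) + (- hessian_term \<sigma> t (X t)) *v g)
        \<le> (B1 + B2 + B3 * k) * (1 + \<bar>\<rho>\<bar> + norm g)" if t: "t \<in> {0..T}" for t \<rho> g
    proof -
      have "norm (1 *\<^sub>R metric_drift \<sigma> t (X t) + \<rho> *\<^sub>R misfit_drift \<sigma> t (X t) + (- hessian_term \<sigma> t (X t)) *v g)
          \<le> norm (metric_drift \<sigma> t (X t)) + \<bar>\<rho>\<bar> * norm (misfit_drift \<sigma> t (X t)) + norm ((- hessian_term \<sigma> t (X t)) *v g)"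
        using norm_triangle_ineq[of "metric_drift \<sigma> t (X t) + \<rho> *\<^sub>R misfit_drift \<sigma> t (X t)" "(- hessian_term \<sigma> t (X t)) *v g"]
          norm_triangle_ineq[of "metric_drift \<sigma> t (X t)" "\<rho> *\<^sub>R misfit_drift \<sigma> t (X t)"]
        by simp
      also have "\<dots> \<le> B1 + \<bar>\<rho>\<bar> * B2 + B3 * k * norm g"
      proof (intro add_mono mult_left_mono)
        have "norm ((- hessian_term \<sigma> t (X t)) *v g) \<le> norm (hessian_term \<sigma> t (X t)) * (norm g * k)"
          using k(2)[of "- hessian_term \<sigma> t (X t)" g] by (simp add: mult.assoc)
        also have "\<dots> \<le> B3 * (norm g * k)"
          using B3(2)[OF t] k(1) by (intro mult_right_mono) auto
        finally show "norm ((- hessian_term \<sigma> t (X t)) *v g) \<le> B3 * k * norm g"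
          by (simp add: mult_ac)
      qed (use B1 B2 t in auto)
      also have "\<dots> \<le> (B1 + B2 + B3 * k) * (1 + \<bar>\<rho>\<bar> + norm g)"
      proof -
        have "0 \<le> B1 * (\<bar>\<rho>\<bar> + norm g) + B2 * (1 + norm g) + B3 * k * (1 + \<bar>\<rho>\<bar>)"
          using B1(1) B2(1) B3(1) k(1) by (intro add_nonneg_nonneg mult_nonneg_nonneg) auto
        then show ?thesis
          by (simp add: algebra_simps)
      qed
      finally show ?thesis .
    qed
    then show ?thesis
      using B1(1) B2(1) B3(1) k(1) by (intro exI[of _ "B1 + B2 + B3 * k"]) auto
  qed
  then have "\<forall>\<sigma>\<in>S. \<exists>B. B \<ge> 0 \<and> (\<forall>t\<in>{0..T}. \<forall>\<rho> g. norm (1 *\<^sub>R metric_drift \<sigma> t (X t) + (\<rho>::real) *\<^sub>R misfit_drift \<sigma> t (X t)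
      + (- hessian_term \<sigma> t (X t)) *v g) \<le> B * (1 + \<bar>\<rho>\<bar> + norm g))"
    by blast
  from bchoice[OF this] obtain B where B': "\<forall>\<sigma>\<in>S. B \<sigma> \<ge> 0 \<and> (\<forall>t\<in>{0..T}. \<forall>\<rho> g.
      norm (1 *\<^sub>R metric_drift \<sigma> t (X t) + (\<rho>::real) *\<^sub>R misfit_drift \<sigma> t (X t)
      + (- hessian_term \<sigma> t (X t)) *v g) \<le> B \<sigma> * (1 + \<bar>\<rho>\<bar> + norm g))"
    by blast
  have B: "B \<sigma> \<ge> 0" "t \<in> {0..T} \<Longrightarrow> norm (1 *\<^sub>R metric_drift \<sigma> t (X t) + (\<rho>::real) *\<^sub>R misfit_drift \<sigma> t (X t)
      + (- hessian_term \<sigma> t (X t)) *v g) \<le> B \<sigma> * (1 + \<bar>\<rho>\<bar> + norm g)" if "\<sigma> \<in> S" for \<sigma> t \<rho> g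
    using B' that by simp_all
  define K where "K = sum B S"
  have BK: "B \<sigma> \<le> K" if "\<sigma> \<in> S" for \<sigma>
    unfolding K_def using that B(1) finite_S by (intro member_le_sum) auto
  have "norm (drift \<rho> g t (X t)) \<le> K * (\<Sum>\<sigma>\<in>S. 1 + \<bar>\<rho> \<sigma> t\<bar> + norm (g \<sigma> t))" if t: "t \<in> {0..T}" for \<rho> g t
    unfolding drift_def sum_distrib_left
  proof (rule sum_norm_le)
    fix \<sigma> assume \<sigma>: "\<sigma> \<in> S"
    have "B \<sigma> * (1 + \<bar>\<rho> \<sigma> t\<bar> + norm (g \<sigma> t)) \<le> K * (1 + \<bar>\<rho> \<sigma> t\<bar> + norm (g \<sigma> t))"
      by (intro mult_right_mono BK \<sigma>) auto
    with B(2)[OF \<sigma> t, of "\<rho> \<sigma> t" "g \<sigma> t"]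
    show "norm (1 *\<^sub>R metric_drift \<sigma> t (X t) + \<rho> \<sigma> t *\<^sub>R misfit_drift \<sigma> t (X t) + (- hessian_term \<sigma> t (X t)) *v g \<sigma> t)
        \<le> K * (1 + \<bar>\<rho> \<sigma> t\<bar> + norm (g \<sigma> t))"
      by linarith
  qed
  moreover have "K \<ge> 0"
    unfolding K_def by (intro sum_nonneg B(1))
  ultimately show ?thesis
    by blast
qed

lemma drift_continuous:
  assumes X: "continuous_on {0..T} X"
    and \<rho>: "\<And>\<sigma>. \<sigma> \<in> S \<Longrightarrow> continuous_on {0..T} (\<rho> \<sigma>)" and g: "\<And>\<sigma>. \<sigma> \<in> S \<Longrightarrow> continuous_on {0..T} (g \<sigma>)"
  shows "continuous_on {0..T} (\<lambda>t. drift \<rho> g t (X t))"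
  unfolding drift_def
proof (rule continuous_on_sum)
  fix \<sigma> assume \<sigma>: "\<sigma> \<in> S"
  have along: "continuous_on {0..T} (\<lambda>t. f t (X t))"
    if "continuous_on ({0..T} \<times> UNIV) (\<lambda>z. f (fst z) (snd z))"
    for f :: "real \<Rightarrow> real^'n \<Rightarrow> 'x::topological_space"
  proof -
    have "continuous_on {0..T} (\<lambda>t. f (fst (t, X t)) (snd (t, X t)))"
      by (rule continuous_on_compose2[OF that]) (auto intro: continuous_intros X)
    then show ?thesis
      by simp
  qed
  note joint = continuous_on_joint(5)[OF \<sigma> order_refl order_refl]
    drift_coefficients_continuous[OF \<sigma> order_refl order_refl]
  show "continuous_on {0..T} (\<lambda>t. 1 *\<^sub>R metric_drift \<sigma> t (X t)
      + \<rho> \<sigma> t *\<^sub>R misfit_drift \<sigma> t (X t) + (- hessian_term \<sigma> t (X t)) *v g \<sigma> t)"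
    by (intro continuous_intros joint[THEN along] \<rho>[OF \<sigma>] g[OF \<sigma>])
qed

text \<open>The terms of \<open>V_vec\<close> regrouped by the function of time to which they are proportional.\<close>

lemma V_vec_eq_drift:
  assumes t: "t \<in> {0..T}"
  shows "V_vec \<theta> S C Q y cost P P' xh g t x
    = drift (\<lambda>\<sigma> t. wnorm_sq (matrix_inv (Q \<sigma>)) (y t - C *v xh \<sigma> t)) g t x"
proof -
  have rearrange: "- (e *\<^sub>R (w - v)) + \<theta> *\<^sub>R ((e * (s - 2 * p + q)) *\<^sub>R u)
      = 1 *\<^sub>R (e *\<^sub>R v + (\<theta> * e * q) *\<^sub>R u) + s *\<^sub>R ((\<theta> * e) *\<^sub>R u)
        + - (e *\<^sub>R (w + (2 * \<theta>) *\<^sub>R (p *\<^sub>R u)))" for e p q s :: real and u v w :: "real^'n"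
    by (simp add: vec_eq_iff algebra_simps)
  show ?thesis
    unfolding V_vec_def drift_def weight_def[symmetric] scaleR_sum_right sum_negf[symmetric] sum.distrib[symmetric]
  proof (rule sum.cong[OF refl])
    fix \<sigma> assume \<sigma>: "\<sigma> \<in> S"
    show "- (weight \<sigma> t x *\<^sub>R (P \<sigma> t *v g \<sigma> t - P' \<sigma> t *v (x - xh \<sigma> t)))
      + \<theta> *\<^sub>R ((weight \<sigma> t x * (wnorm_sq (matrix_inv (Q \<sigma>)) (y t - C *v xh \<sigma> t)
             - 2 * ((x - xh \<sigma> t) \<bullet> (P \<sigma> t *v g \<sigma> t))
             + (x - xh \<sigma> t) \<bullet> (P' \<sigma> t *v (x - xh \<sigma> t)))) *\<^sub>R (P \<sigma> t *v (x - xh \<sigma> t)))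
      = 1 *\<^sub>R metric_drift \<sigma> t x + wnorm_sq (matrix_inv (Q \<sigma>)) (y t - C *v xh \<sigma> t) *\<^sub>R misfit_drift \<sigma> t x
        + (- hessian_term \<sigma> t x) *v g \<sigma> t"
      unfolding metric_drift_def misfit_drift_def
        bounded_bilinear.minus_left[OF bounded_bilinear_mult_vec]
        hessian_term_mult_vector[OF \<sigma> t]
      by (rule rearrange)
  qed
qed

end

section \<open>Densities and growth of the filters\<close>

lemma integrable_Ioo_iff:
  fixes f :: "real \<Rightarrow> 'a::euclidean_space"
  shows "integrable (lebesgue_on {0<..<T}) f \<longleftrightarrow> f absolutely_integrable_on {0..T}"
  unfolding absolutely_integrable_on_Icc_iff_Ioo
  by (simp add: set_integrable_def integrable_restrict_space)

lemma absolutely_integrable_affine: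
  fixes f :: "real \<Rightarrow> real"
  assumes "f absolutely_integrable_on {a..b}"
  shows "(\<lambda>t. K * (1 + f t)) absolutely_integrable_on {a..b}"
proof -
  have "(\<lambda>t. 1 :: real) absolutely_integrable_on {a..b}"
    by (intro absolutely_integrable_continuous_real continuous_intros)
  from set_integral_add(1)[OF this assms] show ?thesis
    by simp
qed

lemma le_1_plus_square: "x \<le> 1 + x\<^sup>2" for x :: real
proof -
  have "2 * x \<le> x\<^sup>2 + 1"
    using sum_squares_bound[of x 1] by simp
  then show ?thesis
    using zero_le_power2[of x] by linarith
qed

lemma Lp_space_2_absolutely_integrable:
  fixes y :: "real \<Rightarrow> 'a::euclidean_space"
  assumes "y \<in> Lp_space T 2"
  shows "(\<lambda>t. (norm (y t))\<^sup>2) absolutely_integrable_on {0..T}" "y absolutely_integrable_on {0..T}"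
proof -
  show sq: "(\<lambda>t. (norm (y t))\<^sup>2) absolutely_integrable_on {0..T}"
    using assms by (simp add: Lp_space_def flip: integrable_Ioo_iff)
  have "(\<lambda>t. 1 + (norm (y t))\<^sup>2) absolutely_integrable_on {0..T}"
    using absolutely_integrable_affine[OF sq, of 1] by simp
  then have "(\<lambda>t. 1 + (norm (y t))\<^sup>2) absolutely_integrable_on {0<..<T}"
    unfolding absolutely_integrable_on_Icc_iff_Ioo .
  then have "(\<lambda>t. 1 + (norm (y t))\<^sup>2) integrable_on {0<..<T}"
    unfolding absolutely_integrable_on_def ..
  then have "y absolutely_integrable_on {0<..<T}"
    using assms le_1_plus_square
    by (intro measurable_bounded_by_integrable_imp_absolutely_integrable[where g = "\<lambda>t. 1 + (norm (y t))\<^sup>2"])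
      (auto simp: Lp_space_def)
  then show "y absolutely_integrable_on {0..T}"
    by (simp add: absolutely_integrable_on_Icc_iff_Ioo)
qed

text \<open>The \<open>p\<close>-th power of \<open>1 + \<bar>y\<bar>\<^sup>2\<close> is at most \<open>2\<^sup>p (1 + \<bar>y\<bar>\<^sup>2\<^sup>p)\<close>: quadratic growth halves the exponent.\<close>

lemma Lp_space_growth:
  fixes f :: "real \<Rightarrow> 'a::euclidean_space" and y :: "real \<Rightarrow> 'b::euclidean_space"
  assumes f: "f absolutely_integrable_on {0..T}" and y: "y \<in> Lp_space T (2 * p)" and K: "K \<ge> 0"
    and le: "\<And>t. t \<in> {0..T} \<Longrightarrow> norm (f t) \<le> K * (1 + (norm (y t))\<^sup>2)"
  shows "f \<in> Lp_space T p"
proof -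
  have meas: "f \<in> borel_measurable (lebesgue_on {0<..<T})"
    using f by (intro absolutely_integrable_imp_borel_measurable) (simp_all add: absolutely_integrable_on_Icc_iff_Ioo)
  have "(\<lambda>t. (norm (y t)) ^ (2 * p)) absolutely_integrable_on {0..T}"
    using y by (simp add: Lp_space_def flip: integrable_Ioo_iff)
  then have "(\<lambda>t. (2 * K) ^ p * (1 + norm (y t) ^ (2 * p))) absolutely_integrable_on {0..T}"
    by (rule absolutely_integrable_affine)
  then have dominating: "integrable (lebesgue_on {0<..<T}) (\<lambda>t. (2 * K) ^ p * (1 + norm (y t) ^ (2 * p)))"
    unfolding integrable_Ioo_iff .
  have le_p: "norm (norm (f t) ^ p) \<le> (2 * K) ^ p * (1 + norm (y t) ^ (2 * p))" if "t \<in> {0<..<T}" for t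
  proof -
    have "norm (f t) ^ p \<le> (K * (1 + (norm (y t))\<^sup>2)) ^ p"
      using le[of t] that by (intro power_mono) auto
    also have "\<dots> \<le> (K * (2 * max 1 ((norm (y t))\<^sup>2))) ^ p"
      using K by (intro power_mono mult_left_mono) auto
    also have "\<dots> = (2 * K) ^ p * (max 1 ((norm (y t))\<^sup>2)) ^ p"
      unfolding power_mult_distrib[symmetric] by (simp only: mult_ac)
    also have "\<dots> \<le> (2 * K) ^ p * (1 + norm (y t) ^ (2 * p))"
    proof (rule mult_left_mono)
      show "(max 1 ((norm (y t))\<^sup>2)) ^ p \<le> 1 + norm (y t) ^ (2 * p)"
        unfolding power_mult by (cases "1 \<le> (norm (y t))\<^sup>2") simp_all
    qed (use K in simp)
    finally show ?thesis
      by simp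
  qed
  have "(\<lambda>t. norm (f t) ^ p) \<in> borel_measurable (lebesgue_on {0<..<T})"
    by (intro borel_measurable_power measurable_compose[OF meas borel_measurable_norm])
  from measurable_bounded_by_integrable_imp_lebesgue_integrable[OF this dominating le_p]
  have "integrable (lebesgue_on {0<..<T}) (\<lambda>t. norm (f t) ^ p)"
    by simp
  with meas show ?thesis
    by (simp add: Lp_space_def)
qed

text \<open>The density of the filter state comes from a weak derivative, hence only on compact subintervals of
\<open>(0,T)\<close>. Continuity carries the constancy of \<open>f - \<integral> g\<close> over to the end points.\<close>

lemma has_density_closure:
  fixes f g :: "real \<Rightarrow> 'a::euclidean_space"
  assumes f: "continuous_on {0..T} f" and g: "g absolutely_integrable_on {0..T}"
    and inner: "\<And>a b. 0 < a \<Longrightarrow> b < T \<Longrightarrow> has_density f g a b" and T: "0 < T"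
  shows "has_density f g 0 T"
proof -
  define F where "F t = f t - integral {0..t} g" for t
  note G = has_density_integral[OF g]
  have "continuous_on {0..T} F"
    unfolding F_def by (intro continuous_intros f has_density_continuous_on[OF G])
  then have cont: "continuous_on (closure {0<..<T}) F"
    using T by simp
  have const: "F t = F (T / 2)" if "t \<in> {0<..<T}" for t
  proof -
    have step: "F s = F u" if "0 < s" "s \<le> u" "u < T" for s u
      using has_densityD(4)[OF inner[of s u], of s u] has_densityD(4)[OF G, of s u] that
      by (simp add: F_def algebra_simps)
    show ?thesis
      using step[of t "T / 2"] step[of "T / 2" t] that by (cases "t \<le> T / 2") auto
  qed
  have "F (T / 2) + integral {0..t} g = f t" if "t \<in> {0..T}" for t
  proof -
    have "t \<in> closure {0<..<T}"
      using that T by simp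
    from continuous_constant_on_closure[OF cont const this] have "F t = F (T / 2)" .
    then show ?thesis
      by (simp add: F_def algebra_simps)
  qed
  moreover have "has_density (\<lambda>t. F (T / 2) + integral {0..t} g) (\<lambda>t. 0 + g t) 0 T"
    by (rule has_density_add[OF has_density_const G])
  ultimately show ?thesis
    using has_density_cong[of "\<lambda>t. F (T / 2) + integral {0..t} g" "\<lambda>t. 0 + g t" 0 T f g] by simp
qed

text \<open>The Riccati equation has the form studied above with \<open>G = C\<^sup>T Q\<inverse> C\<close> and \<open>W = B R B\<^sup>T\<close>, and the inverse of its
solution has the derivative \<open>- \<Pi>k\<inverse> \<Pi>k' \<Pi>k\<inverse>\<close>, which is continuous.\<close>

lemma riccati_solution_regular:
  fixes B :: "real^'m^'n" and C :: "real^'n^'r"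
  assumes ric: "riccati_solution T A B C \<Gamma> R Q \<Pi>k"
    and spd: "sym_pos_def \<Gamma>" "sym_pos_def R" "sym_pos_def Q" and t: "t \<in> {0..T}"
  defines "P' \<equiv> \<lambda>t. vector_derivative (\<lambda>t. matrix_inv (\<Pi>k t)) (at t within {0..T})"
  shows "continuous_on {0..T} \<Pi>k" and "sym_pos_def (matrix_inv (\<Pi>k t))"
    and "0 < T \<Longrightarrow> ((\<lambda>t. matrix_inv (\<Pi>k t)) has_vector_derivative P' t) (at t within {0..T})"
    and "0 < T \<Longrightarrow> continuous_on {0..T} P'"
proof -
  define G where "G = transpose C ** matrix_inv Q ** C"
  define W where "W = B ** R ** transpose B"
  define D where "D t = A ** \<Pi>k t + \<Pi>k t ** transpose A - \<Pi>k t ** G ** \<Pi>k t + W" for t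
  have ode: "(\<Pi>k has_vector_derivative A ** \<Pi>k t + \<Pi>k t ** transpose A - \<Pi>k t ** G ** \<Pi>k t + W) (at t within {0..T})"
    if "t \<in> {0..T}" for t
    using ric that by (simp add: riccati_solution_def G_def W_def matrix_mul_assoc)
  show cont: "continuous_on {0..T} \<Pi>k"
    using ode by (meson continuous_on_eq_continuous_within has_vector_derivative_continuous)
  have G: "transpose G = G"
    using sym_pos_def_matrix_inv[OF spd(3)]
    by (simp add: G_def matrix_transpose_mul sym_pos_def_def matrix_mul_assoc)
  have W: "transpose W = W"
    using spd(2) by (simp add: W_def matrix_transpose_mul sym_pos_def_def matrix_mul_assoc)
  have W_psd: "0 \<le> x \<bullet> (W *v x)" for x
  proof -
    have "x \<bullet> (W *v x) = (transpose B *v x) \<bullet> (R *v (transpose B *v x))"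
      by (simp add: W_def inner_matrix_transpose[of x B] flip: matrix_vector_mul_assoc)
    then show ?thesis
      using spd(2) by (cases "transpose B *v x = 0") (auto simp: sym_pos_def_def less_imp_le)
  qed
  have init: "sym_pos_def (\<Pi>k 0)"
    using ric spd(1) by (simp add: riccati_solution_def)
  have pos: "sym_pos_def (\<Pi>k t)" if "t \<in> {0..T}" for t
    by (rule riccati_pos_def[OF ode G W W_psd init that])
  show "sym_pos_def (matrix_inv (\<Pi>k t))"
    by (rule sym_pos_def_matrix_inv[OF pos[OF t]])
  note inv = sym_pos_def_invertible[OF pos]
  have der: "((\<lambda>t. matrix_inv (\<Pi>k t)) has_vector_derivative
      - (matrix_inv (\<Pi>k t) ** D t ** matrix_inv (\<Pi>k t))) (at t within {0..T})" if "t \<in> {0..T}" for t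
    unfolding D_def by (rule has_vector_derivative_matrix_inv[OF ode[OF that] that inv])
  {
    assume T: "0 < T"
    have P': "P' t = - (matrix_inv (\<Pi>k t) ** D t ** matrix_inv (\<Pi>k t))" if "t \<in> {0..T}" for t
      unfolding P'_def using der[OF that] that T by (intro vector_derivative_within_closed_interval) auto
    show "((\<lambda>t. matrix_inv (\<Pi>k t)) has_vector_derivative P' t) (at t within {0..T})"
      using der[OF t] by (simp add: P'[OF t])
    have "continuous_on {0..T} (\<lambda>t. - (matrix_inv (\<Pi>k t) ** D t ** matrix_inv (\<Pi>k t)))"
      unfolding D_def by (intro continuous_intros continuous_on_matrix_inv cont inv)
    then show "continuous_on {0..T} P'"
      by (rule continuous_on_eq) (simp add: P')
  }
qed

definition filter_rhs where
  "filter_rhs A C Q y \<Pi>k xh t = A *v xh t + (\<Pi>k t ** transpose C ** matrix_inv Q) *v (y t - C *v xh t)"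

definition misfit where
  "misfit C Q y xh t = wnorm_sq (matrix_inv Q) (y t - C *v xh t)"

lemma misfit_nonneg: "sym_pos_def Q \<Longrightarrow> 0 \<le> misfit C Q y xh t"
  using sym_pos_def_matrix_inv[of Q]
  by (cases "y t - C *v xh t = 0") (auto simp: misfit_def wnorm_sq_def sym_pos_def_def less_imp_le)

text \<open>The right-hand side is affine and the misfit quadratic in \<open>y\<close>, with bounded coefficients.\<close>

lemma filter_growth:
  fixes C :: "real^'n^'r" and y :: "real \<Rightarrow> real^'r" and \<Pi>k :: "real \<Rightarrow> real^'n^'n"
  assumes \<Pi>k: "continuous_on {0..T} \<Pi>k" and xh: "continuous_on {0..T} xh"
  shows "\<exists>K\<ge>0. \<forall>t\<in>{0..T}. norm (filter_rhs A C Q y \<Pi>k xh t) \<le> K * (1 + (norm (y t))\<^sup>2) \<and>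
     \<bar>misfit C Q y xh t\<bar> \<le> K * (1 + (norm (y t))\<^sup>2)"
proof -
  have bound: "\<exists>B>0. \<forall>t\<in>{0..T}. norm (f t) \<le> B" if "continuous_on {0..T} f"
    for f :: "real \<Rightarrow> 'x::real_normed_vector"
    using compact_imp_bounded[OF compact_continuous_image[OF that]] unfolding bounded_pos by auto
  let ?L = "\<lambda>t. \<Pi>k t ** transpose C ** matrix_inv Q"
  have "continuous_on {0..T} (\<lambda>t. A *v xh t)" "continuous_on {0..T} ?L" "continuous_on {0..T} (\<lambda>t. C *v xh t)"
    by (intro continuous_intros \<Pi>k xh)+
  from this[THEN bound] obtain B1 B2 B3 where B: "B1 > 0" "B2 > 0" "B3 > 0"
    "\<And>t. t \<in> {0..T} \<Longrightarrow> norm (A *v xh t) \<le> B1" "\<And>t. t \<in> {0..T} \<Longrightarrow> norm (?L t) \<le> B2"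
    "\<And>t. t \<in> {0..T} \<Longrightarrow> norm (C *v xh t) \<le> B3"
    by blast
  obtain k where k: "k > 0" "\<And>(X::real^'r^'n) x. norm (X *v x) \<le> norm X * norm x * k"
    using bounded_bilinear.pos_bounded[OF bounded_bilinear_mult_vec] by blast
  obtain l where l: "l > 0" "\<And>(X::real^'r^'r) x. norm (X *v x) \<le> norm X * norm x * l"
    using bounded_bilinear.pos_bounded[OF bounded_bilinear_mult_vec] by blast
  define K1 where "K1 = B1 + B2 * k * (1 + B3)"
  define K2 where "K2 = norm (matrix_inv Q) * l * (2 + 2 * B3\<^sup>2)"
  have K: "K1 \<ge> 0" "K2 \<ge> 0"
    using B k(1) l(1) by (auto simp: K1_def K2_def)
  have "norm (filter_rhs A C Q y \<Pi>k xh t) \<le> K1 * (1 + (norm (y t))\<^sup>2) \<and>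
     \<bar>misfit C Q y xh t\<bar> \<le> K2 * (1 + (norm (y t))\<^sup>2)" if t: "t \<in> {0..T}" for t
  proof
    let ?z = "y t - C *v xh t" and ?n = "norm (y t)"
    have z: "norm ?z \<le> ?n + B3"
      using norm_triangle_ineq4[of "y t" "C *v xh t"] B(6)[OF t] by simp
    have n: "?n \<le> 1 + ?n\<^sup>2"
      by (rule le_1_plus_square)
    have "norm (filter_rhs A C Q y \<Pi>k xh t) \<le> norm (A *v xh t) + norm (?L t *v ?z)"
      unfolding filter_rhs_def by (rule norm_triangle_ineq)
    also have "norm (?L t *v ?z) \<le> norm (?L t) * norm ?z * k"
      by (rule k(2))
    also have "\<dots> \<le> B2 * (?n + B3) * k"
      using z B k(1) t by (intro mult_right_mono mult_mono) auto
    also have "\<dots> \<le> B2 * ((1 + ?n\<^sup>2) + B3 * (1 + ?n\<^sup>2)) * k"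
      using n B k(1) by (intro mult_right_mono mult_left_mono add_mono) auto
    also have "norm (A *v xh t) \<le> B1 * (1 + ?n\<^sup>2)"
    proof -
      have "B1 * 1 \<le> B1 * (1 + ?n\<^sup>2)"
        using B(1) by (intro mult_left_mono) auto
      then show ?thesis
        using B(4)[OF t] by simp
    qed
    finally show "norm (filter_rhs A C Q y \<Pi>k xh t) \<le> K1 * (1 + ?n\<^sup>2)"
      by (simp add: K1_def algebra_simps)
    have "\<bar>misfit C Q y xh t\<bar> \<le> norm ?z * norm (matrix_inv Q *v ?z)"
      unfolding misfit_def wnorm_sq_def by (rule Cauchy_Schwarz_ineq2)
    also have "\<dots> \<le> norm ?z * (norm (matrix_inv Q) * norm ?z * l)"
      by (intro mult_left_mono l) auto
    also have "\<dots> = (norm (matrix_inv Q) * l) * (norm ?z)\<^sup>2"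
      by (simp add: power2_eq_square mult_ac)
    also have "\<dots> \<le> (norm (matrix_inv Q) * l) * ((2 + 2 * B3\<^sup>2) * (1 + ?n\<^sup>2))"
    proof (rule mult_left_mono)
      have "(norm ?z)\<^sup>2 \<le> (?n + B3)\<^sup>2"
        using z by (intro power_mono) auto
      also have "\<dots> \<le> 2 * ?n\<^sup>2 + 2 * B3\<^sup>2"
        using sum_squares_bound[of ?n B3] by (simp add: power2_sum)
      also have "\<dots> \<le> (2 + 2 * B3\<^sup>2) * (1 + ?n\<^sup>2)"
        by (simp add: algebra_simps)
      finally show "(norm ?z)\<^sup>2 \<le> (2 + 2 * B3\<^sup>2) * (1 + ?n\<^sup>2)" .
    qed (use l(1) in simp)
    finally show "\<bar>misfit C Q y xh t\<bar> \<le> K2 * (1 + ?n\<^sup>2)"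
      by (simp add: K2_def mult_ac)
  qed
  moreover have "K1 * (1 + (norm (y t))\<^sup>2) \<le> (K1 + K2) * (1 + (norm (y t))\<^sup>2)"
    "K2 * (1 + (norm (y t))\<^sup>2) \<le> (K1 + K2) * (1 + (norm (y t))\<^sup>2)" for t
    using K by (simp_all add: mult_right_mono)
  ultimately have "\<forall>t\<in>{0..T}. norm (filter_rhs A C Q y \<Pi>k xh t) \<le> (K1 + K2) * (1 + (norm (y t))\<^sup>2) \<and>
     \<bar>misfit C Q y xh t\<bar> \<le> (K1 + K2) * (1 + (norm (y t))\<^sup>2)"
    by (meson order_trans)
  moreover have "0 \<le> K1 + K2"
    using K by simp
  ultimately show ?thesis
    by blast
qed

lemma misfit_absolutely_integrable:
  fixes C :: "real^'n^'r" and y :: "real \<Rightarrow> real^'r"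
  assumes y: "y \<in> Lp_space T 2" and xh: "continuous_on {0..T} xh"
  shows "misfit C Q y xh absolutely_integrable_on {0..T}"
proof -
  obtain K where K: "\<And>t. t \<in> {0..T} \<Longrightarrow> \<bar>misfit C Q y xh t\<bar> \<le> K * (1 + (norm (y t))\<^sup>2)"
    using filter_growth[OF continuous_on_const[of _ 0] xh] by blast
  have "(\<lambda>t. K * (1 + (norm (y t))\<^sup>2)) absolutely_integrable_on {0..T}"
    by (rule absolutely_integrable_affine[OF Lp_space_2_absolutely_integrable(1)[OF y]])
  then have "(\<lambda>t. K * (1 + (norm (y t))\<^sup>2)) integrable_on {0..T}"
    by (simp add: absolutely_integrable_on_def)
  moreover have "misfit C Q y xh \<in> borel_measurable (lebesgue_on {0..T})"
  proof -
    have "(\<lambda>t. y t - C *v xh t) \<in> borel_measurable (lebesgue_on {0..T})"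
      by (intro borel_measurable_diff
          absolutely_integrable_imp_borel_measurable[OF Lp_space_2_absolutely_integrable(2)[OF y]]
          continuous_imp_measurable_on_sets_lebesgue continuous_intros xh) auto
    moreover have "wnorm_sq (matrix_inv Q) \<in> borel_measurable borel"
      unfolding wnorm_sq_def by (intro borel_measurable_continuous_onI continuous_intros)
    ultimately show ?thesis
      unfolding misfit_def by (rule measurable_compose)
  qed
  ultimately show ?thesis
    using K by (intro measurable_bounded_by_integrable_imp_absolutely_integrable) auto
qed

lemma residual_has_density:
  fixes C :: "real^'n^'r" and y :: "real \<Rightarrow> real^'r"
  assumes y: "y \<in> Lp_space T 2" and xh: "continuous_on {0..T} xh"
  shows "has_density (residual C Q y xh) (misfit C Q y xh) 0 T"
proof -
  note int = misfit_absolutely_integrable[OF y xh]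
  have "residual C Q y xh t = integral {0..t} (misfit C Q y xh)" if "t \<in> {0..T}" for t
  proof -
    have "misfit C Q y xh absolutely_integrable_on {0..t}"
      using that by (intro absolutely_integrable_on_subinterval[OF int]) auto
    then show ?thesis
      unfolding residual_def misfit_def[symmetric]
      by (intro lebesgue_integral_eq_integral absolutely_integrable_imp_integrable) auto
  qed
  then show ?thesis
    by (intro has_density_cong[OF has_density_integral[OF int]]) auto
qed

lemma residual_nonneg:
  assumes "sym_pos_def Q"
  shows "0 \<le> residual C Q y xh t"
  unfolding residual_def misfit_def[symmetric]
  by (intro integral_nonneg_AE AE_I2 misfit_nonneg assms)

lemma filter_has_density:
  fixes C :: "real^'n^'r" and y :: "real \<Rightarrow> real^'r"
  assumes T: "0 < T" and y: "y \<in> Lp_space T 2" and \<Pi>k: "continuous_on {0..T} \<Pi>k"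
    and filt: "filter_solution T A C Q x\<^sub>0 y \<Pi>k xh"
  shows "has_density xh (filter_rhs A C Q y \<Pi>k xh) 0 T"
proof (rule has_density_closure[OF _ _ _ T])
  show xh: "continuous_on {0..T} xh"
    using filt by (simp add: filter_solution_def)
  have weak: "has_weak_derivative T xh (filter_rhs A C Q y \<Pi>k xh)"
    using filt unfolding filter_solution_def filter_rhs_def[abs_def] by blast
  show "has_density xh (filter_rhs A C Q y \<Pi>k xh) a b" if "0 < a" "b < T" for a b
    by (rule weak_derivative_imp_has_density[OF weak xh that])
  have "(\<lambda>t. C *v xh t) absolutely_integrable_on {0..T}" "(\<lambda>t. A *v xh t) absolutely_integrable_on {0..T}"
    by (intro absolutely_integrable_continuous_real continuous_intros xh)+
  note Cxh = this(1) and Axh = this(2)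
  have "continuous_on {0..T} (\<lambda>t. \<Pi>k t ** transpose C ** matrix_inv Q)"
    by (intro continuous_intros \<Pi>k)
  from absolutely_integrable_continuous_product[OF bounded_bilinear_mult_vec this
      set_integral_diff(1)[OF Lp_space_2_absolutely_integrable(2)[OF y] Cxh]]
  show "filter_rhs A C Q y \<Pi>k xh absolutely_integrable_on {0..T}"
    unfolding filter_rhs_def by (rule set_integral_add(1)[OF Axh])
qed

section \<open>Regularity of the estimator\<close>

theorem theorem3p12:
  fixes T \<theta> :: real
    and B :: "real^'m^'n" and C :: "real^'n^'r"
    and x\<^sub>0 :: "real^'n" and y :: "real \<Rightarrow> real^'r"
    and \<Sigma>A :: "'sa set" and \<Sigma>\<Gamma> :: "'sg set" and \<Sigma>R :: "'sr set" and \<Sigma>Q :: "'sq set"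
    and A :: "'sa \<Rightarrow> real^'n^'n" and \<Gamma> :: "'sg \<Rightarrow> real^'n^'n"
    and R :: "'sr \<Rightarrow> real^'m^'m" and Q :: "'sq \<Rightarrow> real^'r^'r"
    and \<Pi>k :: "'sa \<times> 'sg \<times> 'sr \<times> 'sq \<Rightarrow> real \<Rightarrow> real^'n^'n"
    and xh :: "'sa \<times> 'sg \<times> 'sr \<times> 'sq \<Rightarrow> real \<Rightarrow> real^'n"
  defines "S \<equiv> \<Sigma>A \<times> \<Sigma>\<Gamma> \<times> \<Sigma>R \<times> \<Sigma>Q"
    and "P \<equiv> \<lambda>\<sigma> t. matrix_inv (\<Pi>k \<sigma> t)"
  defines "P' \<equiv> \<lambda>\<sigma> t. vector_derivative (P \<sigma>) (at t within {0..T})"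
    and "\<V> \<equiv> \<lambda>\<sigma>. value_fun C (Q (\<sigma>Q \<sigma>)) y (P \<sigma>) (xh \<sigma>)"
  defines "x\<theta> \<equiv> estimator \<theta> S \<V>"
    and "M \<equiv> M_mat \<theta> S \<V> P xh"
    and "V \<equiv> V_vec \<theta> S C (\<lambda>\<sigma>. Q (\<sigma>Q \<sigma>)) y \<V> P P' xh"
  assumes "T > 0" and "\<theta> > 0"
    and "y \<in> Lp_space T 2"
    and "finite \<Sigma>A" "\<Sigma>A \<noteq> {}" "finite \<Sigma>\<Gamma>" "\<Sigma>\<Gamma> \<noteq> {}"
    and "finite \<Sigma>R" "\<Sigma>R \<noteq> {}" "finite \<Sigma>Q" "\<Sigma>Q \<noteq> {}"
    and "\<And>g. g \<in> \<Sigma>\<Gamma> \<Longrightarrow> sym_pos_def (\<Gamma> g)"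
    and "\<And>\<rho>. \<rho> \<in> \<Sigma>R \<Longrightarrow> sym_pos_def (R \<rho>)"
    and "\<And>q. q \<in> \<Sigma>Q \<Longrightarrow> sym_pos_def (Q q)"
    and "\<And>\<sigma>. \<sigma> \<in> S \<Longrightarrow>
           riccati_solution T (A (\<sigma>A \<sigma>)) B C (\<Gamma> (\<sigma>\<Gamma> \<sigma>)) (R (\<sigma>R \<sigma>)) (Q (\<sigma>Q \<sigma>)) (\<Pi>k \<sigma>)"
    and "\<And>\<sigma>. \<sigma> \<in> S \<Longrightarrow>
           filter_solution T (A (\<sigma>A \<sigma>)) C (Q (\<sigma>Q \<sigma>)) x\<^sub>0 y (\<Pi>k \<sigma>) (xh \<sigma>)"
  shows "(\<forall>t\<in>{0..T}. invertible (M t (x\<theta> t))) \<and>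
    (\<forall>p::nat. 1 \<le> p \<and> y \<in> Lp_space T (2 * p) \<longrightarrow>
       x\<theta> \<in> W1p_space T p \<and>
       (\<forall>xh'. (\<forall>\<sigma>\<in>S. has_weak_derivative T (xh \<sigma>) (xh' \<sigma>)) \<longrightarrow>
          has_weak_derivative T x\<theta>
            (\<lambda>t. - (matrix_inv (M t (x\<theta> t)) *v V xh' t (x\<theta> t))))) \<and>
    (continuous_on {0..T} y \<longrightarrow>
       x\<theta> \<in> C1_space T \<and>
       (\<forall>t\<in>{0..T}. (x\<theta> has_vector_derivative
          - (matrix_inv (M t (x\<theta> t)) *v
               V (\<lambda>\<sigma> s. vector_derivative (xh \<sigma>) (at s within {0..T})) t (x\<theta> t)))
          (at t within {0..T})))"
proof -
  note T = \<open>T > 0\<close> and \<theta> = \<open>\<theta> > 0\<close> and y = \<open>y \<in> Lp_space T 2\<close>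
  have S: "finite S" "S \<noteq> {}"
    unfolding S_def using assms by auto
  have spd: "sym_pos_def (\<Gamma> (\<sigma>\<Gamma> \<sigma>))" "sym_pos_def (R (\<sigma>R \<sigma>))" "sym_pos_def (Q (\<sigma>Q \<sigma>))" if "\<sigma> \<in> S" for \<sigma>
    using that assms(19-21) by (auto simp: S_def)
  note riccati = riccati_solution_regular[OF assms(22) spd]
  note filt = assms(23)
  have t0: "0 \<in> {0..T}"
    using T by simp
  have \<Pi>k_cont: "continuous_on {0..T} (\<Pi>k \<sigma>)" and P'_cont: "continuous_on {0..T} (P' \<sigma>)" if "\<sigma> \<in> S" for \<sigma>
    using riccati(1)[OF that that that that t0] riccati(4)[OF that that that that t0 T] by (auto simp: P'_def P_def)
  have xh_cont: "continuous_on {0..T} (xh \<sigma>)" if "\<sigma> \<in> S" for \<sigma>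
    using filt[OF that] by (simp add: filter_solution_def)
  define g where "g \<sigma> = filter_rhs (A (\<sigma>A \<sigma>)) C (Q (\<sigma>Q \<sigma>)) y (\<Pi>k \<sigma>) (xh \<sigma>)" for \<sigma>
  define \<rho> where "\<rho> \<sigma> = misfit C (Q (\<sigma>Q \<sigma>)) y (xh \<sigma>)" for \<sigma>
  define r where "r \<sigma> = residual C (Q (\<sigma>Q \<sigma>)) y (xh \<sigma>)" for \<sigma>
  have g_dens: "has_density (xh \<sigma>) (g \<sigma>) 0 T" if "\<sigma> \<in> S" for \<sigma>
    unfolding g_def by (rule filter_has_density[OF T y \<Pi>k_cont[OF that] filt[OF that]])
  have \<rho>_dens: "has_density (r \<sigma>) (\<rho> \<sigma>) 0 T" if "\<sigma> \<in> S" for \<sigma>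
    unfolding r_def \<rho>_def by (rule residual_has_density[OF y xh_cont[OF that]])
  interpret bank: soft_max_bank T \<theta> S P P' xh r
  proof
    show "sym_pos_def (P \<sigma> t)" "(P \<sigma> has_vector_derivative P' \<sigma> t) (at t within {0..T})"
      if "\<sigma> \<in> S" "t \<in> {0..T}" for \<sigma> t
      using riccati(2)[OF that(1) that(1) that(1) that(1) that(2)]
        riccati(3)[OF that(1) that(1) that(1) that(1) that(2) T] by (auto simp: P_def P'_def)
    show "continuous_on {0..T} (r \<sigma>)" if "\<sigma> \<in> S" for \<sigma>
      by (rule has_density_continuous_on[OF \<rho>_dens[OF that]])
    show "0 \<le> r \<sigma> t" if "\<sigma> \<in> S" for \<sigma> t
      unfolding r_def by (rule residual_nonneg[OF spd(3)[OF that]])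
  qed (use T \<theta> S P'_cont xh_cont in auto)
  have V_cost: "\<V> = bank.cost"
    by (intro ext) (simp add: \<V>_def value_fun_def bank.cost_def r_def)
  have M_eq: "M = M_mat \<theta> S bank.cost P xh" and x_eq: "x\<theta> = estimator \<theta> S bank.cost"
    by (simp_all add: M_def x\<theta>_def V_cost)
  have V_eq: "V xh' t x = bank.drift \<rho> xh' t x" if "t \<in> {0..T}" for xh' t x
    unfolding V_def V_cost bank.V_vec_eq_drift[OF that] \<rho>_def misfit_def ..
  obtain c where c: "c > 0" "\<And>t x h. t \<in> {0..T} \<Longrightarrow> c * (h \<bullet> h) \<le> h \<bullet> (M t x *v h)"
    unfolding M_eq by (rule bank.M_coercive) blast
  have invertible: "invertible (M t (x\<theta> t))" if "t \<in> {0..T}" for t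
  proof (rule coercive_imp_invertible)
    show "0 < h \<bullet> (M t (x\<theta> t) *v h)" if "h \<noteq> 0" for h
      using c(2)[OF \<open>t \<in> {0..T}\<close>, of h "x\<theta> t"] c(1) that by (smt (verit) inner_gt_zero_iff mult_pos_pos)
  qed
  define rate where "rate xh' t = - (matrix_inv (M t (x\<theta> t)) *v V xh' t (x\<theta> t))" for xh' t
  have dens: "has_density x\<theta> (rate xh') a b"
    if "0 \<le> a" "b \<le> T" "\<And>\<sigma>. \<sigma> \<in> S \<Longrightarrow> has_density (xh \<sigma>) (xh' \<sigma>) a b" for xh' a b
  proof -
    have "has_density x\<theta> (\<lambda>t. - (matrix_inv (M t (x\<theta> t)) *v bank.drift \<rho> xh' t (x\<theta> t))) a b"
      unfolding M_eq x_eq using that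
      by (intro bank.estimator_has_density has_density_subinterval[OF \<rho>_dens]) auto
    then show ?thesis
      by (rule has_density_cong) (use that in \<open>simp_all add: rate_def V_eq\<close>)
  qed
  \<comment> \<open>An arbitrary weak derivative is integrable on compact subintervals of \<open>(0,T)\<close> only.\<close>
  have weak: "has_weak_derivative T x\<theta> (rate xh')"
    if "\<And>a b \<sigma>. 0 < a \<Longrightarrow> b < T \<Longrightarrow> \<sigma> \<in> S \<Longrightarrow> has_density (xh \<sigma>) (xh' \<sigma>) a b" for xh'
    using that by (intro has_density_imp_weak_derivative dens T) auto
  \<comment> \<open>The right-hand sides of the filter equations are integrable on all of \<open>[0,T]\<close>.\<close>
  have dens_g: "has_density x\<theta> (rate g) 0 T"
    by (rule dens) (auto intro: g_dens)
  note x_cont = has_density_continuous_on[OF dens_g]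

  have W1p: "x\<theta> \<in> W1p_space T p" if "1 \<le> p" "y \<in> Lp_space T (2 * p)" for p
  proof -
    have "\<exists>K\<ge>0. \<forall>t\<in>{0..T}. norm (rate g t) \<le> K * (1 + (norm (y t))\<^sup>2)"
    proof -
      obtain K where K: "K \<ge> 0" "\<And>t. t \<in> {0..T} \<Longrightarrow>
          norm (bank.drift \<rho> g t (x\<theta> t)) \<le> K * (\<Sum>\<sigma>\<in>S. 1 + \<bar>\<rho> \<sigma> t\<bar> + norm (g \<sigma> t))"
        using bank.drift_bound[OF x_cont] by blast
      have "\<forall>\<sigma>\<in>S. \<exists>L. 0 \<le> L \<and> (\<forall>t\<in>{0..T}. norm (g \<sigma> t) \<le> L * (1 + (norm (y t))\<^sup>2) \<and>
          \<bar>\<rho> \<sigma> t\<bar> \<le> L * (1 + (norm (y t))\<^sup>2))"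
        unfolding g_def \<rho>_def by (intro ballI filter_growth \<Pi>k_cont xh_cont)
      from bchoice[OF this] obtain L where L: "\<forall>\<sigma>\<in>S. 0 \<le> L \<sigma> \<and> (\<forall>t\<in>{0..T}.
          norm (g \<sigma> t) \<le> L \<sigma> * (1 + (norm (y t))\<^sup>2) \<and> \<bar>\<rho> \<sigma> t\<bar> \<le> L \<sigma> * (1 + (norm (y t))\<^sup>2))"
        by blast
      define K' where "K' = K * (\<Sum>\<sigma>\<in>S. 1 + 2 * L \<sigma>) / c"
      have "norm (rate g t) \<le> K' * (1 + (norm (y t))\<^sup>2)" if t: "t \<in> {0..T}" for t
      proof -
        let ?n = "1 + (norm (y t))\<^sup>2"
        have "norm (rate g t) \<le> norm (bank.drift \<rho> g t (x\<theta> t)) / c"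
          unfolding rate_def norm_minus_cancel V_eq[OF t] by (rule norm_matrix_inv_le[OF c(1) c(2)[OF t]])
        also have "\<dots> \<le> K * (\<Sum>\<sigma>\<in>S. 1 + \<bar>\<rho> \<sigma> t\<bar> + norm (g \<sigma> t)) / c"
          using K(2)[OF t] c(1) by (intro divide_right_mono) auto
        also have "\<dots> \<le> K * (\<Sum>\<sigma>\<in>S. (1 + 2 * L \<sigma>) * ?n) / c"
        proof (intro divide_right_mono mult_left_mono sum_mono)
          fix \<sigma> assume "\<sigma> \<in> S"
          then have "\<bar>\<rho> \<sigma> t\<bar> \<le> L \<sigma> * ?n" "norm (g \<sigma> t) \<le> L \<sigma> * ?n"
            using L t by auto
          moreover have "1 \<le> ?n"
            by simp
          moreover have "(1 + 2 * L \<sigma>) * ?n = ?n + L \<sigma> * ?n + L \<sigma> * ?n"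
            by (simp add: algebra_simps)
          ultimately show "1 + \<bar>\<rho> \<sigma> t\<bar> + norm (g \<sigma> t) \<le> (1 + 2 * L \<sigma>) * ?n"
            by linarith
        qed (use K(1) c(1) in auto)
        also have "\<dots> = K' * ?n"
          unfolding sum_distrib_right[symmetric] by (simp add: K'_def)
        finally show ?thesis .
      qed
      moreover have "0 \<le> K'"
        unfolding K'_def using K(1) c(1) L by (intro divide_nonneg_nonneg mult_nonneg_nonneg sum_nonneg) auto
      ultimately show ?thesis
        by blast
    qed
    then obtain K where K: "K \<ge> 0" "\<And>t. t \<in> {0..T} \<Longrightarrow> norm (rate g t) \<le> K * (1 + (norm (y t))\<^sup>2)"
      by blast
    have "rate g \<in> Lp_space T p"
      by (rule Lp_space_growth[OF has_densityD(1)[OF dens_g] that(2) K])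
    moreover have "x\<theta> \<in> Lp_space T p"
    proof -
      obtain B where B: "B > 0" "\<And>t. t \<in> {0..T} \<Longrightarrow> norm (x\<theta> t) \<le> B"
        using compact_imp_bounded[OF compact_continuous_image[OF x_cont]] unfolding bounded_pos by auto
      have "norm (x\<theta> t) \<le> B * (1 + (norm (y t))\<^sup>2)" if "t \<in> {0..T}" for t
      proof -
        have "B * 1 \<le> B * (1 + (norm (y t))\<^sup>2)"
          using B(1) by (intro mult_left_mono) auto
        then show ?thesis
          using B(2)[OF that] by simp
      qed
      then show ?thesis
        by (rule Lp_space_growth[OF absolutely_integrable_continuous_real[OF x_cont] that(2) less_imp_le[OF B(1)]])
    qed
    moreover have "has_weak_derivative T x\<theta> (rate g)"
      by (rule weak) (auto intro: has_density_subinterval[OF g_dens])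
    ultimately show ?thesis
      unfolding W1p_space_def by blast
  qed

  have weak_formula: "has_weak_derivative T x\<theta> (rate xh')"
    if "\<And>\<sigma>. \<sigma> \<in> S \<Longrightarrow> has_weak_derivative T (xh \<sigma>) (xh' \<sigma>)" for xh'
    by (rule weak) (rule weak_derivative_imp_has_density[OF that xh_cont])

  \<comment> \<open>For continuous \<open>y\<close> the density \<open>g\<close> is continuous, hence it is the classical derivative of \<open>xh\<close>.\<close>
  define xh_dot where "xh_dot \<sigma> s = vector_derivative (xh \<sigma>) (at s within {0..T})" for \<sigma> s
  have C1: "(x\<theta> has_vector_derivative rate xh_dot t) (at t within {0..T})" "continuous_on {0..T} (rate xh_dot)"
    if cont_y: "continuous_on {0..T} y" and t: "t \<in> {0..T}" for t
  proof -
    have g_cont: "continuous_on {0..T} (g \<sigma>)" if "\<sigma> \<in> S" for \<sigma>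
      unfolding g_def filter_rhs_def by (intro continuous_intros cont_y \<Pi>k_cont[OF that] xh_cont[OF that])
    have \<rho>_cont: "continuous_on {0..T} (\<rho> \<sigma>)" if "\<sigma> \<in> S" for \<sigma>
      unfolding \<rho>_def misfit_def wnorm_sq_def by (intro continuous_intros cont_y xh_cont[OF that])
    have xh_dot: "xh_dot \<sigma> s = g \<sigma> s" if "\<sigma> \<in> S" "s \<in> {0..T}" for \<sigma> s
      unfolding xh_dot_def using that T
      by (intro vector_derivative_within_closed_interval
          has_density_imp_has_vector_derivative[OF g_dens g_cont]) auto
    have rate: "rate g s = rate xh_dot s" if "s \<in> {0..T}" for s
      unfolding rate_def V_eq[OF that] bank.drift_def using that by (simp add: xh_dot)
    have "continuous_on {0..T} (\<lambda>t. M (fst (t, x\<theta> t)) (snd (t, x\<theta> t)))"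
      unfolding M_eq
      by (rule continuous_on_compose2[OF bank.M_continuous[OF order_refl order_refl]])
        (auto intro: continuous_intros x_cont)
    then have "continuous_on {0..T} (\<lambda>t. - (matrix_inv (M t (x\<theta> t)) *v bank.drift \<rho> g t (x\<theta> t)))"
      by (intro continuous_on_minus continuous_on_matrix_vector_mult continuous_on_matrix_inv
          bank.drift_continuous x_cont \<rho>_cont g_cont invertible) simp_all
    then have cont: "continuous_on {0..T} (rate g)"
      by (rule continuous_on_eq) (simp add: rate_def V_eq)
    then show "continuous_on {0..T} (rate xh_dot)"
      by (rule continuous_on_eq) (rule rate)
    show "(x\<theta> has_vector_derivative rate xh_dot t) (at t within {0..T})"
      using has_density_imp_has_vector_derivative[OF dens_g cont t] by (simp add: rate[OF t])
  qed
  show ?thesis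
  proof (intro conjI ballI allI impI)
    show "x\<theta> \<in> C1_space T" if "continuous_on {0..T} y"
      unfolding C1_space_def using C1[OF that] t0 by blast
    show "(x\<theta> has_vector_derivative - (matrix_inv (M t (x\<theta> t)) *v
        V (\<lambda>\<sigma> s. vector_derivative (xh \<sigma>) (at s within {0..T})) t (x\<theta> t))) (at t within {0..T})"
      if "continuous_on {0..T} y" "t \<in> {0..T}" for t
      using C1(1)[OF that] unfolding rate_def xh_dot_def[abs_def] .
    show "has_weak_derivative T x\<theta> (\<lambda>t. - (matrix_inv (M t (x\<theta> t)) *v V xh' t (x\<theta> t)))"
      if "\<forall>\<sigma>\<in>S. has_weak_derivative T (xh \<sigma>) (xh' \<sigma>)" for xh'
      using weak_formula[of xh'] that unfolding rate_def[abs_def] by blast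
    show "invertible (M t (x\<theta> t))" if "t \<in> {0..T}" for t
      by (rule invertible[OF that])
    show "x\<theta> \<in> W1p_space T p" if "1 \<le> p \<and> y \<in> Lp_space T (2 * p)" for p
      using that by (intro W1p) auto
  qed
qed

end
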